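(* Let $G=GL_3(F)$ and let $\sigma$ be an irreducible smooth $\overline{\mathbf{F}}_p$-representation of $K=GL_3(\mathfrak{o}_F)$, extended to $KZ$ by letting $\varpi$ act trivially. Then there exist non-zero $\mathcal{H}(IZ,\chi_\sigma)$-submodules of $(\mathrm{ind}^G_{KZ}\,\sigma)^{IZ,\chi_\sigma}$ of infinite codimension (as $\overline{\mathbf{F}}_p$-subspaces).
   Context: Let $F$ be a non-archimedean local field with ring of integers $\mathfrak{o}_F$, a fixed uniformizer $\varpi$, and residue field $k_F$ of characteristic $p$ and order $q$. Let $G=GL_3(F)$, $K=GL_3(\mathfrak{o}_F)$, and let $Z\cong F^\times$ be the center of $G$; $\varpi$ also denotes the corresponding scalar matrix. All representations are smooth over $\overline{\mathbf{F}}_p$. Let $I$ (resp. $I_1$) be the inverse image in $K$, under reduction $K\to GL_3(k_F)$, of the group of upper triangular matrices (resp. upper triangular unipotent matrices): the standard Iwahori (resp. pro-$p$-Iwahori) subgroup. For an irreducible smooth representation $\sigma$ of $K$, the space $\sigma^{I_1}$ is one-dimensional; $\chi_\sigma$ denotes the character by which $I$ acts on $\sigma^{I_1}$, extended to $IZ$ by $\chi_\sigma(\varpi)=1$. $\sigma$ is extended to $KZ$ by letting $\varpi$ act trivially. $\mathrm{ind}^G_{KZ}\sigma$ is the compact induction: the space of smooth functions $f:G\to\sigma$ with support compact modulo $Z$ and $f(kg)=\sigma(k)f(g)$ for $k\in KZ$, $g\in G$, with $G$ acting by right translation. For a character $\chi$ of $IZ$ with $\chi(\varpi)=1$, $\mathrm{ind}^G_{IZ}\chi$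 is defined in the same way, and for a representation $\pi$ of $G$, $\pi^{IZ,\chi}=\{v\in\pi : x v=\chi(x)v\ \forall x\in IZ\}$. $\mathcal{H}(IZ,\chi)=\mathrm{End}_G(\mathrm{ind}^G_{IZ}\chi)$. It acts on the right on $\pi^{IZ,\chi}\cong \mathrm{Hom}_G(\mathrm{ind}^G_{IZ}\chi,\pi)$ (Frobenius reciprocity) by composition. *)

theory Defs
  imports
    "HOL-Analysis.Analysis"
    "HOL-Library.Function_Algebras"
    "HOL-Algebra.QuotRing"
    "HOL-Algebra.Algebraic_Closure_Type"
    "Berlekamp_Zassenhaus.Finite_Field"
begin

unbundle no Formal_Power_Series.fps_syntax

section \<open>Non-archimedean local fields\<close>

text \<open>A local field is given by its normalized discrete valuation \<open>v\<close>. The value \<open>v 0\<close>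
  (mathematically \<open>\<infinity>\<close>) is junk and is never used. \<open>frac_ideal v n\<close> is the
  fractional ideal of elements of valuation at least \<open>n\<close>: the ring of integers is
  \<open>frac_ideal v 0\<close>, its maximal ideal is \<open>frac_ideal v 1\<close>.\<close>

definition frac_ideal :: "('f::field \<Rightarrow> int) \<Rightarrow> int \<Rightarrow> 'f set" where
  "frac_ideal v n = {x. x = 0 \<or> v x \<ge> n}"

definition integer_ring :: "('f::field \<Rightarrow> int) \<Rightarrow> 'f ring" where
  "integer_ring v = ring_of_type_algebra\<lparr>carrier := frac_ideal v 0\<rparr>"

definition residue_field :: "('f::field \<Rightarrow> int) \<Rightarrow> 'f set ring" where
  "residue_field v = integer_ring v Quot frac_ideal v 1"

definition residue_char :: "('f::field \<Rightarrow> int) \<Rightarrow> nat" where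
  "residue_char v = group.ord (add_monoid (residue_field v)) \<one>\<^bsub>residue_field v\<^esub>"

locale nonarch_local_field =
  fixes v :: "'f::field \<Rightarrow> int"
  assumes v_mult: "x \<noteq> 0 \<Longrightarrow> y \<noteq> 0 \<Longrightarrow> v (x * y) = v x + v y"
    and v_add: "x \<noteq> 0 \<Longrightarrow> y \<noteq> 0 \<Longrightarrow> x + y \<noteq> 0 \<Longrightarrow> v (x + y) \<ge> min (v x) (v y)"
    and v_normalized: "\<exists>x. x \<noteq> 0 \<and> v x = 1"
    and complete: "\<forall>n. \<exists>N. \<forall>i\<ge>N. \<forall>j\<ge>N. a i - a j \<in> frac_ideal v n \<Longrightarrow>
      \<exists>L. \<forall>n. \<exists>N::nat. \<forall>i\<ge>N. a i - L \<in> frac_ideal v n"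
    and finite_residue_field: "finite (carrier (residue_field v))"

definition uniformizer :: "('f::field \<Rightarrow> int) \<Rightarrow> 'f \<Rightarrow> bool" where
  "uniformizer v \<pi> \<longleftrightarrow> \<pi> \<noteq> 0 \<and> v \<pi> = 1"


section \<open>The group and its subgroups\<close>

definition GL3 :: "('f::field ^ 3 ^ 3) set" where
  "GL3 = {A. invertible A}"

definition GL3_int :: "('f::field \<Rightarrow> int) \<Rightarrow> ('f ^ 3 ^ 3) set" where
  "GL3_int v = {A. (\<forall>i j. A $ i $ j \<in> frac_ideal v 0) \<and>
     (\<exists>B. (\<forall>i j. B $ i $ j \<in> frac_ideal v 0) \<and> A ** B = mat 1 \<and> B ** A = mat 1)}"

text \<open>Rows and columns are indexed by \<open>1, 2, 3 :: 3\<close>, taken in this order; in the library's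
  order on the type \<open>3\<close> one has \<open>3 = 0 < 1\<close>, so entries are listed explicitly.\<close>

definition iwahori :: "('f::field \<Rightarrow> int) \<Rightarrow> ('f ^ 3 ^ 3) set" where
  "iwahori v = {A \<in> GL3_int v. A $ 2 $ 1 \<in> frac_ideal v 1 \<and>
     A $ 3 $ 1 \<in> frac_ideal v 1 \<and> A $ 3 $ 2 \<in> frac_ideal v 1}"

definition pro_p_iwahori :: "('f::field \<Rightarrow> int) \<Rightarrow> ('f ^ 3 ^ 3) set" where
  "pro_p_iwahori v = {A \<in> iwahori v. \<forall>i. A $ i $ i - 1 \<in> frac_ideal v 1}"

text \<open>\<open>H Z\<close>, where \<open>Z\<close> consists of the scalar matrices \<open>mat c\<close> with \<open>c \<noteq> 0\<close>.\<close>

definition times_center :: "('f::field ^ 3 ^ 3) set \<Rightarrow> ('f ^ 3 ^ 3) set" where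
  "times_center H = {h ** mat c | h c. h \<in> H \<and> c \<noteq> 0}"

text \<open>The topology of the space of matrices as the product of nine copies of the field. On
  \<open>GL3\<close> inversion is continuous, so the group topology is the subspace topology.\<close>

definition mat_topology :: "('f::field \<Rightarrow> int) \<Rightarrow> ('f ^ 3 ^ 3) topology" where
  "mat_topology v = topology (\<lambda>U. \<forall>A\<in>U. \<exists>n. \<forall>B.
     (\<forall>i j. B $ i $ j - A $ i $ j \<in> frac_ideal v n) \<longrightarrow> B \<in> U)"

lemma openin_mat_topology:
  fixes v :: "'f::field \<Rightarrow> int"
  shows "openin (mat_topology v) U \<longleftrightarrow>
     (\<forall>A\<in>U. \<exists>n. \<forall>B. (\<forall>i j. B $ i $ j - A $ i $ j \<in> frac_ideal v n) \<longrightarrow> B \<in> U)"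
proof -
  have mono: "x \<in> frac_ideal v m" if "x \<in> frac_ideal v (max m n)" for x m n
    using that by (auto simp: frac_ideal_def)
  have mono': "x \<in> frac_ideal v n" if "x \<in> frac_ideal v (max m n)" for x m n
    using that by (auto simp: frac_ideal_def)
  have "istopology (\<lambda>U :: ('f ^ 3 ^ 3) set. \<forall>A\<in>U. \<exists>n. \<forall>B.
     (\<forall>i j. B $ i $ j - A $ i $ j \<in> frac_ideal v n) \<longrightarrow> B \<in> U)" (is "istopology ?P")
    unfolding istopology_def
  proof (intro conjI allI impI)
    fix S T assume ST: "?P S" "?P T"
    show "?P (S \<inter> T)"
    proof
      fix A assume A: "A \<in> S \<inter> T"
      obtain m where m: "\<And>B. (\<forall>i j. B $ i $ j - A $ i $ j \<in> frac_ideal v m) \<Longrightarrow> B \<in> S"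
        using ST A by blast
      obtain n where n: "\<And>B. (\<forall>i j. B $ i $ j - A $ i $ j \<in> frac_ideal v n) \<Longrightarrow> B \<in> T"
        using ST A by blast
      show "\<exists>n. \<forall>B. (\<forall>i j. B $ i $ j - A $ i $ j \<in> frac_ideal v n) \<longrightarrow> B \<in> S \<inter> T"
        using m n mono mono' by (intro exI[of _ "max m n"]) blast
    qed
  next
    fix \<K> assume "\<forall>K\<in>\<K>. ?P K"
    then show "?P (\<Union>\<K>)" by (meson UnionE UnionI)
  qed
  then show ?thesis by (simp only: mat_topology_def topology_inverse')
qed

definition GL3_topology :: "('f::field \<Rightarrow> int) \<Rightarrow> ('f ^ 3 ^ 3) topology" where
  "GL3_topology v = subtopology (mat_topology v) GL3"


section \<open>Representations\<close>

definition is_representation ::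
    "('k::field \<Rightarrow> 'v::ab_group_add \<Rightarrow> 'v) \<Rightarrow> ('f::field ^ 3 ^ 3) set \<Rightarrow>
     ('f ^ 3 ^ 3 \<Rightarrow> 'v \<Rightarrow> 'v) \<Rightarrow> bool" where
  "is_representation smul H \<rho> \<longleftrightarrow>
     (\<forall>g\<in>H. Vector_Spaces.linear smul smul (\<rho> g)) \<and>
     \<rho> (mat 1) = id \<and> (\<forall>g\<in>H. \<forall>h\<in>H. \<rho> (g ** h) = \<rho> g \<circ> \<rho> h)"

definition smooth_representation ::
    "('f::field \<Rightarrow> int) \<Rightarrow> ('f ^ 3 ^ 3) set \<Rightarrow> ('f ^ 3 ^ 3 \<Rightarrow> 'v \<Rightarrow> 'v) \<Rightarrow> bool" where
  "smooth_representation v H \<rho> \<longleftrightarrow>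
     (\<forall>w. openin (subtopology (GL3_topology v) H) {h \<in> H. \<rho> h w = w})"

definition irreducible_representation ::
    "('k::field \<Rightarrow> 'v::ab_group_add \<Rightarrow> 'v) \<Rightarrow> ('f::field ^ 3 ^ 3) set \<Rightarrow>
     ('f ^ 3 ^ 3 \<Rightarrow> 'v \<Rightarrow> 'v) \<Rightarrow> bool" where
  "irreducible_representation smul H \<rho> \<longleftrightarrow>
     (UNIV :: 'v set) \<noteq> {0} \<and>
     (\<forall>W. module.subspace smul W \<and> (\<forall>g\<in>H. \<rho> g ` W \<subseteq> W) \<longrightarrow> W = {0} \<or> W = UNIV)"

text \<open>Extension of a function \<open>f\<close> on \<open>H\<close> (for \<open>H = K\<close> or \<open>H = I\<close>) to \<open>H Z\<close> by letting the
  scalar matrix \<open>\<pi>\<close> act trivially: \<open>H Z\<close> is the direct product of \<open>H\<close> and the powers of \<open>\<pi>\<close>,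
  and the extension sends \<open>h \<pi>\<^sup>n\<close> to \<open>f h\<close>.\<close>

definition extend_trivially ::
    "'f::field \<Rightarrow> ('f ^ 3 ^ 3) set \<Rightarrow> ('f ^ 3 ^ 3 \<Rightarrow> 'b) \<Rightarrow> 'f ^ 3 ^ 3 \<Rightarrow> 'b" where
  "extend_trivially \<pi> H f g = f (THE h. h \<in> H \<and> (\<exists>n::int. g = h ** mat (\<pi> powi n)))"

lemma GL3_int_uniformizer_power_unique:
  fixes v :: "'f::field \<Rightarrow> int"
  assumes "nonarch_local_field v" "uniformizer v \<pi>"
    and hh: "h \<in> GL3_int v" "h' \<in> GL3_int v"
    and eq: "h ** mat (\<pi> powi m) = h' ** mat (\<pi> powi n)"
  shows "h = h'"
proof -
  interpret nonarch_local_field v by fact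
  have pi: "\<pi> \<noteq> 0" "v \<pi> = 1" using assms(2) by (auto simp: uniformizer_def)
  have v1: "v 1 = 0" using v_mult[of 1 1] by simp
  have vpow: "v (\<pi> ^ k) = int k" for k
    using pi v1 by (induction k) (auto simp: v_mult)
  have mat_entry: "(A ** mat c) $ i $ j = A $ i $ j * c" for A :: "'f ^ 3 ^ 3" and c i j
    by (simp add: matrix_matrix_mult_def mat_def if_distrib sum.delta cong: if_cong)
  have ideal_add: "x + y \<in> frac_ideal v 1" if "x \<in> frac_ideal v 1" "y \<in> frac_ideal v 1" for x y
    using that v_add[of x y] by (cases "x = 0 \<or> y = 0 \<or> x + y = 0") (auto simp: frac_ideal_def)
  have ideal_mult: "x * y \<in> frac_ideal v 1" if "x \<in> frac_ideal v 1" "y \<in> frac_ideal v 0" for x y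
    using that v_mult[of x y] by (cases "x = 0 \<or> y = 0") (auto simp: frac_ideal_def)
  have no_shift: False
    if AB: "A \<in> GL3_int v" "B \<in> GL3_int v" "A = B ** mat (\<pi> ^ Suc k)" for A B :: "'f ^ 3 ^ 3" and k
  proof -
    obtain C where C: "\<And>i j. C $ i $ j \<in> frac_ideal v 0" "A ** C = mat 1"
      using AB(1) unfolding GL3_int_def by blast
    have B: "B $ i $ j \<in> frac_ideal v 0" for i j using AB(2) by (auto simp: GL3_int_def)
    have A: "A $ i $ j \<in> frac_ideal v 1" for i j
      using B[of i j] pi v_mult[of "B $ i $ j" "\<pi> ^ Suc k"] vpow[of "Suc k"]
      by (cases "B $ i $ j = 0") (auto simp: AB(3) mat_entry frac_ideal_def)
    have "(A ** C) $ 1 $ 1 \<in> frac_ideal v 1"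
      unfolding matrix_matrix_mult_def by (auto simp: sum_3 intro!: ideal_add ideal_mult A C)
    then show False using C v1 by (simp add: mat_def frac_ideal_def)
  qed
  have key: "A = B ** mat (\<pi> ^ nat (l - k))"
    if "A ** mat (\<pi> powi k) = B ** mat (\<pi> powi l)" "k \<le> l" for A B :: "'f ^ 3 ^ 3" and k l
  proof -
    have "A $ i $ j * \<pi> powi k = B $ i $ j * \<pi> powi l" for i j
      using that(1) mat_entry by metis
    moreover have "\<pi> powi l = \<pi> ^ nat (l - k) * \<pi> powi k"
      using that(2) pi power_int_add[of \<pi> "l - k" k] by (simp add: power_int_def)
    ultimately have "A $ i $ j = B $ i $ j * \<pi> ^ nat (l - k)" for i j
      using pi by (simp add: mult.assoc[symmetric])
    then show ?thesis by (simp add: vec_eq_iff mat_entry)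
  qed
  show ?thesis
  proof (cases m n rule: linorder_cases)
    case less
    then show ?thesis
      using no_shift[OF hh, of "nat (n - m) - 1"] key[OF eq] by simp
  next
    case equal
    then show ?thesis using key[OF eq] by simp
  next
    case greater
    then show ?thesis
      using no_shift[OF hh(2,1), of "nat (m - n) - 1"] key[OF eq[symmetric]] by simp
  qed
qed

lemma extend_trivially_eq:
  assumes "nonarch_local_field v" "uniformizer v \<pi>" "H \<subseteq> GL3_int v" "h \<in> H"
  shows "extend_trivially \<pi> H f (h ** mat (\<pi> powi n)) = f h"
proof -
  have "(THE h'. h' \<in> H \<and> (\<exists>m. h ** mat (\<pi> powi n) = h' ** mat (\<pi> powi m))) = h"
    using assms GL3_int_uniformizer_power_unique[OF assms(1,2)]
    by (intro the_equality) blast+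
  then show ?thesis by (simp add: extend_trivially_def)
qed

text \<open>The function \<open>\<chi>\<^sub>\<sigma>\<close> on \<open>I\<close> by which \<open>I\<close> acts on the line of \<open>I\<^sub>1\<close>-invariants.\<close>

definition invariants :: "('f::field ^ 3 ^ 3) set \<Rightarrow> ('f ^ 3 ^ 3 \<Rightarrow> 'v \<Rightarrow> 'v) \<Rightarrow> 'v set" where
  "invariants H \<rho> = {w. \<forall>h\<in>H. \<rho> h w = w}"

definition invariant_character ::
    "('f::field \<Rightarrow> int) \<Rightarrow> ('k::field \<Rightarrow> 'v::ab_group_add \<Rightarrow> 'v) \<Rightarrow>
     ('f ^ 3 ^ 3 \<Rightarrow> 'v \<Rightarrow> 'v) \<Rightarrow> 'f ^ 3 ^ 3 \<Rightarrow> 'k" where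
  "invariant_character v smul \<sigma> g =
     (THE c. \<forall>w \<in> invariants (pro_p_iwahori v) \<sigma>. \<sigma> g w = smul c w)"


section \<open>Compact induction\<close>

text \<open>Functions on \<open>GL3\<close> are represented by functions on all matrices vanishing outside \<open>GL3\<close>.
  Smooth means locally constant, i.e. continuous for the discrete topology on the target; support
  compact modulo \<open>Z\<close> means support contained in \<open>C Z\<close> for a compact subset \<open>C\<close> of \<open>GL3\<close>.\<close>

definition compact_induction ::
    "('f::field \<Rightarrow> int) \<Rightarrow> ('f ^ 3 ^ 3) set \<Rightarrow> ('f ^ 3 ^ 3 \<Rightarrow> 'v \<Rightarrow> 'v) \<Rightarrow>
     ('f ^ 3 ^ 3 \<Rightarrow> 'v::ab_group_add) set" where
  "compact_induction v H \<tau> = {f.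
     (\<forall>g. g \<notin> GL3 \<longrightarrow> f g = 0) \<and>
     continuous_map (GL3_topology v) (discrete_topology UNIV) f \<and>
     (\<exists>C. compactin (GL3_topology v) C \<and> {g \<in> GL3. f g \<noteq> 0} \<subseteq> times_center C) \<and>
     (\<forall>h\<in>H. \<forall>g\<in>GL3. f (h ** g) = \<tau> h (f g))}"

definition fun_scale :: "('k \<Rightarrow> 'v \<Rightarrow> 'v) \<Rightarrow> 'k \<Rightarrow> ('a \<Rightarrow> 'v) \<Rightarrow> 'a \<Rightarrow> 'v" where
  "fun_scale smul c f = (\<lambda>x. smul c (f x))"

lemma vector_space_fun_scale:
  assumes "vector_space smul"
  shows "vector_space (fun_scale smul :: 'k::field \<Rightarrow> ('a \<Rightarrow> 'v::ab_group_add) \<Rightarrow> 'a \<Rightarrow> 'v)"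
proof -
  interpret vector_space smul by fact
  show ?thesis
    by unfold_locales (auto simp: fun_scale_def fun_eq_iff scale_right_distrib scale_left_distrib)
qed

definition right_translation :: "'f::field ^ 3 ^ 3 \<Rightarrow> ('f ^ 3 ^ 3 \<Rightarrow> 'v) \<Rightarrow> 'f ^ 3 ^ 3 \<Rightarrow> 'v" where
  "right_translation g f = (\<lambda>x. f (x ** g))"

definition ind_KZ ::
    "('f::field \<Rightarrow> int) \<Rightarrow> 'f \<Rightarrow> ('f ^ 3 ^ 3 \<Rightarrow> 'v::ab_group_add \<Rightarrow> 'v) \<Rightarrow>
     ('f ^ 3 ^ 3 \<Rightarrow> 'v) set" where
  "ind_KZ v \<pi> \<sigma> =
     compact_induction v (times_center (GL3_int v)) (extend_trivially \<pi> (GL3_int v) \<sigma>)"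

definition ind_IZ ::
    "('f::field \<Rightarrow> int) \<Rightarrow> ('f ^ 3 ^ 3 \<Rightarrow> 'k::field) \<Rightarrow> ('f ^ 3 ^ 3 \<Rightarrow> 'k) set" where
  "ind_IZ v chi = compact_induction v (times_center (iwahori v)) (\<lambda>h c. chi h * c)"


section \<open>Iwahori--Hecke modules\<close>

text \<open>In this section a representation of \<open>GL3\<close> is given by a subspace \<open>W\<close> of an ambient vector
  space (with scalar multiplication \<open>smul\<close>) and an action \<open>act\<close> preserving \<open>W\<close>; morphisms are
  \<open>extensional\<close>, so that they are determined by their values on \<open>W\<close>.\<close>

definition Hom_GL3 ::
    "('k \<Rightarrow> 'a \<Rightarrow> 'a) \<Rightarrow> ('f::field ^ 3 ^ 3 \<Rightarrow> 'a \<Rightarrow> 'a) \<Rightarrow> 'a::ab_group_add set \<Rightarrow>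
     ('k \<Rightarrow> 'b \<Rightarrow> 'b) \<Rightarrow> ('f ^ 3 ^ 3 \<Rightarrow> 'b \<Rightarrow> 'b) \<Rightarrow> 'b::ab_group_add set \<Rightarrow> ('a \<Rightarrow> 'b) set" where
  "Hom_GL3 smul act W smul' act' W' = {\<phi> \<in> W \<rightarrow>\<^sub>E W'.
     (\<forall>x\<in>W. \<forall>y\<in>W. \<phi> (x + y) = \<phi> x + \<phi> y) \<and>
     (\<forall>c. \<forall>x\<in>W. \<phi> (smul c x) = smul' c (\<phi> x)) \<and>
     (\<forall>g\<in>GL3. \<forall>x\<in>W. \<phi> (act g x) = act' g (\<phi> x))}"

definition hecke_algebra ::
    "('f::field \<Rightarrow> int) \<Rightarrow> ('f ^ 3 ^ 3 \<Rightarrow> 'k::field) \<Rightarrow>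
     (('f ^ 3 ^ 3 \<Rightarrow> 'k) \<Rightarrow> ('f ^ 3 ^ 3 \<Rightarrow> 'k)) set" where
  "hecke_algebra v chi = Hom_GL3 (fun_scale (*)) right_translation (ind_IZ v chi)
     (fun_scale (*)) right_translation (ind_IZ v chi)"

definition eigenspace_IZ ::
    "('f::field \<Rightarrow> int) \<Rightarrow> ('f ^ 3 ^ 3 \<Rightarrow> 'k::field) \<Rightarrow>
     ('k \<Rightarrow> 'a \<Rightarrow> 'a) \<Rightarrow> ('f ^ 3 ^ 3 \<Rightarrow> 'a \<Rightarrow> 'a) \<Rightarrow> 'a set \<Rightarrow> 'a set" where
  "eigenspace_IZ v chi smul act W =
     {w \<in> W. \<forall>x \<in> times_center (iwahori v). act x w = smul (chi x) w}"

text \<open>Frobenius reciprocity identifies \<open>Hom\<^sub>G(ind chi, W)\<close> with the \<open>(IZ, chi)\<close>-eigenspace of \<open>W\<close>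
  through evaluation at the function that is \<open>chi\<close> on \<open>IZ\<close> and vanishes elsewhere. The right action
  of an endomorphism \<open>T\<close> is precomposition, transported along this bijection.\<close>

definition frobenius_vector ::
    "('f::field \<Rightarrow> int) \<Rightarrow> ('f ^ 3 ^ 3 \<Rightarrow> 'k::field) \<Rightarrow> 'f ^ 3 ^ 3 \<Rightarrow> 'k" where
  "frobenius_vector v chi g = (if g \<in> times_center (iwahori v) then chi g else 0)"

definition hecke_action ::
    "('f::field \<Rightarrow> int) \<Rightarrow> ('f ^ 3 ^ 3 \<Rightarrow> 'k::field) \<Rightarrow>
     ('k \<Rightarrow> 'a \<Rightarrow> 'a) \<Rightarrow> ('f ^ 3 ^ 3 \<Rightarrow> 'a \<Rightarrow> 'a) \<Rightarrow> 'a::ab_group_add set \<Rightarrow>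
     'a \<Rightarrow> (('f ^ 3 ^ 3 \<Rightarrow> 'k) \<Rightarrow> ('f ^ 3 ^ 3 \<Rightarrow> 'k)) \<Rightarrow> 'a" where
  "hecke_action v chi smul act W w T =
     (let frob = (\<lambda>\<phi>. \<phi> (frobenius_vector v chi));
          \<phi> = the_inv_into
                (Hom_GL3 (fun_scale (*)) right_translation (ind_IZ v chi) smul act W) frob w
      in frob (compose (ind_IZ v chi) \<phi> T))"

definition hecke_submodule ::
    "('f::field \<Rightarrow> int) \<Rightarrow> ('f ^ 3 ^ 3 \<Rightarrow> 'k::field) \<Rightarrow>
     ('k \<Rightarrow> 'a \<Rightarrow> 'a) \<Rightarrow> ('f ^ 3 ^ 3 \<Rightarrow> 'a \<Rightarrow> 'a) \<Rightarrow> 'a::ab_group_add set \<Rightarrow> 'a set \<Rightarrow> bool" where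
  "hecke_submodule v chi smul act W M \<longleftrightarrow>
     module.subspace smul M \<and> M \<subseteq> eigenspace_IZ v chi smul act W \<and>
     (\<forall>w\<in>M. \<forall>T \<in> hecke_algebra v chi. hecke_action v chi smul act W w T \<in> M)"

text \<open>\<open>E / M\<close> is infinite-dimensional: no finite subset of \<open>E\<close> spans it.\<close>

definition infinite_codimension ::
    "('k::field \<Rightarrow> 'a \<Rightarrow> 'a) \<Rightarrow> 'a::ab_group_add set \<Rightarrow> 'a set \<Rightarrow> bool" where
  "infinite_codimension smul E M \<longleftrightarrow>
     \<not> (\<exists>B. finite B \<and> B \<subseteq> E \<and> E \<subseteq> module.span smul (M \<union> B))"

end

theory Submission
  imports Defs
begin

text \<open>Let \<open>m\<close> span the line of \<open>I\<^sub>1\<close>-invariants of \<open>\<sigma>\<close> and let \<open>\<phi>\<close> be the functional on \<open>\<sigma>\<close> that is invariant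
  under the opposite group and satisfies \<open>\<phi> m = 1\<close>. With \<open>t = diag(1, \<pi>, \<pi>\<^sup>2)\<close>, the kernel supported on \<open>KZ t K\<close>
  with value \<open>\<lambda>w. \<phi> w m\<close> at \<open>t\<close> defines an endomorphism \<open>T\<close> of \<open>ind \<sigma>\<close>, and the submodule is the image under \<open>T\<close>
  of the eigenspace. Measure the distance from \<open>KZ g\<close> to \<open>KZ\<close> by the least \<open>n\<close> such that, up to scaling, \<open>g\<close> is
  integral and \<open>\<pi>\<^sup>n\<close> times its inverse is integral. Then \<open>T\<close> raises the maximal distance in the support by
  exactly 2, but never creates a value of maximal distance on the wall of the dominant chamber through
  \<open>diag(1, 1, \<pi>\<^sup>n)\<close>. Hence \<open>T\<close> is injective, and eigenfunctions supported on the double cosets of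
  \<open>diag(1, 1, \<pi>\<^sup>n)\<close> are linearly independent modulo the image.

  The existence of \<open>m\<close> and \<open>\<phi>\<close> and the one-dimensionality of the invariants come from the Hecke operators
  attached to the simple reflections: a simultaneous eigenvector generates \<open>\<sigma>\<close> already under the opposite
  unipotent group, hence is not killed by \<open>\<phi>\<close>, while the kernel of \<open>\<phi>\<close> on the invariants is stable under
  these operators.\<close>

text \<open>Two features of the regular coweight (0, 1, 2) of \<open>t\<close> drive the argument.
  First, modulo the maximal ideal the group K \<inter> t K t^-1 is upper triangular, while its
  conjugate by t^-1 is lower triangular with the same diagonal. So the rank-one map made of an upper
  invariant vector and a lower invariant functional intertwines the two actions of this group for
  every weight, and the kernel of \<open>T\<close> is well defined whatever \<sigma> is. Second,
  adding a regular dominant coweight to a dominant one leads off the walls: (0, 0, n) is the sum of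
  (0, 1, 2) and (0, -1, n - 2), but the latter already has height n - 1 instead of n - 2. This keeps
  the leading part of \<open>T f\<close> away from the wall. Since \<open>T\<close> commutes with G,
  it commutes with the Hecke action as soon as that action is written as a sum over cosets of IZ. As
  \<sigma> is not given as finite-dimensional, fixed vectors and eigenvectors are extracted from
  commuting operators of finite order over an algebraically closed field, and integrality arguments
  use lattices of matrices instead of determinants.\<close>

section \<open>Matrices of size three over a field\<close>

definition mat_lattice :: "('f::field \<Rightarrow> int) \<Rightarrow> int \<Rightarrow> ('f ^ 3 ^ 3) set" where
  "mat_lattice v n = {A. \<forall>i j. A $ i $ j \<in> frac_ideal v n}"

definition mat3 :: "'a \<Rightarrow> 'a \<Rightarrow> 'a \<Rightarrow> 'a \<Rightarrow> 'a \<Rightarrow> 'a \<Rightarrow> 'a \<Rightarrow> 'a \<Rightarrow> 'a \<Rightarrow> 'a::zero ^ 3 ^ 3" where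
  "mat3 a b c d e f g h i = vector [vector [a, b, c], vector [d, e, f], vector [g, h, i]]"

lemma mat3_nth [simp]:
  "mat3 a b c d e f g h i $ 1 $ 1 = a" "mat3 a b c d e f g h i $ 1 $ 2 = b"
  "mat3 a b c d e f g h i $ 1 $ 3 = c" "mat3 a b c d e f g h i $ 2 $ 1 = d"
  "mat3 a b c d e f g h i $ 2 $ 2 = e" "mat3 a b c d e f g h i $ 2 $ 3 = f"
  "mat3 a b c d e f g h i $ 3 $ 1 = g" "mat3 a b c d e f g h i $ 3 $ 2 = h"
  "mat3 a b c d e f g h i $ 3 $ 3 = i"
  by (simp_all add: mat3_def)

lemma mat3_eq_iff: "(A :: 'a::zero ^ 3 ^ 3) = B \<longleftrightarrow>
    A $ 1 $ 1 = B $ 1 $ 1 \<and> A $ 1 $ 2 = B $ 1 $ 2 \<and> A $ 1 $ 3 = B $ 1 $ 3 \<and>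
    A $ 2 $ 1 = B $ 2 $ 1 \<and> A $ 2 $ 2 = B $ 2 $ 2 \<and> A $ 2 $ 3 = B $ 2 $ 3 \<and>
    A $ 3 $ 1 = B $ 3 $ 1 \<and> A $ 3 $ 2 = B $ 3 $ 2 \<and> A $ 3 $ 3 = B $ 3 $ 3"
  by (simp add: vec_eq_iff forall_3)

lemma mat_mult3: "((A :: 'a::semiring_1 ^ 3 ^ 3) ** B) $ i $ j
    = A $ i $ 1 * B $ 1 $ j + A $ i $ 2 * B $ 2 $ j + A $ i $ 3 * B $ 3 $ j"
  by (simp add: matrix_matrix_mult_def sum_3)

lemma mat_nth: "(mat c :: 'a::zero ^ 3 ^ 3) $ i $ j = (if i = j then c else 0)"
  by (simp add: mat_def)

lemma mat_mult_scalar: "((A :: 'a::comm_semiring_1 ^ 3 ^ 3) ** mat c) $ i $ j = c * A $ i $ j"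
  by (simp add: matrix_matrix_mult_def mat_def if_distrib sum.delta mult.commute cong: if_cong)

lemma scalar_mult_mat: "(mat c ** (A :: 'a::comm_semiring_1 ^ 3 ^ 3)) $ i $ j = c * A $ i $ j"
proof -
  have "(\<Sum>k\<in>UNIV. (if i = k then c else 0) * A $ k $ j) = (\<Sum>k\<in>UNIV. if k = i then c * A $ k $ j else 0)"
    by (intro sum.cong) auto
  then show ?thesis by (simp add: matrix_matrix_mult_def mat_def)
qed

lemma mat_scalar_commute: "mat c ** (A :: 'a::comm_semiring_1 ^ 3 ^ 3) = A ** mat c"
  by (simp add: vec_eq_iff mat_mult_scalar scalar_mult_mat)

lemma mat_mat_mult: "(mat c :: 'a::comm_semiring_1 ^ 3 ^ 3) ** mat d = mat (c * d)"
  unfolding vec_eq_iff mat_mult_scalar by (simp add: mat_def mult.commute)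

lemma matrix_inv_unique:
  fixes A :: "'a::field ^ 3 ^ 3"
  assumes "A ** B = mat 1"
  shows "matrix_inv A = B" "B ** A = mat 1"
proof -
  show BA: "B ** A = mat 1" using assms matrix_left_right_inverse by blast
  then have "A ** matrix_inv A = mat 1 \<and> matrix_inv A ** A = mat 1"
    unfolding matrix_inv_def
    using assms someI[of "\<lambda>A'. A ** A' = mat 1 \<and> A' ** A = mat 1" B] by blast
  then have "B ** A ** matrix_inv A = B"
    by (simp add: matrix_mul_assoc[symmetric])
  then show "matrix_inv A = B" using BA by simp
qed

lemma GL3_inv:
  fixes g :: "'a::field ^ 3 ^ 3"
  assumes "g \<in> GL3"
  shows "g ** matrix_inv g = mat 1" "matrix_inv g ** g = mat 1" "matrix_inv g \<in> GL3"
    "matrix_inv (matrix_inv g) = g"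
proof -
  obtain B where B: "g ** B = mat 1" "B ** g = mat 1"
    using assms by (auto simp: GL3_def invertible_def)
  then show "g ** matrix_inv g = mat 1" "matrix_inv g ** g = mat 1" "matrix_inv g \<in> GL3"
    "matrix_inv (matrix_inv g) = g"
    using matrix_inv_unique[of g B] matrix_inv_unique[of B g]
    by (auto simp: GL3_def invertible_def)
qed

lemma GL3_inv_cancel:
  fixes g :: "'a::field ^ 3 ^ 3"
  assumes "g \<in> GL3"
  shows "g ** (matrix_inv g ** A) = A" "matrix_inv g ** (g ** A) = A"
    "(A ** g) ** matrix_inv g = A" "(A ** matrix_inv g) ** g = A"
  by (simp_all add: matrix_mul_assoc[of g "matrix_inv g" A] matrix_mul_assoc[of "matrix_inv g" g A]
      matrix_mul_assoc[of A g "matrix_inv g", symmetric]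
      matrix_mul_assoc[of A "matrix_inv g" g, symmetric] GL3_inv[OF assms])

lemma GL3_I: "A ** B = mat 1 \<Longrightarrow> (A :: 'a::field ^ 3 ^ 3) \<in> GL3"
  unfolding GL3_def invertible_def using matrix_inv_unique(2) by blast

lemma GL3_one [simp]: "mat 1 \<in> (GL3 :: ('a::field ^ 3 ^ 3) set)"
  by (rule GL3_I[of _ "mat 1"]) simp

lemma GL3_mult: "g \<in> GL3 \<Longrightarrow> h \<in> GL3 \<Longrightarrow> (g ** h :: 'a::field ^ 3 ^ 3) \<in> GL3"
  by (simp add: GL3_def invertible_mult)

lemma GL3_mult_left_iff: "h \<in> GL3 \<Longrightarrow> (h ** g :: 'a::field ^ 3 ^ 3) \<in> GL3 \<longleftrightarrow> g \<in> GL3"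
  using GL3_mult[of h g] GL3_mult[of "matrix_inv h" "h ** g"] by (auto simp: GL3_inv GL3_inv_cancel)

lemma GL3_mult_right_iff: "h \<in> GL3 \<Longrightarrow> (g ** h :: 'a::field ^ 3 ^ 3) \<in> GL3 \<longleftrightarrow> g \<in> GL3"
  using GL3_mult[of g h] GL3_mult[of "g ** h" "matrix_inv h"] by (auto simp: GL3_inv GL3_inv_cancel)

lemma matrix_inv_mult: "g \<in> GL3 \<Longrightarrow> h \<in> GL3 \<Longrightarrow>
    matrix_inv (g ** h :: 'a::field ^ 3 ^ 3) = matrix_inv h ** matrix_inv g"
  by (rule matrix_inv_unique) (simp add: matrix_mul_assoc GL3_inv_cancel GL3_inv)

lemma matrix_inv_one [simp]: "matrix_inv (mat 1 :: 'a::field ^ 3 ^ 3) = mat 1"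
  by (rule matrix_inv_unique) simp

lemma GL3_scalar: "c \<noteq> 0 \<Longrightarrow> (mat c :: 'a::field ^ 3 ^ 3) \<in> GL3"
  by (rule GL3_I[of _ "mat (inverse c)"]) (simp add: mat_mat_mult)

lemma matrix_inv_scalar: "c \<noteq> 0 \<Longrightarrow> matrix_inv (mat c :: 'a::field ^ 3 ^ 3) = mat (inverse c)"
  by (rule matrix_inv_unique) (simp add: mat_mat_mult)

lemma transpose_inv:
  fixes g :: "'a::field ^ 3 ^ 3"
  assumes "g \<in> GL3"
  shows "transpose g \<in> GL3" "matrix_inv (transpose g) = transpose (matrix_inv g)"
  using matrix_inv_unique[of "transpose g" "transpose (matrix_inv g)"] GL3_inv[OF assms]
    GL3_I[of "transpose g" "transpose (matrix_inv g)"]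
  by (simp_all flip: matrix_transpose_mul)

section \<open>The valuation, lattices of matrices and the maximal compact subgroup\<close>

context nonarch_local_field
begin

abbreviation D :: "int \<Rightarrow> 'f set" where "D \<equiv> frac_ideal v"

abbreviation L :: "int \<Rightarrow> ('f ^ 3 ^ 3) set" where "L \<equiv> mat_lattice v"

lemma v_one: "v 1 = 0"
  using v_mult[of 1 1] by simp

lemma v_uminus: "v (- x) = v x"
proof (cases "x = 0")
  case False
  have "v (- 1) = 0" using v_mult[of "- 1" "- 1"] v_one by simp
  then show ?thesis using False v_mult[of "- 1" x] by simp
qed simp

lemma v_inverse: "x \<noteq> 0 \<Longrightarrow> v (inverse x) = - v x"
  using v_mult[of x "inverse x"] v_one by simp

lemma v_powi: "x \<noteq> 0 \<Longrightarrow> v (x powi n) = n * v x"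
proof -
  assume x: "x \<noteq> 0"
  have "v (x ^ k) = int k * v x" for k
    using x by (induction k) (auto simp: v_one v_mult algebra_simps)
  then show ?thesis using x by (simp add: power_int_def v_inverse power_inverse)
qed

lemma D_zero [simp]: "0 \<in> D n"
  by (simp add: frac_ideal_def)

lemma D_add: "x \<in> D n \<Longrightarrow> y \<in> D n \<Longrightarrow> x + y \<in> D n"
  using v_add[of x y] by (cases "x = 0 \<or> y = 0 \<or> x + y = 0") (auto simp: frac_ideal_def)

lemma D_uminus [simp]: "- x \<in> D n \<longleftrightarrow> x \<in> D n"
  by (simp add: frac_ideal_def v_uminus)

lemma D_diff: "x \<in> D n \<Longrightarrow> y \<in> D n \<Longrightarrow> x - y \<in> D n"
  using D_add[of x n "- y"] by simp

lemma D_diff_commute: "x - y \<in> D n \<longleftrightarrow> y - x \<in> D n"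
  using D_uminus[of "x - y" n] by simp

lemma D_diff_trans: "x - y \<in> D n \<Longrightarrow> y - z \<in> D n \<Longrightarrow> x - z \<in> D n"
  using D_add[of "x - y" n "y - z"] by simp

lemma D_mult: "x \<in> D m \<Longrightarrow> y \<in> D n \<Longrightarrow> x * y \<in> D (m + n)"
  using v_mult[of x y] by (cases "x = 0 \<or> y = 0") (auto simp: frac_ideal_def)

lemma D_mono: "x \<in> D n \<Longrightarrow> m \<le> n \<Longrightarrow> x \<in> D m"
  by (auto simp: frac_ideal_def)

lemma D_mult0: "x \<in> D n \<Longrightarrow> y \<in> D 0 \<Longrightarrow> x * y \<in> D n" "y \<in> D 0 \<Longrightarrow> x \<in> D n \<Longrightarrow> y * x \<in> D n"
  using D_mult[of x n y 0] D_mult[of y 0 x n] by auto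

lemma one_D: "1 \<in> D n \<longleftrightarrow> n \<le> 0"
  by (auto simp: frac_ideal_def v_one)

lemma one_D0 [simp]: "1 \<in> D 0" "1 \<notin> D 1"
  by (simp_all add: one_D)

lemma D01: "x \<in> D 1 \<Longrightarrow> x \<in> D 0"
  by (rule D_mono[of _ 1]) auto

lemma unit_iff: "x \<in> D 0 \<and> x \<notin> D 1 \<longleftrightarrow> x \<noteq> 0 \<and> v x = 0"
  by (auto simp: frac_ideal_def)

lemma unit_inverse: "x \<in> D 0 \<Longrightarrow> x \<notin> D 1 \<Longrightarrow> inverse x \<in> D 0 \<and> inverse x \<notin> D 1 \<and> x \<noteq> 0"
  using unit_iff[of x] unit_iff[of "inverse x"] v_inverse[of x] by auto

lemma D_cancel: "x \<notin> D (a + 1) \<Longrightarrow> x * y \<in> D (a + b) \<Longrightarrow> y \<in> D b"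
  using v_mult[of x y] by (cases "y = 0") (auto simp: frac_ideal_def)

lemma D_cancel_unit: "x \<notin> D 1 \<Longrightarrow> x * y \<in> D b \<Longrightarrow> y \<in> D b"
  using D_cancel[of x 0 y b] by simp

lemma unit_mult: "x \<in> D 0 \<Longrightarrow> x \<notin> D 1 \<Longrightarrow> y \<in> D 0 \<Longrightarrow> y \<notin> D 1 \<Longrightarrow> x * y \<in> D 0 \<and> x * y \<notin> D 1"
  using D_cancel_unit[of x y 1] D_mult0(1)[of x 0 y] by auto

lemma L_iff: "A \<in> L n \<longleftrightarrow> (\<forall>i j. A $ i $ j \<in> D n)"
  by (simp add: mat_lattice_def)

lemma L_nth: "A \<in> L n \<Longrightarrow> A $ i $ j \<in> D n"
  by (simp add: mat_lattice_def)

lemma L_iff3: "A \<in> L n \<longleftrightarrow> A $ 1 $ 1 \<in> D n \<and> A $ 1 $ 2 \<in> D n \<and> A $ 1 $ 3 \<in> D n \<and>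
    A $ 2 $ 1 \<in> D n \<and> A $ 2 $ 2 \<in> D n \<and> A $ 2 $ 3 \<in> D n \<and>
    A $ 3 $ 1 \<in> D n \<and> A $ 3 $ 2 \<in> D n \<and> A $ 3 $ 3 \<in> D n"
  by (simp add: L_iff forall_3)

lemma L_zero [simp]: "0 \<in> L n"
  by (simp add: L_iff)

lemma L_add: "A \<in> L n \<Longrightarrow> B \<in> L n \<Longrightarrow> A + B \<in> L n"
  by (simp add: L_iff D_add)

lemma L_diff: "A \<in> L n \<Longrightarrow> B \<in> L n \<Longrightarrow> A - B \<in> L n"
  by (simp add: L_iff D_diff)

lemma L_diff_commute: "A - B \<in> L n \<longleftrightarrow> B - A \<in> L n"
  using D_diff_commute by (simp add: L_iff)

lemma L_diff_trans: "A - B \<in> L n \<Longrightarrow> B - C \<in> L n \<Longrightarrow> A - C \<in> L n"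
  using L_add[of "A - B" n "B - C"] by simp

lemma L_mono: "A \<in> L n \<Longrightarrow> m \<le> n \<Longrightarrow> A \<in> L m"
  by (auto simp: L_iff intro: D_mono[of _ n])

lemma L_mult: "A \<in> L m \<Longrightarrow> B \<in> L n \<Longrightarrow> A ** B \<in> L (m + n)"
  by (simp add: L_iff mat_mult3 D_add D_mult)

lemma L_mult0: "A \<in> L 0 \<Longrightarrow> B \<in> L n \<Longrightarrow> A ** B \<in> L n" "B \<in> L n \<Longrightarrow> A \<in> L 0 \<Longrightarrow> B ** A \<in> L n"
  using L_mult[of A 0 B n] L_mult[of B n A 0] by auto

lemma L_transpose: "transpose A \<in> L n \<longleftrightarrow> A \<in> L n"
  by (auto simp: L_iff transpose_def)

lemma L_scalar: "c \<in> D m \<Longrightarrow> A \<in> L n \<Longrightarrow> A ** mat c \<in> L (m + n)"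
  by (simp add: L_iff mat_mult_scalar D_mult)

lemma L_one: "mat 1 \<in> L n \<longleftrightarrow> n \<le> 0"
  by (auto simp: L_iff3 mat_nth one_D)

lemma L_exists: "\<exists>n. A \<in> L n"
proof -
  define n where "n = Min (range (\<lambda>(i, j). v (A $ i $ j)))"
  have "n \<le> v (A $ i $ j)" for i j
    unfolding n_def by (rule Min_le) (auto intro: image_eqI[of _ _ "(i, j)"])
  then show ?thesis by (auto simp: L_iff frac_ideal_def intro!: exI[of _ n])
qed

abbreviation K :: "('f ^ 3 ^ 3) set" where "K \<equiv> GL3_int v"

lemma K_I: "A \<in> L 0 \<Longrightarrow> B \<in> L 0 \<Longrightarrow> A ** B = mat 1 \<Longrightarrow> A \<in> K"
  unfolding GL3_int_def L_iff using matrix_inv_unique(2) by blast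

lemma K_iff: "A \<in> K \<longleftrightarrow> A \<in> GL3 \<and> A \<in> L 0 \<and> matrix_inv A \<in> L 0"
proof
  assume "A \<in> K"
  then obtain B where "A \<in> L 0" "B \<in> L 0" "A ** B = mat 1" by (auto simp: GL3_int_def L_iff)
  then show "A \<in> GL3 \<and> A \<in> L 0 \<and> matrix_inv A \<in> L 0"
    using matrix_inv_unique[of A B] GL3_I by auto
qed (auto intro: K_I GL3_inv)

lemma K_GL3: "A \<in> K \<Longrightarrow> A \<in> GL3" and K_L0: "A \<in> K \<Longrightarrow> A \<in> L 0"
  by (simp_all add: K_iff)

lemma K_D0: "A \<in> K \<Longrightarrow> A $ i $ j \<in> D 0"
  by (simp add: K_iff L_nth)

lemma K_inv: "A \<in> K \<Longrightarrow> matrix_inv A \<in> K"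
  by (simp add: K_iff GL3_inv)

lemma K_mult: "A \<in> K \<Longrightarrow> B \<in> K \<Longrightarrow> A ** B \<in> K"
  by (simp add: K_iff GL3_mult matrix_inv_mult L_mult0)

lemma K_one [simp]: "mat 1 \<in> K"
  by (simp add: K_iff L_one)

lemma K_transpose: "A \<in> K \<Longrightarrow> transpose A \<in> K"
  by (simp add: K_iff transpose_inv L_transpose)

lemma K_L_left: "k \<in> K \<Longrightarrow> k ** A \<in> L n \<longleftrightarrow> A \<in> L n"
  using L_mult0(1)[of k A n] L_mult0(1)[of "matrix_inv k" "k ** A" n]
  by (auto simp: K_iff GL3_inv_cancel)

lemma K_L_right: "k \<in> K \<Longrightarrow> A ** k \<in> L n \<longleftrightarrow> A \<in> L n"
  using L_mult0(2)[of A n k] L_mult0(2)[of "A ** k" n "matrix_inv k"]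
  by (auto simp: K_iff GL3_inv_cancel)

lemma matrix_diff_ldistrib: "A ** (B - C) = A ** B - (A :: 'f ^ 3 ^ 3) ** (C :: 'f ^ 3 ^ 3)"
  unfolding vec_eq_iff vector_minus_component mat_mult3 by (simp add: algebra_simps)

lemma matrix_diff_rdistrib: "(B - C) ** A = B ** A - (C :: 'f ^ 3 ^ 3) ** (A :: 'f ^ 3 ^ 3)"
  unfolding vec_eq_iff vector_minus_component mat_mult3 by (simp add: algebra_simps)

text \<open>The identity h^-1 = 1 - (h - 1) h^-1 improves any bound on the denominators of the
  inverse by one power of the maximal ideal, so finitely many applications make the inverse
  integral. \<open>near_one_K\<close> later derives invertibility itself from the
  congruence.\<close>

lemma K_near_one:
  assumes "h \<in> GL3" "h - mat 1 \<in> L 1"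
  shows "h \<in> K"
proof -
  let ?B = "matrix_inv h"
  have B: "?B = mat 1 - (h - mat 1) ** ?B"
    using GL3_inv[OF assms(1)] by (simp add: matrix_diff_rdistrib)
  have step: "?B \<in> L (- int a) \<Longrightarrow> ?B \<in> L 0" for a
  proof (induction a)
    case (Suc a)
    have "(h - mat 1) ** ?B \<in> L (- int a)"
      using L_mult[OF assms(2) Suc.prems] by simp
    then have "?B \<in> L (- int a)"
      by (subst B) (intro L_diff, auto simp: L_one)
    then show ?case by (rule Suc.IH)
  qed simp
  obtain n where "?B \<in> L n" using L_exists by blast
  then have "?B \<in> L (- int (nat (- n)))" by (rule L_mono) simp
  then have "?B \<in> L 0" by (rule step)
  moreover have "h = (h - mat 1) + mat 1" by simp
  then have "h \<in> L 0"
    using L_add[of "h - mat 1" 0 "mat 1"] L_mono[OF assms(2), of 0] by (simp add: L_one)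
  ultimately show ?thesis using assms(1) by (simp add: K_iff)
qed

text \<open>Stands in for a unit determinant: a column of non-units would make a diagonal entry of
  the identity matrix a non-unit.\<close>

lemma K_unit_in_column: "k \<in> K \<Longrightarrow> \<exists>i. k $ i $ j \<notin> D 1"
proof (rule ccontr)
  assume k: "k \<in> K" and "\<nexists>i. k $ i $ j \<notin> D 1"
  then have "(matrix_inv k ** k) $ j $ j \<in> D 1"
    using K_D0[OF K_inv[OF k]] by (auto simp: mat_mult3 intro!: D_add D_mult0)
  then show False using GL3_inv[OF K_GL3[OF k]] by (simp add: mat_nth)
qed

lemma K_unit_in_row: "k \<in> K \<Longrightarrow> \<exists>j. k $ i $ j \<notin> D 1"
  using K_unit_in_column[OF K_transpose, of k i] by (simp add: transpose_def)

end

section \<open>Common eigenvectors\<close>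

context vector_space
begin

text \<open>\<open>P q w\<close> is the polynomial \<open>q\<close> in the endomorphism
  \<open>f\<close>, applied to \<open>w\<close>. The roots are peeled off one at a time: either
  \<open>w\<close> is already an eigenvector for the root c, or f w - c w is a nonzero vector of
  \<open>A\<close> killed by the product of the remaining factors.\<close>

lemma eigenvector_of_root_product:
  fixes f :: "'b \<Rightarrow> 'b"
  assumes "Vector_Spaces.linear scale scale f" "subspace A" "f ` A \<subseteq> A" "w \<in> A" "w \<noteq> 0"
    and P: "\<And>q w. P q w = (\<Sum>i\<le>Polynomial.degree q. scale (poly.coeff q i) ((f ^^ i) w))"
    and "P (Polynomial.smult l (\<Prod>x\<in>#M. [:- x, 1:])) w = 0" "l \<noteq> 0"
  shows "\<exists>c w. w \<in> A \<and> w \<noteq> 0 \<and> f w = scale c w"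
  using assms(4,5,7)
proof (induction M arbitrary: w)
  case empty
  then show ?case using \<open>l \<noteq> 0\<close> by (simp add: P)
next
  case (add c M)
  interpret f: Vector_Spaces.linear scale scale f by fact
  have lin: "Vector_Spaces.linear scale scale (f ^^ i)" for i
  proof (induction i)
    case 0
    show ?case unfolding funpow.simps by (rule linear_id)
  next
    case (Suc i)
    show ?case unfolding funpow.simps by (rule Vector_Spaces.linear_compose[OF Suc f.linear_axioms])
  qed
  let ?q = "Polynomial.smult l (\<Prod>x\<in>#M. [:- x, 1:])"
  let ?w = "f w - scale c w"
  \<comment> \<open>The upper limit in \<open>P\<close> varies with the polynomial; padding to a
    common limit makes the sums comparable.\<close>
  have P_eq: "P q u = (\<Sum>i\<le>n. scale (poly.coeff q i) ((f ^^ i) u))" if "Polynomial.degree q \<le> n" for q u n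
    unfolding P using that by (intro sum.mono_neutral_left) (auto simp: coeff_eq_0)
  have "Polynomial.smult l (\<Prod>x\<in>#add_mset c M. [:- x, 1:]) = pCons 0 ?q - Polynomial.smult c ?q" (is "?r = _")
  proof -
    have "(\<Prod>x\<in>#add_mset c M. [:- x, 1:])
        = pCons 0 (\<Prod>x\<in>#M. [:- x, 1:]) - Polynomial.smult c (\<Prod>x\<in>#M. [:- x, 1:])" by simp
    then show ?thesis by (simp only: smult_diff_right smult_smult smult_pCons mult.commute mult_zero_right mult_zero_left)
  qed
  define n where "n = Polynomial.degree ?q"
  have "P (pCons 0 ?q - Polynomial.smult c ?q) w
      = (\<Sum>i\<le>Suc n. scale (poly.coeff (pCons 0 ?q - Polynomial.smult c ?q) i) ((f ^^ i) w))"
    unfolding n_def by (intro P_eq degree_diff_le) (auto simp: degree_pCons_le)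
  also have "\<dots> = (\<Sum>i\<le>Suc n. scale (poly.coeff (pCons 0 ?q) i) ((f ^^ i) w))
      - (\<Sum>i\<le>Suc n. scale (c * poly.coeff ?q i) ((f ^^ i) w))"
    by (simp add: scale_left_diff_distrib sum_subtractf del: sum.atMost_Suc coeff_smult)
       (simp add: mult.assoc)
  also have "(\<Sum>i\<le>Suc n. scale (poly.coeff (pCons 0 ?q) i) ((f ^^ i) w))
      = (\<Sum>i\<le>n. scale (poly.coeff ?q i) ((f ^^ i) (f w)))"
    by (subst sum.atMost_Suc_shift) (simp add: funpow_swap1)
  also have "(\<Sum>i\<le>Suc n. scale (c * poly.coeff ?q i) ((f ^^ i) w))
      = (\<Sum>i\<le>n. scale (poly.coeff ?q i) ((f ^^ i) (scale c w)))"
  proof -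
    have "poly.coeff ?q (Suc n) = 0" by (rule coeff_eq_0) (simp add: n_def)
    moreover have "(f ^^ i) (scale c w) = scale c ((f ^^ i) w)" for i
      by (rule module_hom.scale[OF lin[unfolded linear_iff_module_hom]])
    ultimately show ?thesis by (simp add: mult.commute)
  qed
  also have "(\<Sum>i\<le>n. scale (poly.coeff ?q i) ((f ^^ i) (f w)))
      - (\<Sum>i\<le>n. scale (poly.coeff ?q i) ((f ^^ i) (scale c w))) = P ?q ?w"
  proof -
    have "(f ^^ i) ?w = (f ^^ i) (f w) - (f ^^ i) (scale c w)" for i
      by (rule module_hom.diff[OF lin[unfolded linear_iff_module_hom]])
    then show ?thesis by (simp add: P n_def scale_right_diff_distrib sum_subtractf)
  qed
  finally have "P ?q ?w = 0" using add.prems(3) \<open>?r = _\<close> by simp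
  show ?case
  proof (cases "?w = 0")
    case True
    then show ?thesis using add.prems by (auto intro!: exI[of _ c] exI[of _ w])
  next
    case False
    have "?w \<in> A" using assms(2,3) add.prems(1)
      by (auto intro!: subspace_diff subspace_scale)
    then show ?thesis using False \<open>P ?q ?w = 0\<close> by (rule add.IH)
  qed
qed

end

text \<open>The polynomial x^N - 1 kills \<open>w\<close> and splits over an algebraically closed
  field. N may be divisible by the characteristic, since only one eigenvector is sought, not a
  diagonalisation.\<close>

lemma finite_order_eigenvector:
  fixes smul :: "'k::alg_closed_field \<Rightarrow> 'v::ab_group_add \<Rightarrow> 'v"
  assumes "vector_space smul" "Vector_Spaces.linear smul smul f" "module.subspace smul A"
    "f ` A \<subseteq> A" "w \<in> A" "w \<noteq> 0" "N > 0" "(f ^^ N) w = w"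
  shows "\<exists>c w. w \<in> A \<and> w \<noteq> 0 \<and> f w = smul c w"
proof -
  interpret vector_space smul by fact
  define P where "P = (\<lambda>q w. \<Sum>i\<le>Polynomial.degree q. smul (poly.coeff q i) ((f ^^ i) w))"
  let ?q = "Polynomial.monom 1 N - 1 :: 'k poly"
  have cq: "poly.coeff ?q i = (if i = N then 1 else if i = 0 then - 1 else 0)" for i
    using \<open>N > 0\<close> by (auto simp: coeff_1)
  then have "?q \<noteq> 0" by (metis coeff_0 zero_neq_one)
  then obtain M where M: "?q = Polynomial.smult (Polynomial.lead_coeff ?q) (\<Prod>x\<in>#M. [:- x, 1:])"
    using alg_closed_imp_factorization by blast
  have "Polynomial.degree ?q \<le> N" by (intro degree_le) (auto simp del: coeff_diff simp: cq)
  moreover have "N \<le> Polynomial.degree ?q" by (intro le_degree) (simp del: coeff_diff add: cq)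
  ultimately have deg: "Polynomial.degree ?q = N" by simp
  have "P ?q w = (\<Sum>i\<le>N. if i = N then (f ^^ N) w else if i = 0 then - w else 0)"
    unfolding P_def deg cq by (intro sum.cong) auto
  also have "\<dots> = (\<Sum>i\<in>{0, N}. if i = N then (f ^^ N) w else if i = 0 then - w else 0)"
    by (intro sum.mono_neutral_right) auto
  also have "\<dots> = 0" using assms(7,8) by simp
  finally have "P (Polynomial.smult (Polynomial.lead_coeff ?q) (\<Prod>x\<in>#M. [:- x, 1:])) w = 0" using M by simp
  moreover have "Polynomial.lead_coeff ?q \<noteq> 0" using \<open>?q \<noteq> 0\<close> by (simp only: leading_coeff_0_iff not_False_eq_True)
  ultimately show ?thesis
    by (intro eigenvector_of_root_product[OF assms(2-6), of P]) (simp_all only: P_def)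
qed

text \<open>Induction on \<open>S\<close>: by commutation an eigenspace of one operator is stable
  under the others. Periodicity takes the place of finite dimension as the source of
  eigenvectors.\<close>

lemma common_eigenvector:
  fixes smul :: "'k::alg_closed_field \<Rightarrow> 'v::ab_group_add \<Rightarrow> 'v" and act :: "'m \<Rightarrow> 'v \<Rightarrow> 'v"
  assumes "vector_space smul" "finite S"
    "module.subspace smul A" "A \<noteq> {0}"
    "\<And>s. s \<in> S \<Longrightarrow> Vector_Spaces.linear smul smul (act s)"
    "\<And>s w. s \<in> S \<Longrightarrow> w \<in> A \<Longrightarrow> act s w \<in> A"
    "\<And>s t w. s \<in> S \<Longrightarrow> t \<in> S \<Longrightarrow> w \<in> A \<Longrightarrow> act s (act t w) = act t (act s w)"
    "\<And>s. s \<in> S \<Longrightarrow> \<exists>N>0. \<forall>w\<in>A. (act s ^^ N) w = w"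
  shows "\<exists>w\<in>A. w \<noteq> 0 \<and> (\<forall>s\<in>S. \<exists>c. act s w = smul c w)"
  using assms(2-8)
proof (induction S arbitrary: A rule: finite_induct)
  case empty
  interpret vector_space smul by fact
  show ?case using empty.prems(1,2) subspace_0 by blast
next
  case (insert s S)
  interpret vector_space smul by fact
  obtain N where N: "N > 0" "\<forall>w\<in>A. (act s ^^ N) w = w" using insert.prems(6) by blast
  obtain w0 where w0: "w0 \<in> A" "w0 \<noteq> 0"
    using insert.prems(1,2) subspace_0 by blast
  obtain c w where w: "w \<in> A" "w \<noteq> 0" "act s w = smul c w"
    using finite_order_eigenvector[OF assms(1) insert.prems(3), of s A w0 N] N w0 insert.prems by blast
  interpret s: Vector_Spaces.linear smul smul "act s" using insert.prems by blast
  let ?A = "{w \<in> A. act s w = smul c w}"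
  have "\<exists>w\<in>?A. w \<noteq> 0 \<and> (\<forall>s\<in>S. \<exists>c. act s w = smul c w)"
  proof (rule insert.IH)
    show "subspace ?A"
      using insert.prems(1)
      by (auto simp: subspace_def s.add s.scale scale_right_distrib mult.commute)
    show "?A \<noteq> {0}" using w by blast
    show "act t w \<in> ?A" if "t \<in> S" "w \<in> ?A" for t w
    proof -
      interpret t: Vector_Spaces.linear smul smul "act t" using insert.prems that by blast
      have "act s (act t w) = act t (act s w)" using insert.prems(5)[of s t w] that by blast
      then show ?thesis using insert.prems(4)[of t w] that by (simp add: t.scale)
    qed
    show "Vector_Spaces.linear smul smul (act t)" if "t \<in> S" for t using insert.prems(3) that by blast
    show "act t (act u w) = act u (act t w)" if "t \<in> S" "u \<in> S" "w \<in> ?A" for t u w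
      using insert.prems(5) that by blast
    show "\<exists>N>0. \<forall>w\<in>?A. (act t ^^ N) w = w" if "t \<in> S" for t
      using insert.prems(6)[of t] that by blast
  qed
  then show ?case by auto
qed

section \<open>Sums over classes\<close>

text \<open>Sums over cosets, with one representative per fibre of \<open>q\<close>. Indexing by the
  fibres that meet the support keeps the index set finite for the infinite coset spaces below, where
  a sum over all cosets would take the default value 0. The choice of representatives is immaterial
  for a \<open>class_function\<close>.\<close>

definition class_sum :: "('a \<Rightarrow> 'c) \<Rightarrow> 'a set \<Rightarrow> ('a \<Rightarrow> 'b::comm_monoid_add) \<Rightarrow> 'b" where
  "class_sum q A F = (\<Sum>c\<in>q ` {x \<in> A. F x \<noteq> 0}. F (SOME x. x \<in> A \<and> q x = c))"

definition class_function :: "('a \<Rightarrow> 'c) \<Rightarrow> 'a set \<Rightarrow> ('a \<Rightarrow> 'b) \<Rightarrow> bool" where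
  "class_function q A F \<longleftrightarrow> (\<forall>x\<in>A. \<forall>y\<in>A. q x = q y \<longrightarrow> F x = F y)"

lemma class_rep:
  assumes "c \<in> q ` A"
  shows "(SOME x. x \<in> A \<and> q x = c) \<in> A" "q (SOME x. x \<in> A \<and> q x = c) = c"
  using someI_ex[of "\<lambda>x. x \<in> A \<and> q x = c"] assms by blast+

lemma class_rep_eq: "class_function q A F \<Longrightarrow> x \<in> A \<Longrightarrow> F (SOME y. y \<in> A \<and> q y = q x) = F x"
  using class_rep[of "q x" q A] unfolding class_function_def by blast

text \<open>Lets sums with different supports be compared over one common finite set of
  classes.\<close>

lemma class_sum_superset:
  assumes "class_function q A F" "finite C" "C \<subseteq> q ` A" "\<And>x. x \<in> A \<Longrightarrow> F x \<noteq> 0 \<Longrightarrow> q x \<in> C"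
  shows "class_sum q A F = (\<Sum>c\<in>C. F (SOME x. x \<in> A \<and> q x = c))"
  unfolding class_sum_def
proof (rule sum.mono_neutral_left)
  show "\<forall>c\<in>C - q ` {x \<in> A. F x \<noteq> 0}. F (SOME x. x \<in> A \<and> q x = c) = 0"
  proof
    fix c assume c: "c \<in> C - q ` {x \<in> A. F x \<noteq> 0}"
    then have "c \<in> q ` A" using assms(3) by blast
    note r = class_rep[OF this]
    show "F (SOME x. x \<in> A \<and> q x = c) = 0"
    proof (rule ccontr)
      assume "F (SOME x. x \<in> A \<and> q x = c) \<noteq> 0"
      then have "q (SOME x. x \<in> A \<and> q x = c) \<in> q ` {x \<in> A. F x \<noteq> 0}" using r(1) by blast
      then show False using c r(2) by simp
    qed
  qed
qed (use assms in auto)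

lemma class_rep_inj: "inj_on (\<lambda>c. SOME x. x \<in> A \<and> q x = c) (q ` A)"
  using class_rep(2)[of _ q A] by (rule inj_on_inverseI)

lemma class_sum_reps:
  assumes "class_function q A f" "finite (q ` A)"
  shows "class_sum q A f = sum f ((\<lambda>c. SOME x. x \<in> A \<and> q x = c) ` q ` A)"
proof -
  have "class_sum q A f = (\<Sum>c\<in>q ` A. f (SOME x. x \<in> A \<and> q x = c))"
    using assms by (intro class_sum_superset) auto
  then show ?thesis using sum.reindex[OF class_rep_inj[of A q], of f] by (simp add: o_def)
qed

lemma class_sum_cong:
  assumes "\<And>x. x \<in> A \<Longrightarrow> F x = G x"
  shows "class_sum q A F = class_sum q A G"
  unfolding class_sum_def
proof (rule sum.cong)
  show eq: "q ` {x \<in> A. F x \<noteq> 0} = q ` {x \<in> A. G x \<noteq> 0}" using assms by auto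
  fix c assume "c \<in> q ` {x \<in> A. G x \<noteq> 0}"
  then have "c \<in> q ` A" by blast
  then show "F (SOME x. x \<in> A \<and> q x = c) = G (SOME x. x \<in> A \<and> q x = c)"
    by (intro assms class_rep(1))
qed

text \<open>An additive map may kill some values and shrink the support, so both sides are compared
  over the classes of the original support.\<close>

lemma class_sum_hom:
  assumes F: "class_function q A F" "finite (q ` {x \<in> A. F x \<noteq> 0})"
    and h: "h 0 = 0" "\<And>a b. h (a + b) = h a + h b"
  shows "class_sum q A (\<lambda>x. h (F x)) = h (class_sum q A F)"
proof -
  let ?C = "q ` {x \<in> A. F x \<noteq> 0}"
  have hsum: "h (sum g C) = (\<Sum>c\<in>C. h (g c))" for g and C :: "'b set"
    by (induction C rule: infinite_finite_induct) (auto simp: h)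
  have "class_sum q A (\<lambda>x. h (F x)) = (\<Sum>c\<in>?C. h (F (SOME x. x \<in> A \<and> q x = c)))"
  proof (rule class_sum_superset)
    show "class_function q A (\<lambda>x. h (F x))" using F(1) unfolding class_function_def by metis
    show "q x \<in> ?C" if "x \<in> A" "h (F x) \<noteq> 0" for x
    proof -
      have "F x \<noteq> 0" using that h(1) by auto
      then show ?thesis using that by blast
    qed
  qed (use F in auto)
  then show ?thesis by (simp add: class_sum_def hsum)
qed

lemma class_sum_add:
  assumes F: "class_function q A F" "finite (q ` {x \<in> A. F x \<noteq> 0})"
    and G: "class_function q A G" "finite (q ` {x \<in> A. G x \<noteq> 0})"
  shows "class_sum q A (\<lambda>x. F x + G x) = class_sum q A F + class_sum q A G"
proof -
  let ?C = "q ` {x \<in> A. F x \<noteq> 0} \<union> q ` {x \<in> A. G x \<noteq> 0}"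
  have C: "finite ?C" "?C \<subseteq> q ` A" using F G by auto
  have FG: "class_function q A (\<lambda>x. F x + G x)"
    using F(1) G(1) unfolding class_function_def by metis
  have "class_sum q A F = (\<Sum>c\<in>?C. F (SOME x. x \<in> A \<and> q x = c))"
    using F C by (intro class_sum_superset) auto
  moreover have "class_sum q A G = (\<Sum>c\<in>?C. G (SOME x. x \<in> A \<and> q x = c))"
    using G C by (intro class_sum_superset) auto
  moreover have "class_sum q A (\<lambda>x. F x + G x)
      = (\<Sum>c\<in>?C. F (SOME x. x \<in> A \<and> q x = c) + G (SOME x. x \<in> A \<and> q x = c))"
    using FG C by (intro class_sum_superset) auto
  ultimately show ?thesis by (simp add: sum.distrib)
qed

lemma class_sum_single:
  assumes "class_function q A F" "a \<in> A" "\<And>x. x \<in> A \<Longrightarrow> F x \<noteq> 0 \<Longrightarrow> q x = q a"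
  shows "class_sum q A F = F a"
  using class_sum_superset[of q A F "{q a}"] class_rep_eq[OF assms(1,2)] assms by auto

text \<open>Change of variables in a coset sum: \<open>\<theta>\<close> has to be injective on
  classes and to reach those classes on which \<open>G\<close> is nonzero.\<close>

lemma class_sum_reindex:
  assumes G: "class_function q' Y G" and \<theta>: "\<And>x. x \<in> A \<Longrightarrow> \<theta> x \<in> Y"
    and inj: "\<And>x y. x \<in> A \<Longrightarrow> y \<in> A \<Longrightarrow> q' (\<theta> x) = q' (\<theta> y) \<longleftrightarrow> q x = q y"
    and surj: "\<And>y. y \<in> Y \<Longrightarrow> G y \<noteq> 0 \<Longrightarrow> \<exists>x\<in>A. q' (\<theta> x) = q' y"
  shows "class_sum q A (\<lambda>x. G (\<theta> x)) = class_sum q' Y G"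
proof -
  let ?r = "\<lambda>c. SOME x. x \<in> A \<and> q x = c"
  have GG: "G y = G y'" if "y \<in> Y" "y' \<in> Y" "q' y = q' y'" for y y'
    using G that unfolding class_function_def by blast
  have "sum (\<lambda>c. G (\<theta> (?r c))) (q ` {x \<in> A. G (\<theta> x) \<noteq> 0})
      = (\<Sum>c\<in>q' ` {y \<in> Y. G y \<noteq> 0}. G (SOME y. y \<in> Y \<and> q' y = c))"
  proof (rule sum.reindex_cong[symmetric, of "\<lambda>c. q' (\<theta> (?r c))"])
    have r: "?r (q x) \<in> A" "q (?r (q x)) = q x" if "x \<in> A" for x
      using class_rep[of "q x" q A] that by auto
    then have r': "q' (\<theta> (?r (q x))) = q' (\<theta> x)" if "x \<in> A" for x
      using inj that by blast
    show "inj_on (\<lambda>c. q' (\<theta> (?r c))) (q ` {x \<in> A. G (\<theta> x) \<noteq> 0})"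
      using inj r' by (auto simp: inj_on_def)
    show "q' ` {y \<in> Y. G y \<noteq> 0} = (\<lambda>c. q' (\<theta> (?r c))) ` q ` {x \<in> A. G (\<theta> x) \<noteq> 0}"
    proof
      show "q' ` {y \<in> Y. G y \<noteq> 0} \<subseteq> (\<lambda>c. q' (\<theta> (?r c))) ` q ` {x \<in> A. G (\<theta> x) \<noteq> 0}"
      proof clarify
        fix y assume y: "y \<in> Y" "G y \<noteq> 0"
        obtain x where x: "x \<in> A" "q' (\<theta> x) = q' y" using surj[OF y] by blast
        then have "G (\<theta> x) \<noteq> 0" using GG[of y "\<theta> x"] y \<theta> by auto
        then show "q' y \<in> (\<lambda>c. q' (\<theta> (?r c))) ` q ` {x \<in> A. G (\<theta> x) \<noteq> 0}"
          using x r'[of x] by (auto intro!: image_eqI[of _ _ "q x"])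
      qed
      show "(\<lambda>c. q' (\<theta> (?r c))) ` q ` {x \<in> A. G (\<theta> x) \<noteq> 0} \<subseteq> q' ` {y \<in> Y. G y \<noteq> 0}"
        using r' \<theta> by auto
    qed
    fix c assume "c \<in> q ` {x \<in> A. G (\<theta> x) \<noteq> 0}"
    then obtain x where x: "x \<in> A" "c = q x" by blast
    then have "\<theta> (?r c) \<in> Y" using r \<theta> by blast
    from class_rep_eq[OF G this] show "G (SOME y. y \<in> Y \<and> q' y = q' (\<theta> (?r c))) = G (\<theta> (?r c))" .
  qed
  then show ?thesis unfolding class_sum_def .
qed

section \<open>Finiteness of residue rings\<close>

context nonarch_local_field
begin

text \<open>The coset of the maximal ideal, written without the quotient ring;
  \<open>residue_class_coset\<close> identifies the two.\<close>

definition residue_class :: "'f \<Rightarrow> 'f set" where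
  "residue_class a = {b. b - a \<in> D 1}"

lemma residue_class_eq_iff: "residue_class a = residue_class b \<longleftrightarrow> a - b \<in> D 1"
proof
  assume "residue_class a = residue_class b"
  moreover have "a \<in> residue_class a" by (simp add: residue_class_def)
  ultimately show "a - b \<in> D 1" by (auto simp: residue_class_def)
next
  assume "a - b \<in> D 1"
  then show "residue_class a = residue_class b"
    unfolding residue_class_def by (blast intro: D_diff_trans D_diff_commute[THEN iffD1])
qed

lemma integer_ring_simps:
  "carrier (integer_ring v) = D 0" "x \<otimes>\<^bsub>integer_ring v\<^esub> y = x * y" "\<one>\<^bsub>integer_ring v\<^esub> = 1"
  "\<zero>\<^bsub>integer_ring v\<^esub> = 0" "x \<oplus>\<^bsub>integer_ring v\<^esub> y = x + y"
  by (simp_all add: integer_ring_def ring_of_type_algebra_def)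

lemma integer_ring_is_ring: "ring (integer_ring v)"
proof (rule ringI)
  show "abelian_group (integer_ring v)"
  proof (rule abelian_groupI)
    fix x assume "x \<in> carrier (integer_ring v)"
    then show "\<exists>y\<in>carrier (integer_ring v). y \<oplus>\<^bsub>integer_ring v\<^esub> x = \<zero>\<^bsub>integer_ring v\<^esub>"
      by (intro bexI[of _ "- x"]) (simp_all add: integer_ring_simps)
  qed (auto simp: integer_ring_simps D_add algebra_simps)
  show "Group.monoid (integer_ring v)"
    by (rule Group.monoidI) (auto simp: integer_ring_simps D_mult0)
qed (auto simp: integer_ring_simps algebra_simps)

lemma maximal_ideal: "ideal (D 1) (integer_ring v)"
proof (rule idealI[OF integer_ring_is_ring])
  interpret ring "integer_ring v" by (rule integer_ring_is_ring)
  show "subgroup (D 1) (add_monoid (integer_ring v))"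
  proof (rule add.subgroupI)
    fix a assume a: "a \<in> D 1"
    then have "\<ominus>\<^bsub>integer_ring v\<^esub> a = - a"
      by (intro minus_equality) (auto simp: integer_ring_simps intro: D01)
    then show "\<ominus>\<^bsub>integer_ring v\<^esub> a \<in> D 1"
      using a by simp
  next
    show "D 1 \<noteq> {}" using D_zero[of 1] by blast
  qed (auto simp: integer_ring_simps D01 D_add)
qed (auto simp: integer_ring_simps D_mult0)

lemma residue_class_coset: "D 1 +>\<^bsub>integer_ring v\<^esub> a = residue_class a"
  unfolding a_r_coset_def' residue_class_def integer_ring_simps
  by (auto intro: exI[of _ "_ - a"])

lemma residue_field_carrier: "carrier (residue_field v) = residue_class ` D 0"
  by (auto simp: residue_field_def FactRing_def A_RCOSETS_def' residue_class_coset integer_ring_simps)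

lemma finite_residue_classes: "finite (residue_class ` D 0)"
  using finite_residue_field by (simp add: residue_field_carrier)

text \<open>The residue characteristic p is the additive order of 1 in the residue field, so p
  vanishes there and divides q by Lagrange. The first fact gives the filtration quotients of the
  pro-p group exponent p; the second makes a sum of q equal vectors vanish.\<close>

lemma residue_char_properties:
  shows "of_nat (residue_char v) \<in> D 1" "residue_char v dvd card (residue_class ` D 0)"
proof -
  interpret ideal "D 1" "integer_ring v" by (rule maximal_ideal)
  interpret Q: ring "residue_field v" unfolding residue_field_def by (rule quotient_is_ring)
  interpret h: ring_hom_ring "integer_ring v" "residue_field v" "residue_class"
    using rcos_ring_hom_ring unfolding residue_field_def residue_class_coset .
  have pow: "[n] \<cdot>\<^bsub>residue_field v\<^esub> \<one>\<^bsub>residue_field v\<^esub> = residue_class (of_nat n)" for n :: nat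
  proof (induction n)
    case 0
    then show ?case using h.hom_zero by (simp add: integer_ring_simps)
  next
    case (Suc n)
    have "of_nat n \<in> D 0" by (induction n) (auto simp: D_add)
    then show ?case
      using Suc h.hom_add[of "of_nat n" 1] h.hom_one by (simp add: integer_ring_simps add.commute)
  qed
  have "residue_class (of_nat (residue_char v)) = \<zero>\<^bsub>residue_field v\<^esub>"
    using Q.add.pow_ord_eq_1[of "\<one>\<^bsub>residue_field v\<^esub>"] unfolding residue_char_def[symmetric] pow by simp
  also have "\<dots> = residue_class 0" using h.hom_zero by (simp add: integer_ring_simps)
  finally show "of_nat (residue_char v) \<in> D 1" by (simp add: residue_class_eq_iff)
  show "residue_char v dvd card (residue_class ` D 0)"
    using Q.add.ord_dvd_group_order[OF Q.one_closed]
    unfolding residue_char_def order_def by (simp add: residue_field_carrier)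
qed

end

locale uniformized_field = nonarch_local_field v for v :: "'f::field \<Rightarrow> int" +
  fixes \<pi> :: 'f
  assumes pi: "uniformizer v \<pi>"
begin

lemma pi_nonzero [simp]: "\<pi> \<noteq> 0" and v_pi: "v \<pi> = 1"
  using pi by (simp_all add: uniformizer_def)

lemma pi_powi_D: "\<pi> powi n \<in> D m \<longleftrightarrow> m \<le> n"
  by (simp add: frac_ideal_def v_powi v_pi)

lemma pi_powi_mult_D: "\<pi> powi n * x \<in> D m \<longleftrightarrow> x \<in> D (m - n)"
  by (cases "x = 0") (auto simp: frac_ideal_def v_mult v_powi v_pi)

text \<open>Expansion in powers of the uniformizer, one further digit per step.\<close>

lemma finite_D_quotient: "\<exists>S. finite S \<and> S \<subseteq> D n \<and> (\<forall>x\<in>D n. \<exists>s\<in>S. x - s \<in> D (n + int k))"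
proof (induction k)
  case 0
  show ?case by (rule exI[of _ "{0}"]) auto
next
  case (Suc k)
  then obtain S where S: "finite S" "S \<subseteq> D n" "\<And>x. x \<in> D n \<Longrightarrow> \<exists>s\<in>S. x - s \<in> D (n + int k)"
    by blast
  define R where "R = (\<lambda>c. SOME a. a \<in> D 0 \<and> residue_class a = c) ` residue_class ` D 0"
  have R: "finite R" "R \<subseteq> D 0" using finite_residue_classes class_rep[of _ residue_class "D 0"]
    by (auto simp: R_def)
  have R': "\<exists>r\<in>R. a - r \<in> D 1" if "a \<in> D 0" for a
  proof -
    let ?r = "SOME b. b \<in> D 0 \<and> residue_class b = residue_class a"
    have "residue_class ?r = residue_class a" using class_rep[of "residue_class a" residue_class "D 0"] that by blast
    moreover have "?r \<in> R" using that unfolding R_def by blast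
    ultimately show ?thesis using residue_class_eq_iff by metis
  qed
  let ?c = "\<pi> powi (n + int k)"
  let ?S = "(\<lambda>(s, r). s + ?c * r) ` (S \<times> R)"
  have "?S \<subseteq> D n"
    using subsetD[OF S(2)] D_mono[OF subsetD[OF R(2)], of _ "- int k"]
    by (auto intro!: D_add simp: pi_powi_mult_D)
  moreover have "\<exists>s\<in>?S. x - s \<in> D (n + int (Suc k))" if x: "x \<in> D n" for x
  proof -
    obtain s where s: "s \<in> S" "x - s \<in> D (n + int k)" using S(3)[OF x] by blast
    let ?y = "(x - s) / ?c"
    have y: "?c * ?y = x - s" by simp
    have "?c * ?y \<in> D (n + int k)" unfolding y by (rule s)
    then have "?y \<in> D 0" unfolding pi_powi_mult_D by simp
    then obtain r where r: "r \<in> R" "?y - r \<in> D 1" using R' by blast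
    have "x - (s + ?c * r) = ?c * (?y - r)" using y by (simp add: right_diff_distrib)
    also have "\<dots> \<in> D (n + int (Suc k))" unfolding pi_powi_mult_D using r(2) by simp
    finally have "x - (s + ?c * r) \<in> D (n + int (Suc k))" .
    moreover have "s + ?c * r \<in> ?S" using s(1) r(1) by (auto intro!: image_eqI[of _ _ "(s, r)"])
    ultimately show ?thesis by blast
  qed
  ultimately show ?case using S(1) R(1) by (intro exI[of _ ?S]) auto
qed

lemma finite_L_quotient:
  assumes "H \<subseteq> L n"
  shows "\<exists>S. finite S \<and> S \<subseteq> H \<and> (\<forall>A\<in>H. \<exists>B\<in>S. A - B \<in> L m)"
proof -
  obtain S where S: "finite S" "\<And>x. x \<in> D n \<Longrightarrow> \<exists>s\<in>S. x - s \<in> D (n + int (nat (m - n)))"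
    using finite_D_quotient by metis
  have S': "\<exists>s\<in>S. x - s \<in> D m" if "x \<in> D n" for x
  proof -
    from S(2)[OF that] obtain s where "s \<in> S" "x - s \<in> D (n + int (nat (m - n)))" by blast
    then show ?thesis using D_mono[of "x - s" "n + int (nat (m - n))" m] by (intro bexI[of _ s]) auto
  qed
  define f where "f A = (\<lambda>(i, j). SOME s. s \<in> S \<and> A $ i $ j - s \<in> D m)" for A :: "'f ^ 3 ^ 3"
  have f: "f A (i, j) \<in> S \<and> A $ i $ j - f A (i, j) \<in> D m" if "A \<in> H" for A i j
    using someI_ex[of "\<lambda>s. s \<in> S \<and> A $ i $ j - s \<in> D m"] S' L_nth[of A n i j] assms that
    by (auto simp: f_def)
  have "f ` H \<subseteq> UNIV \<rightarrow>\<^sub>E S" using f by auto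
  then have fin: "finite (f ` H)"
    by (rule finite_subset) (auto intro: finite_PiE S)
  \<comment> \<open>Representatives are taken inside \<open>H\<close>: one matrix for each pattern
    of rounded entries. Two matrices with the same pattern differ by an element of
    \<open>L m\<close>.\<close>
  let ?T = "(\<lambda>c. SOME A. A \<in> H \<and> f A = c) ` f ` H"
  have "\<exists>B\<in>?T. A - B \<in> L m" if A: "A \<in> H" for A
  proof -
    let ?B = "SOME B. B \<in> H \<and> f B = f A"
    have B: "?B \<in> H" "f ?B = f A" using class_rep[OF imageI[OF A, of f]] .
    have "A $ i $ j - ?B $ i $ j \<in> D m" for i j
      using f[OF A, of i j] f[OF B(1), of i j] D_diff_trans D_diff_commute unfolding B(2) by blast
    then have "A - ?B \<in> L m" by (simp add: L_iff)
    moreover have "?B \<in> ?T" using A by blast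
    ultimately show ?thesis by blast
  qed
  moreover have "?T \<subseteq> H" using class_rep(1)[of _ f H] by (rule image_subsetI)
  moreover have "finite ?T" using fin by (rule finite_imageI)
  ultimately show ?thesis by (intro exI[of _ ?T] conjI ballI)
qed

end

section \<open>The filtration of the Iwahori subgroup\<close>

text \<open>In the type \<open>3\<close> the numeral 3 equals 0, so row and column numbers are
  translated into the integers 1, 2, 3 before they enter the filtration formula.\<close>

definition index_int :: "3 \<Rightarrow> int" where
  "index_int i = (if i = 1 then 1 else if i = 2 then 2 else 3)"

lemma index_int_simps [simp]: "index_int 1 = 1" "index_int 2 = 2" "index_int 3 = 3"
  by (simp_all add: index_int_def)

lemma index_int_bounds: "1 \<le> index_int i" "index_int i \<le> 3"
  by (simp_all add: index_int_def)

lemma mat_add_mult: "(B + C) ** A = B ** A + (C :: 'a::semiring_1 ^ 3 ^ 3) ** (A :: 'a ^ 3 ^ 3)"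
  unfolding vec_eq_iff vector_add_component mat_mult3 by (simp add: algebra_simps)

context nonarch_local_field
begin

text \<open>The lattices \<open>J r\<close> form the filtration of the matrix algebra at the barycentre of the alcove: a
  matrix lies in \<open>J r\<close> iff its \<open>(i, j)\<close> entry has valuation at least \<open>(r + i - j) / 3\<close>. Thus \<open>J 0\<close> is the
  Iwahori order, \<open>J 1\<close> its radical, and the groups \<open>Iwr r\<close> below, for \<open>r \<ge> 1\<close>, have abelian successive quotients of exponent \<open>p\<close>.\<close>

definition J :: "int \<Rightarrow> ('f ^ 3 ^ 3) set" where
  "J r = {B. \<forall>i j. B $ i $ j \<in> D ((r + index_int i - index_int j + 2) div 3)}"

lemma J_nth: "B \<in> J r \<Longrightarrow> B $ i $ j \<in> D ((r + index_int i - index_int j + 2) div 3)"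
  by (simp add: J_def)

lemma J_add: "B \<in> J r \<Longrightarrow> C \<in> J r \<Longrightarrow> B + C \<in> J r"
  by (simp add: J_def D_add)

lemma J_diff: "B \<in> J r \<Longrightarrow> C \<in> J r \<Longrightarrow> B - C \<in> J r"
  by (simp add: J_def D_diff)

lemma J_mono: "B \<in> J s \<Longrightarrow> r \<le> s \<Longrightarrow> B \<in> J r"
  using D_mono[OF J_nth[of B s] zdiv_mono1] by (simp add: J_def)

text \<open>Rounding up is subadditive, and i - j = (i - k) + (k - j).\<close>

lemma J_mult:
  assumes "B \<in> J r" "C \<in> J s"
  shows "B ** C \<in> J (r + s)"
proof -
  have "B $ i $ k * C $ k $ j \<in> D ((r + s + index_int i - index_int j + 2) div 3)" for i j k
  proof -
    have "(r + s + index_int i - index_int j + 2) div 3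
        \<le> (r + index_int i - index_int k + 2) div 3 + (s + index_int k - index_int j + 2) div 3"
      by presburger
    then show ?thesis using D_mult[OF J_nth[OF assms(1), of i k] J_nth[OF assms(2), of k j]] D_mono by blast
  qed
  then show ?thesis by (simp add: J_def mat_mult3 D_add)
qed

text \<open>As i - j lies between -2 and 2 and bounds are rounded upwards, passing from entrywise
  lattices to the filtration costs two steps out of three; the way back in \<open>J_subset_L\<close>
  costs none.\<close>

lemma L_subset_J: "L n \<subseteq> J (3 * n - 2)"
proof
  fix B assume "B \<in> L n"
  moreover have "(3 * n - 2 + index_int i - index_int j + 2) div 3 \<le> n" for i j
    using index_int_bounds[of i] index_int_bounds[of j] by presburger
  ultimately show "B \<in> J (3 * n - 2)" unfolding J_def by (auto intro: D_mono L_nth)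
qed

lemma J_subset_L: "J (3 * n) \<subseteq> L n"
proof
  fix B assume B: "B \<in> J (3 * n)"
  have "n \<le> (3 * n + index_int i - index_int j + 2) div 3" for i j
    using index_int_bounds[of i] index_int_bounds[of j] by presburger
  then show "B \<in> L n" unfolding L_iff by (auto intro: D_mono[OF J_nth[OF B]])
qed

lemma J_scalar: "c \<in> D 1 \<Longrightarrow> B \<in> J r \<Longrightarrow> B ** mat c \<in> J (r + 3)"
proof -
  assume c: "c \<in> D 1" "B \<in> J r"
  have "(r + 3 + index_int i - index_int j + 2) div 3 = 1 + (r + index_int i - index_int j + 2) div 3" for i j
    by presburger
  then show ?thesis using D_mult[OF c(1) J_nth[OF c(2)]] by (simp add: J_def mat_mult_scalar)
qed

lemma D1_multI: "x \<in> D 1 \<and> y \<in> D 0 \<or> x \<in> D 0 \<and> y \<in> D 1 \<Longrightarrow> x * y \<in> D 1"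
  using D_mult0 by blast

lemma of_nat_D0: "of_nat n \<in> D 0"
  by (induction n) (auto intro: D_add)

lemma J0_iff: "B \<in> J 0 \<longleftrightarrow> B \<in> L 0 \<and> B $ 2 $ 1 \<in> D 1 \<and> B $ 3 $ 1 \<in> D 1 \<and> B $ 3 $ 2 \<in> D 1"
  by (auto simp: J_def L_iff3 forall_3 D01)

lemma J1_iff: "B \<in> J 1 \<longleftrightarrow> B \<in> J 0 \<and> B $ 1 $ 1 \<in> D 1 \<and> B $ 2 $ 2 \<in> D 1 \<and> B $ 3 $ 3 \<in> D 1"
  unfolding J0_iff by (auto simp: J_def L_iff3 forall_3 D01)

lemma J_one: "mat 1 \<in> J 0"
  by (simp add: J0_iff L_one mat_nth)

section \<open>The Iwahori subgroup and its congruence filtration\<close>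

abbreviation Iw :: "('f ^ 3 ^ 3) set" where "Iw \<equiv> iwahori v"

definition Iwr :: "int \<Rightarrow> ('f ^ 3 ^ 3) set" where
  "Iwr r = {g \<in> K. g - mat 1 \<in> J r}"

lemma Iw_iff: "g \<in> Iw \<longleftrightarrow> g \<in> K \<and> g \<in> J 0"
  using K_L0[of g] by (auto simp: iwahori_def J0_iff)

lemma Iw_K: "g \<in> Iw \<Longrightarrow> g \<in> K"
  by (simp add: Iw_iff)

lemma Iwr_K: "g \<in> Iwr r \<Longrightarrow> g \<in> K"
  by (simp add: Iwr_def)

lemma Iwr_mono: "g \<in> Iwr s \<Longrightarrow> r \<le> s \<Longrightarrow> g \<in> Iwr r"
  by (auto simp: Iwr_def intro: J_mono)

lemma Iwr_Iw: "g \<in> Iwr r \<Longrightarrow> 0 \<le> r \<Longrightarrow> g \<in> Iw"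
  using J_add[of "g - mat 1" 0 "mat 1"] J_mono[of "g - mat 1" r 0] J_one by (auto simp: Iwr_def Iw_iff)

lemma pro_p_iwahori_eq: "pro_p_iwahori v = Iwr 1"
  unfolding pro_p_iwahori_def Iwr_def Iw_iff J1_iff
  using J_diff[of _ 0 "mat 1"] J_add[of "_ - mat 1" 0 "mat 1"] J_one
  by (auto simp: mat_nth forall_3)

lemma Iw_one: "mat 1 \<in> Iw"
  by (simp add: Iw_iff J_one)

lemma Iw_mult: "g \<in> Iw \<Longrightarrow> h \<in> Iw \<Longrightarrow> g ** h \<in> Iw"
  using J_mult[of g 0 h 0] by (simp add: Iw_iff K_mult)

text \<open>Modulo the maximal ideal the matrix is triangular and invertible. The corners (1, 1) and
  (3, 3) are read off from the two products with the inverse; the middle entry first requires that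
  entry (3, 2) of the inverse is a non-unit.\<close>

lemma Iw_diag_unit: "g \<in> Iw \<Longrightarrow> g $ i $ i \<notin> D 1"
proof
  assume g: "g \<in> Iw" "g $ i $ i \<in> D 1"
  let ?h = "matrix_inv g"
  have D0: "g $ a $ b \<in> D 0" "?h $ a $ b \<in> D 0" for a b
    using g(1) K_D0 K_inv by (auto simp: Iw_iff)
  have low: "g $ 2 $ 1 \<in> D 1" "g $ 3 $ 1 \<in> D 1" "g $ 3 $ 2 \<in> D 1"
    using g(1) by (auto simp: Iw_iff J0_iff)
  note D = D_add D1_multI
  have one: "g ** ?h = mat 1" "?h ** g = mat 1" using GL3_inv K_GL3 Iw_K g(1) by blast+
  consider "i = 1" | "i = 2" | "i = 3" using exhaust_3 by blast
  then show False
  proof cases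
    case 1
    then have "(?h ** g) $ 1 $ 1 \<in> D 1" using g(2) low D0 unfolding mat_mult3 by (auto intro!: D)
    then show False by (simp add: one mat_nth)
  next
    case 3
    then have "(g ** ?h) $ 3 $ 3 \<in> D 1" using g(2) low D0 unfolding mat_mult3 by (auto intro!: D)
    then show False by (simp add: one mat_nth)
  next
    case 2
    have u: "g $ 3 $ 3 \<notin> D 1"
    proof
      assume "g $ 3 $ 3 \<in> D 1"
      then have "(g ** ?h) $ 3 $ 3 \<in> D 1" using low D0 unfolding mat_mult3 by (auto intro!: D)
      then show False by (simp add: one mat_nth)
    qed
    have "(g ** ?h) $ 3 $ 2 \<in> D 1" by (simp add: one mat_nth)
    moreover have "g $ 3 $ 1 * ?h $ 1 $ 2 + g $ 3 $ 2 * ?h $ 2 $ 2 \<in> D 1"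
      using low D0 by (auto intro!: D)
    ultimately have "(g ** ?h) $ 3 $ 2 - (g $ 3 $ 1 * ?h $ 1 $ 2 + g $ 3 $ 2 * ?h $ 2 $ 2) \<in> D 1"
      by (rule D_diff)
    then have "g $ 3 $ 3 * ?h $ 3 $ 2 \<in> D 1" by (simp add: mat_mult3)
    with \<open>g $ 3 $ 3 \<notin> D 1\<close> have "?h $ 3 $ 2 \<in> D 1" using D_cancel_unit by blast
    then have "(g ** ?h) $ 2 $ 2 \<in> D 1" using 2 g(2) low D0 unfolding mat_mult3 by (auto intro!: D)
    then show False by (simp add: one mat_nth)
  qed
qed

lemma Iw_inv: "g \<in> Iw \<Longrightarrow> matrix_inv g \<in> Iw"
proof -
  assume g: "g \<in> Iw"
  let ?h = "matrix_inv g"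
  have hK: "?h \<in> K" using g K_inv Iw_K by blast
  have D0: "g $ a $ b \<in> D 0" "?h $ a $ b \<in> D 0" for a b
    using g hK K_D0 by (auto simp: Iw_iff)
  have low: "g $ 2 $ 1 \<in> D 1" "g $ 3 $ 1 \<in> D 1" "g $ 3 $ 2 \<in> D 1"
    using g by (auto simp: Iw_iff J0_iff)
  have one: "g ** ?h = mat 1" "?h ** g = mat 1" using GL3_inv K_GL3 Iw_K g by blast+
  have *: "b \<in> D 1" if "a * b + c = 0" "c \<in> D 1" "a \<notin> D 1" for a b c
    using that D_cancel_unit[of a b 1] D_uminus[of c 1] by (metis add_eq_0_iff2)
  have h1: "?h $ i $ 1 \<in> D 1" if "i \<noteq> 1" for i
  proof (rule *[of "g $ 1 $ 1" _ "?h $ i $ 2 * g $ 2 $ 1 + ?h $ i $ 3 * g $ 3 $ 1"])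
    have "(?h ** g) $ i $ 1 = 0" using that by (simp add: one mat_nth)
    then show "g $ 1 $ 1 * ?h $ i $ 1 + (?h $ i $ 2 * g $ 2 $ 1 + ?h $ i $ 3 * g $ 3 $ 1) = 0"
      by (simp add: mat_mult3 algebra_simps)
  qed (auto simp: Iw_diag_unit g D0 low intro!: D_add D1_multI)
  have h2: "?h $ 3 $ 2 \<in> D 1"
  proof (rule *[of "g $ 3 $ 3" _ "g $ 3 $ 1 * ?h $ 1 $ 2 + g $ 3 $ 2 * ?h $ 2 $ 2"])
    have "(g ** ?h) $ 3 $ 2 = 0" by (simp add: one mat_nth)
    then show "g $ 3 $ 3 * ?h $ 3 $ 2 + (g $ 3 $ 1 * ?h $ 1 $ 2 + g $ 3 $ 2 * ?h $ 2 $ 2) = 0"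
      by (simp add: mat_mult3 algebra_simps)
  qed (auto simp: Iw_diag_unit g D0 low intro!: D_add D1_multI)
  show ?thesis using hK h1 h2 K_L0 by (simp add: Iw_iff J0_iff)
qed

lemma Iwr_one [simp]: "mat 1 \<in> Iwr r"
  by (simp add: Iwr_def J_def)

lemma Iwr_mult: "g \<in> Iwr r \<Longrightarrow> h \<in> Iwr r \<Longrightarrow> 0 \<le> r \<Longrightarrow> g ** h \<in> Iwr r"
proof -
  assume a: "g \<in> Iwr r" "h \<in> Iwr r" "0 \<le> r"
  have "g ** h - mat 1 = g ** (h - mat 1) + (g - mat 1)"
    by (simp add: matrix_diff_ldistrib)
  moreover have "g ** (h - mat 1) \<in> J (0 + r)"
    using a Iwr_Iw by (intro J_mult) (auto simp: Iwr_def Iw_iff)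
  ultimately have "g ** h - mat 1 \<in> J r" using a by (simp only: Iwr_def) (auto intro: J_add)
  then show ?thesis using a by (simp add: Iwr_def K_mult)
qed

lemma Iwr_conj: "g \<in> Iwr r \<Longrightarrow> h \<in> Iw \<Longrightarrow> h ** g ** matrix_inv h \<in> Iwr r"
proof -
  assume a: "g \<in> Iwr r" "h \<in> Iw"
  have h: "h \<in> GL3" using a K_GL3 Iw_K by blast
  have "h ** g ** matrix_inv h - mat 1 = h ** (g - mat 1) ** matrix_inv h"
    using GL3_inv[OF h] by (simp add: matrix_diff_ldistrib matrix_diff_rdistrib)
  moreover have "h ** (g - mat 1) ** matrix_inv h \<in> J (0 + r + 0)"
    using a Iw_inv[OF a(2)] by (intro J_mult) (auto simp: Iwr_def Iw_iff)
  moreover have "h ** g ** matrix_inv h \<in> K"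
    using K_mult[OF K_mult[OF Iw_K[OF a(2)] Iwr_K[OF a(1)]] K_inv[OF Iw_K[OF a(2)]]] .
  ultimately show ?thesis by (auto simp: Iwr_def)
qed

text \<open>Since s^-1 g - 1 = s^-1 (g - s), additive congruences in the Iwahori order become
  multiplicative ones.\<close>

lemma Iwr_quotient:
  assumes "s \<in> K" "s \<in> J 0" "matrix_inv s \<in> J 0" "g \<in> K" "g - s \<in> J r"
  shows "matrix_inv s ** g \<in> Iwr r"
proof -
  have "matrix_inv s ** g - mat 1 = matrix_inv s ** (g - s)"
    using GL3_inv[OF K_GL3[OF assms(1)]] by (simp add: matrix_diff_ldistrib)
  also have "\<dots> \<in> J (0 + r)" by (intro J_mult assms)
  finally show ?thesis using assms by (simp add: Iwr_def K_mult K_inv)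
qed

lemma Iw_commute:
  assumes "g \<in> Iw" "h \<in> Iw" "g ** h - h ** g \<in> J r"
  obtains u where "u \<in> Iwr r" "g ** h = h ** g ** u"
proof
  have hg: "h ** g \<in> Iw" using assms Iw_mult by blast
  show "matrix_inv (h ** g) ** (g ** h) \<in> Iwr r"
    using assms hg Iw_inv[OF hg] by (intro Iwr_quotient) (auto simp: Iw_iff K_mult)
  show "g ** h = h ** g ** (matrix_inv (h ** g) ** (g ** h))"
    by (rule GL3_inv_cancel(1)[OF K_GL3[OF Iw_K[OF hg]], symmetric])
qed

text \<open>The Iwahori order modulo its radical is a product of three copies of the residue field,
  hence commutative; so only the diagonal of the commutator has to be examined.\<close>

lemma Iw_commutator_diff: "g \<in> Iw \<Longrightarrow> h \<in> Iw \<Longrightarrow> g ** h - h ** g \<in> J 1"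
proof -
  assume a: "g \<in> Iw" "h \<in> Iw"
  have "g ** h - h ** g \<in> J 0" using J_mult[of g 0 h 0] J_mult[of h 0 g 0] a
    by (auto simp: Iw_iff intro!: J_diff)
  moreover have D0: "g $ i $ j \<in> D 0" "h $ i $ j \<in> D 0" for i j
    using a K_D0 Iw_K by blast+
  moreover have low: "g $ 2 $ 1 \<in> D 1" "g $ 3 $ 1 \<in> D 1" "g $ 3 $ 2 \<in> D 1"
      "h $ 2 $ 1 \<in> D 1" "h $ 3 $ 1 \<in> D 1" "h $ 3 $ 2 \<in> D 1"
    using a by (auto simp: Iw_iff J0_iff)
  have "(g ** h) $ i $ i - (h ** g) $ i $ i \<in> D 1" for i
  proof -
    consider "i = 1" | "i = 2" | "i = 3" using exhaust_3 by blast
    then show ?thesis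
    proof cases
      case 1
      have "(g ** h) $ 1 $ 1 - (h ** g) $ 1 $ 1
          = (g $ 1 $ 2 * h $ 2 $ 1 + g $ 1 $ 3 * h $ 3 $ 1) - (h $ 1 $ 2 * g $ 2 $ 1 + h $ 1 $ 3 * g $ 3 $ 1)"
        by (simp add: mat_mult3)
      then show ?thesis using 1 by (auto simp: D0 low intro!: D_add D_diff D1_multI)
    next
      case 2
      have "(g ** h) $ 2 $ 2 - (h ** g) $ 2 $ 2
          = (g $ 2 $ 1 * h $ 1 $ 2 + g $ 2 $ 3 * h $ 3 $ 2) - (h $ 2 $ 1 * g $ 1 $ 2 + h $ 2 $ 3 * g $ 3 $ 2)"
        by (simp add: mat_mult3)
      then show ?thesis using 2 by (auto simp: D0 low intro!: D_add D_diff D1_multI)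
    next
      case 3
      have "(g ** h) $ 3 $ 3 - (h ** g) $ 3 $ 3
          = (g $ 3 $ 1 * h $ 1 $ 3 + g $ 3 $ 2 * h $ 2 $ 3) - (h $ 3 $ 1 * g $ 1 $ 3 + h $ 3 $ 2 * g $ 2 $ 3)"
        by (simp add: mat_mult3)
      then show ?thesis using 3 by (auto simp: D0 low intro!: D_add D_diff D1_multI)
    qed
  qed
  ultimately show ?thesis by (simp add: J1_iff)
qed

text \<open>The commutator of g and h is that of g - 1 and h - 1, so the level in the filtration
  doubles.\<close>

lemma Iwr_commutator_diff:
  assumes "g \<in> Iwr r" "h \<in> Iwr r"
  shows "g ** h - h ** g \<in> J (r + r)"
proof -
  have "g ** h - h ** g = (g - mat 1) ** (h - mat 1) - (h - mat 1) ** (g - mat 1)"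
    by (simp add: matrix_diff_ldistrib matrix_diff_rdistrib)
  moreover have "(g - mat 1) ** (h - mat 1) \<in> J (r + r)" "(h - mat 1) ** (g - mat 1) \<in> J (r + r)"
    using assms by (auto simp only: Iwr_def mem_Collect_eq intro: J_mult)
  ultimately show ?thesis using J_diff by simp
qed

definition mat_pow :: "'f ^ 3 ^ 3 \<Rightarrow> nat \<Rightarrow> 'f ^ 3 ^ 3" where
  "mat_pow g n = (((**) g) ^^ n) (mat 1)"

lemma mat_pow_simps [simp]: "mat_pow g 0 = mat 1" "mat_pow g (Suc n) = g ** mat_pow g n"
  by (simp_all add: mat_pow_def)

lemma mat_pow_add: "mat_pow g (m + n) = mat_pow g m ** mat_pow g n"
  by (induction m) (simp_all add: matrix_mul_assoc)

lemma mat_pow_K: "g \<in> K \<Longrightarrow> mat_pow g n \<in> K"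
  by (induction n) (auto intro: K_mult)

lemma mat_pow_Iwr: "g \<in> Iwr r \<Longrightarrow> 0 \<le> r \<Longrightarrow> mat_pow g n \<in> Iwr r"
  by (induction n) (auto intro: Iwr_mult)

text \<open>(1 + B)^n is congruent to 1 + n B modulo \<open>J (r + 1)\<close>, because B^2 lies in
  \<open>J (r + r)\<close> and r \<ge> 1. For n = p the linear term falls into
  \<open>J (r + 3)\<close>.\<close>

lemma mat_pow_char_Iwr:
  assumes "g \<in> Iwr r" "1 \<le> r" "of_nat p \<in> D 1"
  shows "mat_pow g p \<in> Iwr (r + 1)"
proof -
  define B where "B = g - mat 1"
  have B: "B \<in> J r" "g = mat 1 + B" using assms(1) by (auto simp: B_def Iwr_def)
  have "mat_pow g n - mat 1 - B ** mat (of_nat n) \<in> J (r + 1)" for n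
  proof (induction n)
    case 0
    then show ?case by (simp add: J_def mat_mult_scalar)
  next
    case (Suc n)
    define C where "C = mat_pow g n - mat 1 - B ** mat (of_nat n)"
    have P: "mat_pow g n = mat 1 + B ** mat (of_nat n) + C" by (simp add: C_def)
    have eq: "mat_pow g (Suc n) - mat 1 - B ** mat (of_nat (Suc n)) = C + B ** (B ** mat (of_nat n)) + B ** C"
    proof -
      have "g ** mat_pow g n = g ** (mat 1 + B ** mat (of_nat n) + C)" by (simp only: P)
      also have "\<dots> = (mat 1 + B) ** (mat 1 + B ** mat (of_nat n) + C)" by (simp only: B(2))
      also have "\<dots> = mat 1 + B ** mat (of_nat n) + C + B + B ** (B ** mat (of_nat n)) + B ** C"
        by (simp add: matrix_add_ldistrib mat_add_mult)
      also have "B ** mat (of_nat (Suc n)) = B ** mat (of_nat n) + B"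
        by (simp add: vec_eq_iff mat_mult_scalar algebra_simps)
      ultimately show ?thesis by simp
    qed
    have "B ** mat (of_nat n) \<in> J (r + 0)"
      using B(1) by (intro J_mult) (auto simp: J_def mat_nth forall_3 intro: of_nat_D0)
    then have BB: "B ** (B ** mat (of_nat n)) \<in> J (r + 1)"
      using B(1) assms(2) J_mono[OF J_mult[of B r "B ** mat (of_nat n)" r], of "r + 1"] by simp
    have BC: "B ** C \<in> J (r + 1)"
      using Suc B(1) assms(2) J_mono[OF J_mult[of B r C "r + 1"], of "r + 1"] by (simp add: C_def)
    show ?case unfolding eq using J_add[OF J_add[OF _ BB] BC] Suc unfolding C_def .
  qed
  from this[of p] have "(mat_pow g p - mat 1 - B ** mat (of_nat p)) + B ** mat (of_nat p) \<in> J (r + 1)"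
    using J_mono[OF J_scalar[OF assms(3) B(1)], of "r + 1"] by (intro J_add) auto
  then show ?thesis using mat_pow_K[OF Iwr_K[OF assms(1)]] by (simp add: Iwr_def)
qed

end

section \<open>Fixed vectors of the pro-p-Iwahori subgroup\<close>

context uniformized_field
begin

text \<open>\<open>Iwr r\<close> acts on the vectors fixed by \<open>Iwr (r + 1)\<close> through a
  finite abelian group of exponent p. A common eigenvector exists, and its eigenvalues are p-th
  roots of unity, which in characteristic p are all 1.\<close>

lemma fixed_by_larger_Iwr:
  fixes smul :: "'k::alg_closed_field \<Rightarrow> 'w::ab_group_add \<Rightarrow> 'w"
    and act :: "'f ^ 3 ^ 3 \<Rightarrow> 'w \<Rightarrow> 'w"
  assumes "vector_space smul" and p: "Factorial_Ring.prime CHAR('k)" "of_nat CHAR('k) \<in> D 1"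
    and A: "module.subspace smul A"
    and lin: "\<And>g. g \<in> Iwr 1 \<Longrightarrow> Vector_Spaces.linear smul smul (act g)"
    and stable: "\<And>g w. g \<in> Iwr 1 \<Longrightarrow> w \<in> A \<Longrightarrow> act g w \<in> A"
    and mult: "\<And>g h w. g \<in> Iwr 1 \<Longrightarrow> h \<in> Iwr 1 \<Longrightarrow> w \<in> A \<Longrightarrow> act (g ** h) w = act g (act h w)"
    and one: "\<And>w. w \<in> A \<Longrightarrow> act (mat 1) w = w"
    and r: "1 \<le> r" and w: "w \<in> A" "w \<noteq> 0" "\<And>g. g \<in> Iwr (r + 1) \<Longrightarrow> act g w = w"
  shows "\<exists>w\<in>A. w \<noteq> 0 \<and> (\<forall>g\<in>Iwr r. act g w = w)"
proof -
  interpret vector_space smul by fact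
  have sub1: "g \<in> Iwr r \<Longrightarrow> g \<in> Iwr 1" "g \<in> Iwr (r + 1) \<Longrightarrow> g \<in> Iwr 1" for g
    using r by (auto intro: Iwr_mono)
  let ?A = "{w \<in> A. \<forall>g\<in>Iwr (r + 1). act g w = w}"
  have "Iwr r \<subseteq> L 0" using K_L0 Iwr_K by blast
  then obtain S where S: "finite S" "S \<subseteq> Iwr r" "\<And>g. g \<in> Iwr r \<Longrightarrow> \<exists>s\<in>S. g - s \<in> L (r + 1)"
    using finite_L_quotient[of "Iwr r" 0 "r + 1"] by blast
  have quot: "\<exists>s\<in>S. \<exists>h\<in>Iwr (r + 1). g = s ** h" if g: "g \<in> Iwr r" for g
  proof -
    obtain s where s: "s \<in> S" "g - s \<in> L (r + 1)" using S(3)[OF g] by blast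
    have sI: "s \<in> Iwr r" using s(1) S(2) by blast
    have "g - s \<in> J (r + 1)" using subsetD[OF L_subset_J s(2)] r by (auto intro: J_mono)
    then have "matrix_inv s ** g \<in> Iwr (r + 1)"
      using sI g r Iw_inv[OF Iwr_Iw[OF sI]] Iwr_Iw[OF sI] Iwr_K[OF g]
      by (intro Iwr_quotient) (auto simp: Iw_iff)
    moreover have "g = s ** (matrix_inv s ** g)"
      using GL3_inv_cancel(1) K_GL3 Iwr_K[OF sI] by metis
    ultimately show ?thesis using s(1) by blast
  qed
  have "\<exists>w\<in>?A. w \<noteq> 0 \<and> (\<forall>s\<in>S. \<exists>c. act s w = smul c w)"
  proof (rule common_eigenvector[OF assms(1) S(1)])
    show "subspace ?A"
    proof (rule subspaceI)
      fix x y c assume xy: "x \<in> ?A" "y \<in> ?A"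
      have *: "act g (x + y) = act g x + act g y" "act g (smul c x) = smul c (act g x)"
        if "g \<in> Iwr (r + 1)" for g
        using lin[OF sub1(2)[OF that]] by (auto simp: linear_iff_module_hom module_hom.add module_hom.scale)
      show "x + y \<in> ?A" "smul c x \<in> ?A"
        using xy * A by (auto intro: subspace_add subspace_scale)
    next
      have "act g 0 = 0" if "g \<in> Iwr (r + 1)" for g
        using module_hom.zero[OF lin[OF sub1(2)[OF that], unfolded linear_iff_module_hom]] .
      then show "0 \<in> ?A" using subspace_0[OF A] by blast
    qed
    show "?A \<noteq> {0}" using w by blast
    fix s assume "s \<in> S"
    then have s: "s \<in> Iwr r" "s \<in> Iwr 1" using S(2) sub1 by blast+
    show "Vector_Spaces.linear smul smul (act s)" using lin s by blast
    show "act s w \<in> ?A" if wA: "w \<in> ?A" for w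
    proof -
      have "act h (act s w) = act s w" if h: "h \<in> Iwr (r + 1)" for h
      proof -
        have "matrix_inv s ** h ** matrix_inv (matrix_inv s) \<in> Iwr (r + 1)"
          using h Iw_inv[OF Iwr_Iw[OF s(2)]] by (intro Iwr_conj) auto
        then have u: "matrix_inv s ** h ** s \<in> Iwr (r + 1)" (is "?u \<in> _")
          using GL3_inv(4)[OF K_GL3[OF Iwr_K[OF s(1)]]] by simp
        have "h ** s = s ** ?u"
          using GL3_inv_cancel(1)[OF K_GL3[OF Iwr_K[OF s(1)]], of "h ** s"] by (simp add: matrix_mul_assoc)
        then have "act h (act s w) = act s (act ?u w)"
          using mult[of h s w] mult[of s ?u w] h s u wA sub1 by auto
        then show ?thesis using u wA by simp
      qed
      then show ?thesis using stable[OF s(2)] wA by blast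
    qed
    show "act s (act t w) = act t (act s w)" if t: "t \<in> S" and wA: "w \<in> ?A" for t w
    proof -
      have t: "t \<in> Iwr r" "t \<in> Iwr 1" using S(2) sub1 t by blast+
      have "s ** t - t ** s \<in> J (r + 1)" using Iwr_commutator_diff[OF s(1) t(1)] r by (auto intro: J_mono)
      then obtain u where u: "u \<in> Iwr (r + 1)" "s ** t = t ** s ** u"
        using Iw_commute[of s t] Iwr_Iw[OF s(2)] Iwr_Iw[OF t(2)] by auto
      have "act (s ** t) w = act (t ** s) (act u w)"
        unfolding u(2) using u(1) s t wA sub1 by (intro mult) (auto intro: Iwr_mult)
      then show ?thesis using mult[of s t w] mult[of t s w] s t u(1) wA by auto
    qed
    have pow: "(act s ^^ n) w = act (mat_pow s n) w" if "w \<in> A" for n w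
      using that
    proof (induction n)
      case (Suc n)
      then show ?case using mult[of s "mat_pow s n" w] mat_pow_Iwr[OF s(2)] s by simp
    qed (simp add: one)
    show "\<exists>N>0. \<forall>w\<in>?A. (act s ^^ N) w = w"
      using pow mat_pow_char_Iwr[OF s(1) r p(2)] prime_gt_0_nat[OF p(1)] by auto
  qed
  then obtain w1 where w1: "w1 \<in> ?A" "w1 \<noteq> 0" "\<And>s. s \<in> S \<Longrightarrow> \<exists>c. act s w1 = smul c w1"
    by blast
  have fixed: "act s w1 = w1" if s: "s \<in> S" for s
  proof -
    have sI: "s \<in> Iwr r" "s \<in> Iwr 1" using s S(2) sub1 by blast+
    obtain c where c: "act s w1 = smul c w1" using w1(3) s by blast
    have "act (mat_pow s n) w1 = smul (c ^ n) w1" for n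
    proof (induction n)
      case (Suc n)
      have "act (mat_pow s (Suc n)) w1 = act s (act (mat_pow s n) w1)"
        using mult[of s "mat_pow s n" w1] mat_pow_Iwr[OF sI(2)] sI w1(1) by simp
      then show ?case using Suc c module_hom.scale[OF lin[OF sI(2), unfolded linear_iff_module_hom]]
        by (simp add: mult.commute)
    qed (use w1(1) one in auto)
    from this[of "CHAR('k)"] have "smul (c ^ CHAR('k)) w1 = w1"
      using mat_pow_char_Iwr[OF sI(1) r p(2)] w1(1) by auto
    then have "smul (c ^ CHAR('k) - 1) w1 = 0" by (simp add: scale_left_diff_distrib)
    then have "c ^ CHAR('k) = 1" using w1(2) by simp
    \<comment> \<open>With c = (c - 1) + 1 the additivity of p-th powers turns c^p = 1 into (c -
      1)^p = 0.\<close>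
    moreover have "(c - 1 + 1) ^ CHAR('k) = (c - 1) ^ CHAR('k) + 1 ^ CHAR('k)"
      by (rule freshmans_dream[OF p(1) refl])
    ultimately have "c = 1" by simp
    then show ?thesis using c by simp
  qed
  have "act g w1 = w1" if g: "g \<in> Iwr r" for g
  proof -
    obtain s h where sh: "s \<in> S" "h \<in> Iwr (r + 1)" "g = s ** h" using quot[OF g] by blast
    then have "act g w1 = act s (act h w1)" using mult[of s h w1] S(2) sub1 w1(1) by blast
    then show ?thesis using sh fixed w1(1) by simp
  qed
  then show ?thesis using w1 by blast
qed

text \<open>A pro-p group in characteristic p has fixed vectors, obtained by descending along the
  filtration. The action is kept abstract because it will be both \<sigma> itself and the action on
  linear functionals.\<close>

lemma pro_p_fixed_vector:
  fixes smul :: "'k::alg_closed_field \<Rightarrow> 'w::ab_group_add \<Rightarrow> 'w"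
    and act :: "'f ^ 3 ^ 3 \<Rightarrow> 'w \<Rightarrow> 'w"
  assumes "vector_space smul" "Factorial_Ring.prime CHAR('k)" "of_nat CHAR('k) \<in> D 1"
    "module.subspace smul A"
    "\<And>g. g \<in> Iwr 1 \<Longrightarrow> Vector_Spaces.linear smul smul (act g)"
    "\<And>g w. g \<in> Iwr 1 \<Longrightarrow> w \<in> A \<Longrightarrow> act g w \<in> A"
    "\<And>g h w. g \<in> Iwr 1 \<Longrightarrow> h \<in> Iwr 1 \<Longrightarrow> w \<in> A \<Longrightarrow> act (g ** h) w = act g (act h w)"
    "\<And>w. w \<in> A \<Longrightarrow> act (mat 1) w = w"
    "w \<in> A" "w \<noteq> 0" "\<And>g. g \<in> Iwr r \<Longrightarrow> act g w = w"
  shows "\<exists>w\<in>A. w \<noteq> 0 \<and> (\<forall>g\<in>Iwr 1. act g w = w)"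
proof -
  have "\<exists>w\<in>A. w \<noteq> 0 \<and> (\<forall>g\<in>Iwr 1. act g w = w)"
    if "w \<in> A" "w \<noteq> 0" "\<forall>g\<in>Iwr (1 + int n). act g w = w" for n w
    using that
  proof (induction n arbitrary: w)
    case (Suc n)
    have "\<exists>w\<in>A. w \<noteq> 0 \<and> (\<forall>g\<in>Iwr (1 + int n). act g w = w)"
      using assms(1-8) Suc.prems by (intro fixed_by_larger_Iwr[of smul A act "1 + int n" w]) (auto simp: add.assoc)
    then show ?case using Suc.IH by blast
  qed auto
  from this[of w "nat (r - 1)"] show ?thesis
    using assms(9-11) Iwr_mono[of _ "1 + int (nat (r - 1))" r] by auto
qed

end

section \<open>Weights\<close>

text \<open>The coefficients are any algebraically closed field whose characteristic is the residue
  characteristic; the concrete algebraic closure enters only at the end.\<close>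

locale weight = uniformized_field v \<pi> + V: vector_space smul
  for v :: "'f::field \<Rightarrow> int" and \<pi> :: 'f
    and smul :: "'k::alg_closed_field \<Rightarrow> 'v::ab_group_add \<Rightarrow> 'v" +
  fixes \<sigma> :: "'f ^ 3 ^ 3 \<Rightarrow> 'v \<Rightarrow> 'v"
  assumes prime_char: "Factorial_Ring.prime CHAR('k)" and residue_char: "residue_char v = CHAR('k)"
    and rep: "is_representation smul (GL3_int v) \<sigma>"
    and smooth: "smooth_representation v (GL3_int v) \<sigma>"
    and irreducible: "irreducible_representation smul (GL3_int v) \<sigma>"
begin

lemma char_D1: "of_nat CHAR('k) \<in> D 1"
  using residue_char_properties(1) residue_char by simp

lemma card_residue_zero: "of_nat (card (residue_class ` D 0)) = (0::'k)"
  using residue_char_properties(2) residue_char by (simp add: of_nat_eq_0_iff_char_dvd)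

lemma sg_linear: "g \<in> K \<Longrightarrow> Vector_Spaces.linear smul smul (\<sigma> g)"
  using rep by (simp add: is_representation_def)

lemma sg_hom: "g \<in> K \<Longrightarrow> module_hom smul smul (\<sigma> g)"
  using sg_linear linear_iff_module_hom by blast

lemma sg_add: "g \<in> K \<Longrightarrow> \<sigma> g (w + w') = \<sigma> g w + \<sigma> g w'"
  by (rule module_hom.add[OF sg_hom])

lemma sg_scale: "g \<in> K \<Longrightarrow> \<sigma> g (smul c w) = smul c (\<sigma> g w)"
  by (rule module_hom.scale[OF sg_hom])

lemma sg_zero: "g \<in> K \<Longrightarrow> \<sigma> g 0 = 0"
  by (rule module_hom.zero[OF sg_hom])

lemma sg_sum: "g \<in> K \<Longrightarrow> \<sigma> g (sum F A) = (\<Sum>x\<in>A. \<sigma> g (F x))"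
  by (rule module_hom.sum[OF sg_hom])

lemma sg_one [simp]: "\<sigma> (mat 1) w = w"
  using rep by (simp add: is_representation_def)

lemma sg_mult: "g \<in> K \<Longrightarrow> h \<in> K \<Longrightarrow> \<sigma> (g ** h) w = \<sigma> g (\<sigma> h w)"
  using rep by (simp add: is_representation_def)

lemma sg_inv_cancel: "g \<in> K \<Longrightarrow> \<sigma> (matrix_inv g) (\<sigma> g w) = w" "g \<in> K \<Longrightarrow> \<sigma> g (\<sigma> (matrix_inv g) w) = w"
  using sg_mult[of "matrix_inv g" g w] sg_mult[of g "matrix_inv g" w] GL3_inv[OF K_GL3] K_inv by auto

lemma sg_eq_zero: "g \<in> K \<Longrightarrow> \<sigma> g w = 0 \<longleftrightarrow> w = 0"
  using sg_inv_cancel(1)[of g w] sg_zero[OF K_inv, of g] sg_zero[of g] by auto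

lemma irreducibleD:
  assumes "V.subspace W" "\<And>g w. g \<in> K \<Longrightarrow> w \<in> W \<Longrightarrow> \<sigma> g w \<in> W" "w \<in> W" "w \<noteq> 0"
  shows "W = UNIV"
proof -
  have "\<forall>g\<in>K. \<sigma> g ` W \<subseteq> W" using assms(2) by blast
  then have "W = {0} \<or> W = UNIV"
    using irreducible assms(1) unfolding irreducible_representation_def by simp
  then show ?thesis using assms(3,4) by auto
qed

lemma nonzero_vector: "\<exists>w::'v. w \<noteq> 0"
  using irreducible unfolding irreducible_representation_def by auto

lemma smooth_vector: "\<exists>n. \<forall>g\<in>K. g - mat 1 \<in> L n \<longrightarrow> \<sigma> g w = w"
proof -
  have "openin (subtopology (GL3_topology v) K) {h \<in> K. \<sigma> h w = w}"
    using smooth by (simp add: smooth_representation_def)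
  then obtain U where U: "openin (mat_topology v) U" "{h \<in> K. \<sigma> h w = w} = U \<inter> GL3 \<inter> K"
    unfolding GL3_topology_def openin_subtopology by blast
  have "mat 1 \<in> {h \<in> K. \<sigma> h w = w}" by simp
  then have "mat 1 \<in> U" unfolding U(2) by simp
  then obtain n where n: "\<forall>B. (\<forall>i j. B $ i $ j - mat 1 $ i $ j \<in> D n) \<longrightarrow> B \<in> U"
    using U(1) unfolding openin_mat_topology by meson
  have "\<sigma> g w = w" if g: "g \<in> K" "g - mat 1 \<in> L n" for g
  proof -
    have "g \<in> U" using g(2) n by (simp add: L_iff)
    then have "g \<in> U \<inter> GL3 \<inter> K" using g K_GL3 by simp
    then show ?thesis unfolding U(2)[symmetric] by simp
  qed
  then show ?thesis by blast
qed

definition inv1 :: "'v set" where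
  "inv1 = {w. \<forall>g\<in>Iwr 1. \<sigma> g w = w}"

lemma inv1_D: "w \<in> inv1 \<Longrightarrow> g \<in> Iwr 1 \<Longrightarrow> \<sigma> g w = w"
  by (simp add: inv1_def)

lemma inv1_eq: "inv1 = invariants (pro_p_iwahori v) \<sigma>"
  by (simp add: inv1_def invariants_def pro_p_iwahori_eq)

lemma fixed_subspace: "H \<subseteq> K \<Longrightarrow> V.subspace {w. \<forall>g\<in>H. \<sigma> g w = w}"
  by (rule V.subspaceI) (simp_all add: sg_add sg_scale sg_zero subset_iff)

lemma inv1_subspace: "V.subspace inv1"
  unfolding inv1_def by (rule fixed_subspace) (auto intro: Iwr_K)

text \<open>Smoothness supplies a small subgroup fixing the given vector, from which the pro-p
  argument starts. The relative form, inside a stable subspace, is what later proves non-vanishing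
  of \<open>\<phi>\<close>.\<close>

lemma exists_inv1_in:
  assumes "V.subspace A" "\<And>g w. g \<in> Iwr 1 \<Longrightarrow> w \<in> A \<Longrightarrow> \<sigma> g w \<in> A" "w \<in> A" "w \<noteq> 0"
  shows "\<exists>w\<in>A. w \<noteq> 0 \<and> w \<in> inv1"
proof -
  obtain n where n: "\<And>g. g \<in> K \<Longrightarrow> g - mat 1 \<in> L n \<Longrightarrow> \<sigma> g w = w" using smooth_vector by blast
  have "\<sigma> g w = w" if "g \<in> Iwr (3 * n)" for g
    using that J_subset_L[of n] n by (auto simp: Iwr_def)
  then show ?thesis
    using pro_p_fixed_vector[OF V.vector_space_axioms prime_char char_D1 assms(1), of \<sigma> w "3 * n"] assms
    by (auto simp: inv1_def sg_linear sg_mult Iwr_K)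
qed

text \<open>The principal congruence subgroup is normal in K and fixes the nonzero space
  \<open>inv1\<close>. Its fixed vectors are therefore everything by irreducibility: \<sigma> is
  inflated from the finite group over the residue field.\<close>

lemma sg_near_one:
  assumes "g \<in> K" "g - mat 1 \<in> L 1"
  shows "\<sigma> g w = w"
proof -
  let ?H = "{g \<in> K. g - mat 1 \<in> L 1}"
  let ?W = "{w. \<forall>g\<in>?H. \<sigma> g w = w}"
  obtain w0 where w0: "w0 \<in> inv1" "w0 \<noteq> 0"
    using exists_inv1_in[of UNIV] nonzero_vector by auto
  have "?H \<subseteq> Iwr 1" using L_subset_J[of 1] by (auto simp: Iwr_def)
  then have "w0 \<in> ?W" using inv1_D[OF w0(1)] by blast
  moreover have "\<sigma> h w \<in> ?W" if h: "h \<in> K" and w: "w \<in> ?W" for h w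
  proof -
    have "\<sigma> g (\<sigma> h w) = \<sigma> h w" if g: "g \<in> ?H" for g
    proof -
      let ?u = "matrix_inv h ** g ** h"
      have hG: "h \<in> GL3" using h K_GL3 by blast
      have "?u - mat 1 = matrix_inv h ** (g - mat 1) ** h"
        using GL3_inv[OF hG] by (simp add: matrix_diff_ldistrib matrix_diff_rdistrib)
      then have "?u - mat 1 \<in> L 1" using g h K_inv K_L_left K_L_right by auto
      moreover have u: "?u \<in> K" using g h by (auto intro: K_mult K_inv)
      ultimately have "\<sigma> ?u w = w" using w by blast
      moreover have "g ** h = h ** ?u"
        using GL3_inv_cancel(1)[OF hG, of "g ** h"] by (simp add: matrix_mul_assoc)
      ultimately show ?thesis using sg_mult[of g h w] sg_mult[of h ?u w] g h u by auto
    qed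
    then show ?thesis by blast
  qed
  ultimately have "?W = UNIV"
    using w0 by (intro irreducibleD[of ?W w0] fixed_subspace) auto
  then show ?thesis using assms by blast
qed

lemma sg_congruent:
  assumes "g \<in> K" "h \<in> K" "g - h \<in> L 1"
  shows "\<sigma> g w = \<sigma> h w"
proof -
  have h: "h \<in> GL3" using assms K_GL3 by blast
  have "matrix_inv h ** g - mat 1 = matrix_inv h ** (g - h)"
    using GL3_inv[OF h] by (simp add: matrix_diff_ldistrib)
  then have "matrix_inv h ** g - mat 1 \<in> L 1" using assms K_inv K_L_left by auto
  then have "\<sigma> (matrix_inv h ** g) w = w" using assms by (intro sg_near_one) (auto intro: K_mult K_inv)
  moreover have "\<sigma> (h ** (matrix_inv h ** g)) w = \<sigma> h (\<sigma> (matrix_inv h ** g) w)"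
    using assms by (intro sg_mult) (auto intro: K_mult K_inv)
  ultimately show ?thesis using GL3_inv_cancel(1)[OF h, of g] by simp
qed

text \<open>\<open>J 1\<close> is the radical of the Iwahori order, so on invariants only the
  diagonal modulo the maximal ideal acts.\<close>

lemma sg_inv1_congruent:
  assumes "g \<in> Iw" "h \<in> Iw" "g - h \<in> J 1" "w \<in> inv1"
  shows "\<sigma> g w = \<sigma> h w"
proof -
  have "matrix_inv h ** g \<in> Iwr 1"
    using assms Iw_inv[OF assms(2)] by (intro Iwr_quotient) (auto simp: Iw_iff)
  then have "\<sigma> (h ** (matrix_inv h ** g)) w = \<sigma> h w"
    using sg_mult[of h "matrix_inv h ** g" w] inv1_D[OF assms(4)] assms Iwr_K Iw_K by auto
  then show ?thesis using GL3_inv_cancel(1)[OF K_GL3[OF Iw_K[OF assms(2)]], of g] by simp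
qed

lemma sg_Iw_inv1: "g \<in> Iw \<Longrightarrow> w \<in> inv1 \<Longrightarrow> \<sigma> g w \<in> inv1"
proof -
  assume a: "g \<in> Iw" "w \<in> inv1"
  have "\<sigma> h (\<sigma> g w) = \<sigma> g w" if h: "h \<in> Iwr 1" for h
  proof -
    let ?u = "matrix_inv g ** h ** g"
    have gG: "g \<in> GL3" using a K_GL3 Iw_K by blast
    have u: "?u \<in> Iwr 1" using Iwr_conj[OF h Iw_inv[OF a(1)]] GL3_inv[OF gG] by simp
    have "h ** g = g ** ?u"
      using GL3_inv_cancel(1)[OF gG, of "h ** g"] by (simp add: matrix_mul_assoc)
    then show ?thesis
      using sg_mult[of h g w] sg_mult[of g ?u w] inv1_D[OF a(2) u] a u h Iwr_K Iw_K by auto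
  qed
  then show ?thesis by (simp add: inv1_def)
qed

end

section \<open>Hecke operators on the pro-p-Iwahori invariants\<close>

text \<open>For the two simple reflections (\<open>s\<close> is true for the transposition of the first two
  coordinates), \<open>srefl s a\<close> is the product of a root element with parameter \<open>a\<close> and the permutation
  matrix. It is a symmetric matrix, so that transposition exchanges left and right cosets.\<close>

definition srefl :: "bool \<Rightarrow> 'a \<Rightarrow> 'a::field ^ 3 ^ 3" where
  "srefl s a = (if s then mat3 a 1 0 1 0 0 0 0 1 else mat3 1 0 0 0 a 1 0 1 0)"

definition srefl_inv :: "bool \<Rightarrow> 'a \<Rightarrow> 'a::field ^ 3 ^ 3" where
  "srefl_inv s a = (if s then mat3 0 1 0 1 (- a) 0 0 0 1 else mat3 1 0 0 0 0 1 0 1 (- a))"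

definition root_elt :: "bool \<Rightarrow> 'a \<Rightarrow> 'a::field ^ 3 ^ 3" where
  "root_elt s a = (if s then mat3 1 a 0 0 1 0 0 0 1 else mat3 1 0 0 0 1 a 0 0 1)"

text \<open>The triangular factor both in the rank-one Bruhat relation \<open>srefl_srefl\<close>
  and in the opposite factorisation \<open>root_elt_transpose\<close>.\<close>

definition upper_elt :: "bool \<Rightarrow> 'a \<Rightarrow> 'a::field ^ 3 ^ 3" where
  "upper_elt s b = (if s then mat3 b 1 0 0 (- inverse b) 0 0 0 1 else mat3 1 0 0 0 b 1 0 0 (- inverse b))"

lemma srefl_srefl_inv: "srefl s a ** srefl_inv s a = mat 1" "srefl_inv s a ** srefl s a = mat 1"
  by (cases s; simp add: srefl_def srefl_inv_def mat3_eq_iff mat_mult3 mat_nth)+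

lemma transpose_srefl: "transpose (srefl s a) = srefl s a"
  by (cases s) (simp_all add: srefl_def mat3_eq_iff transpose_def)

lemma srefl_srefl_0: "srefl s a ** srefl s 0 = root_elt s a"
  by (cases s) (simp_all add: srefl_def root_elt_def mat3_eq_iff mat_mult3)

text \<open>The quadratic relation of the Hecke algebra before summation: for nonzero b the product
  stays in the big cell of the rank-one subgroup.\<close>

lemma srefl_srefl:
  assumes "b \<noteq> 0"
  shows "srefl s a ** srefl s b = srefl s (a + inverse b) ** upper_elt s b"
  using assms by (cases s) (simp_all add: srefl_def upper_elt_def mat3_eq_iff mat_mult3 algebra_simps)

text \<open>The two sides differ by the shear b \<mapsto> b + a c and by the order of the
  parameters, and both differences disappear once all parameters are summed over the residue
  field.\<close>

lemma srefl_braid: "srefl True a ** (srefl False b ** srefl True c) = srefl False c ** (srefl True (b + a * c) ** srefl False a)"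
  by (simp add: srefl_def mat3_eq_iff mat_mult3 algebra_simps)

section \<open>Cosets of the simple reflections and sums over the residue field\<close>

context nonarch_local_field
begin

lemma srefl_K [simp]: "a \<in> D 0 \<Longrightarrow> srefl s a \<in> K"
  by (rule K_I[OF _ _ srefl_srefl_inv(1)]) (auto simp: srefl_def srefl_inv_def L_iff3)

lemma srefl_inv_K: "a \<in> D 0 \<Longrightarrow> srefl_inv s a \<in> K"
  by (rule K_I[OF _ _ srefl_srefl_inv(2)]) (auto simp: srefl_def srefl_inv_def L_iff3)

lemma root_elt_K: "a \<in> D 0 \<Longrightarrow> root_elt s a \<in> K"
  unfolding srefl_srefl_0[symmetric] by (intro K_mult) auto

lemma root_elt_Iwr: "a \<in> D 0 \<Longrightarrow> root_elt s a \<in> Iwr 1"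
  using root_elt_K[of a s] by (auto simp: Iwr_def J1_iff J0_iff L_iff3 mat_nth root_elt_def)

lemma srefl_congruent: "a - b \<in> D 1 \<Longrightarrow> srefl s a - srefl s b \<in> L 1"
  by (auto simp: srefl_def L_iff3)

lemma upper_Iw: "b \<in> D 0 \<Longrightarrow> b \<notin> D 1 \<Longrightarrow> upper_elt s b \<in> Iw"
proof -
  assume b: "b \<in> D 0" "b \<notin> D 1"
  note u = unit_inverse[OF b]
  let ?g = "upper_elt s b"
  let ?h = "if s then mat3 (inverse b) 1 0 0 (- b) 0 0 0 1 else mat3 1 0 0 0 (inverse b) 1 0 0 (- b)"
  have "?g ** ?h = mat 1" using u by (simp add: upper_elt_def mat3_eq_iff mat_mult3 mat_nth)
  moreover have "?g \<in> L 0" "?h \<in> L 0" using u b by (auto simp: upper_elt_def L_iff3)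
  ultimately have "?g \<in> K" by (intro K_I)
  then show ?thesis using u b by (auto simp: upper_elt_def Iw_iff J0_iff L_iff3)
qed

text \<open>The affine permutation by which the Iwahori subgroup acts on the q cosets represented by
  the matrices \<open>srefl s a\<close>; \<open>coset_elt\<close> is the factor it leaves on the
  right.\<close>

definition coset_arg :: "bool \<Rightarrow> 'f ^ 3 ^ 3 \<Rightarrow> 'f \<Rightarrow> 'f" where
  "coset_arg s g a = (if s then (a * g $ 1 $ 1 + g $ 1 $ 2) / g $ 2 $ 2
     else (a * g $ 2 $ 2 + g $ 2 $ 3) / g $ 3 $ 3)"

definition coset_elt :: "bool \<Rightarrow> 'f ^ 3 ^ 3 \<Rightarrow> 'f \<Rightarrow> 'f ^ 3 ^ 3" where
  "coset_elt s g a = srefl_inv s (coset_arg s g a) ** g ** srefl s a"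

lemma Iw_unit: "g \<in> Iw \<Longrightarrow> inverse (g $ i $ i) \<in> D 0 \<and> inverse (g $ i $ i) \<notin> D 1 \<and> g $ i $ i \<noteq> 0"
  by (rule unit_inverse) (auto simp: Iw_diag_unit K_D0 Iw_K)

lemma coset_arg_D0: "g \<in> Iw \<Longrightarrow> a \<in> D 0 \<Longrightarrow> coset_arg s g a \<in> D 0"
  unfolding coset_arg_def divide_inverse
  using Iw_unit[of g 2] Iw_unit[of g 3] K_D0[OF Iw_K, of g]
  by (auto intro!: D_mult0 D_add)

lemma coset_arg_diff: "g \<in> Iw \<Longrightarrow> coset_arg s g a - coset_arg s g b \<in> D 1 \<longleftrightarrow> a - b \<in> D 1"
proof -
  assume g: "g \<in> Iw"
  define u where "u = (if s then g $ 1 $ 1 / g $ 2 $ 2 else g $ 2 $ 2 / g $ 3 $ 3)"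
  have "u \<in> D 0 \<and> u \<notin> D 1"
    unfolding u_def divide_inverse using Iw_unit[OF g] Iw_diag_unit[OF g] K_D0[OF Iw_K[OF g]]
      unit_mult[of "g $ 1 $ 1" "inverse (g $ 2 $ 2)"] unit_mult[of "g $ 2 $ 2" "inverse (g $ 3 $ 3)"] by auto
  moreover have "coset_arg s g a - coset_arg s g b = u * (a - b)"
    by (simp add: coset_arg_def u_def field_simps diff_divide_distrib add_divide_distrib)
  ultimately show ?thesis using D_cancel_unit[of u "a - b" 1] D_mult0(2)[of u "a - b" 1] by auto
qed

lemma coset_arg_surj: "g \<in> Iw \<Longrightarrow> b \<in> D 0 \<Longrightarrow> \<exists>a\<in>D 0. coset_arg s g a = b"
proof -
  assume g: "g \<in> Iw" "b \<in> D 0"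
  note u = Iw_unit[OF g(1)] and d = K_D0[OF Iw_K[OF g(1)]]
  let ?a = "if s then (b * g $ 2 $ 2 - g $ 1 $ 2) * inverse (g $ 1 $ 1) else (b * g $ 3 $ 3 - g $ 2 $ 3) * inverse (g $ 2 $ 2)"
  have "?a \<in> D 0" using u d g(2) by (auto intro!: D_mult0 D_diff)
  moreover have "coset_arg s g ?a = b" using u[of 1] u[of 2] u[of 3] by (auto simp: coset_arg_def field_simps)
  ultimately show ?thesis by blast
qed

lemma coset_elt: "g \<in> Iw \<Longrightarrow> a \<in> D 0 \<Longrightarrow> g ** srefl s a = srefl s (coset_arg s g a) ** coset_elt s g a"
  by (simp add: coset_elt_def matrix_mul_assoc srefl_srefl_inv)

text \<open>Modulo the maximal ideal the factor on the right has the diagonal of \<open>g\<close>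
  with two entries exchanged. So it stays pro-p when \<open>g\<close> is pro-p, and on invariants
  its action does not depend on \<open>a\<close>.\<close>

lemma coset_elt_entries:
  assumes "g \<in> Iw" "a \<in> D 0"
  shows "coset_elt s g a \<in> Iw"
    and "(if s then coset_elt s g a $ 1 $ 1 - g $ 2 $ 2 else coset_elt s g a $ 1 $ 1 - g $ 1 $ 1) \<in> D 1"
    and "(if s then coset_elt s g a $ 2 $ 2 - g $ 1 $ 1 else coset_elt s g a $ 2 $ 2 - g $ 3 $ 3) \<in> D 1"
    and "(if s then coset_elt s g a $ 3 $ 3 - g $ 3 $ 3 else coset_elt s g a $ 3 $ 3 - g $ 2 $ 2) \<in> D 1"
proof -
  define b where "b = coset_arg s g a"
  have b: "b \<in> D 0" using coset_arg_D0[OF assms] by (simp add: b_def)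
  have d: "g $ i $ j \<in> D 0" for i j using K_D0 Iw_K assms by blast
  have low: "g $ 2 $ 1 \<in> D 1" "g $ 3 $ 1 \<in> D 1" "g $ 3 $ 2 \<in> D 1"
    using assms by (auto simp: Iw_iff J0_iff)
  have b1: "s \<Longrightarrow> b * g $ 2 $ 2 = a * g $ 1 $ 1 + g $ 1 $ 2"
    and b2: "\<not> s \<Longrightarrow> b * g $ 3 $ 3 = a * g $ 2 $ 2 + g $ 2 $ 3"
    using Iw_unit[OF assms(1)] by (auto simp: b_def coset_arg_def)
  \<comment> \<open>The equation satisfied by b cancels what could be a unit in the critical
    position below the diagonal, (2, 1) or (3, 2); only a multiple of an entry of \<open>g\<close>
    in the maximal ideal is left.\<close>
  have e: "coset_elt s g a = (if s then
      mat3 (a * g $ 2 $ 1 + g $ 2 $ 2) (g $ 2 $ 1) (g $ 2 $ 3)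
        (- (b * a * g $ 2 $ 1)) (g $ 1 $ 1 - b * g $ 2 $ 1) (g $ 1 $ 3 - b * g $ 2 $ 3)
        (a * g $ 3 $ 1 + g $ 3 $ 2) (g $ 3 $ 1) (g $ 3 $ 3)
    else mat3 (g $ 1 $ 1) (a * g $ 1 $ 2 + g $ 1 $ 3) (g $ 1 $ 2)
        (g $ 3 $ 1) (a * g $ 3 $ 2 + g $ 3 $ 3) (g $ 3 $ 2)
        (g $ 2 $ 1 - b * g $ 3 $ 1) (- (b * a * g $ 3 $ 2)) (g $ 2 $ 2 - b * g $ 3 $ 2))"
  proof (cases s)
    case True
    show ?thesis using b1[OF True] unfolding coset_elt_def b_def[symmetric]
      by (simp add: True srefl_def srefl_inv_def mat3_eq_iff mat_mult3 algebra_simps)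
  next
    case False
    show ?thesis using b2[OF False] unfolding coset_elt_def b_def[symmetric]
      by (simp add: False srefl_def srefl_inv_def mat3_eq_iff mat_mult3 algebra_simps)
  qed
  have "coset_elt s g a \<in> K"
    unfolding coset_elt_def
    using K_mult[OF K_mult[OF srefl_inv_K[OF b] Iw_K[OF assms(1)]] srefl_K[OF assms(2)]] unfolding b_def .
  then show "coset_elt s g a \<in> Iw"
    using K_L0[of "coset_elt s g a"] b d low assms(2) unfolding Iw_iff J0_iff e
    by (auto intro!: D_add D_diff D1_multI D_mult0)
  show "(if s then coset_elt s g a $ 1 $ 1 - g $ 2 $ 2 else coset_elt s g a $ 1 $ 1 - g $ 1 $ 1) \<in> D 1"
    "(if s then coset_elt s g a $ 2 $ 2 - g $ 1 $ 1 else coset_elt s g a $ 2 $ 2 - g $ 3 $ 3) \<in> D 1"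
    "(if s then coset_elt s g a $ 3 $ 3 - g $ 3 $ 3 else coset_elt s g a $ 3 $ 3 - g $ 2 $ 2) \<in> D 1"
    unfolding e using b d low assms(2) by (auto intro!: D1_multI)
qed

lemma coset_elt_Iwr:
  assumes "g \<in> Iwr 1" "a \<in> D 0"
  shows "coset_elt s g a \<in> Iwr 1"
proof -
  have g: "g \<in> Iw" using assms Iwr_Iw by auto
  have d: "g $ i $ i - 1 \<in> D 1" for i
  proof -
    have "(g - mat 1) $ i $ i \<in> D 1"
      using assms(1) exhaust_3[of i] unfolding Iwr_def J1_iff by auto
    then show ?thesis by (simp add: mat_nth)
  qed
  note c = coset_elt_entries[OF g assms(2), of s]
  have "coset_elt s g a - mat 1 \<in> J 0" using c(1) J_one by (auto simp: Iw_iff intro!: J_diff)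
  moreover have "coset_elt s g a $ 1 $ 1 - 1 \<in> D 1" "coset_elt s g a $ 2 $ 2 - 1 \<in> D 1" "coset_elt s g a $ 3 $ 3 - 1 \<in> D 1"
    using c(2-4) d by (cases s; auto intro: D_diff_trans)+
  ultimately show ?thesis using c(1) by (simp add: Iwr_def Iw_iff J1_iff mat_nth)
qed

lemma coset_elt_congruent:
  assumes "g \<in> Iw" "a \<in> D 0" "b \<in> D 0"
  shows "coset_elt s g a - coset_elt s g b \<in> J 1"
proof -
  note c = coset_elt_entries[OF assms(1,2), of s] coset_elt_entries[OF assms(1,3), of s]
  have "coset_elt s g a - coset_elt s g b \<in> J 0" using c by (auto simp: Iw_iff intro!: J_diff)
  moreover have "coset_elt s g a $ i $ i - coset_elt s g b $ i $ i \<in> D 1" for i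
    using c(2-4,6-8) exhaust_3[of i] by (cases s) (auto intro: D_diff_trans D_diff_commute[THEN iffD1])
  ultimately show ?thesis by (simp add: J1_iff)
qed

definition residue_reps :: "'f set" where
  "residue_reps = (\<lambda>c. SOME a. a \<in> D 0 \<and> residue_class a = c) ` residue_class ` D 0"

lemma residue_reps: "finite residue_reps" "residue_reps \<subseteq> D 0"
  using finite_residue_classes class_rep(1)[of _ residue_class "D 0"]
  by (auto simp: residue_reps_def)

lemma class_sum_residue:
  "class_function residue_class (D 0) F \<Longrightarrow> class_sum residue_class (D 0) F = sum F residue_reps"
  unfolding residue_reps_def by (rule class_sum_reps[OF _ finite_residue_classes])

lemma card_residue_reps: "card residue_reps = card (residue_class ` D 0)"
  unfolding residue_reps_def by (rule card_image[OF class_rep_inj])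

text \<open>Permutations of the residue field may be applied to unrounded elements, since the
  summand depends on classes only.\<close>

lemma sum_residue_reindex:
  assumes F: "\<And>a b. a \<in> D 0 \<Longrightarrow> b \<in> D 0 \<Longrightarrow> a - b \<in> D 1 \<Longrightarrow> F a = F b"
    and \<theta>: "\<And>a. a \<in> D 0 \<Longrightarrow> \<theta> a \<in> D 0"
      "\<And>a b. a \<in> D 0 \<Longrightarrow> b \<in> D 0 \<Longrightarrow> \<theta> a - \<theta> b \<in> D 1 \<longleftrightarrow> a - b \<in> D 1"
      "\<And>b. b \<in> D 0 \<Longrightarrow> \<exists>a\<in>D 0. \<theta> a = b"
  shows "(\<Sum>a\<in>residue_reps. F (\<theta> a)) = sum F residue_reps"
proof -
  have c: "class_function residue_class (D 0) F" "class_function residue_class (D 0) (\<lambda>a. F (\<theta> a))"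
    unfolding class_function_def residue_class_eq_iff
    by (intro ballI impI F; simp add: \<theta>)+
  have "class_sum residue_class (D 0) (\<lambda>a. F (\<theta> a)) = class_sum residue_class (D 0) F"
  proof (rule class_sum_reindex[OF c(1)])
    fix y assume "y \<in> D 0"
    then obtain a where "a \<in> D 0" "\<theta> a = y" using \<theta>(3) by blast
    then show "\<exists>x\<in>D 0. residue_class (\<theta> x) = residue_class y" by (intro bexI[of _ a]) auto
  qed (simp_all add: residue_class_eq_iff \<theta>)
  then show ?thesis using c by (simp add: class_sum_residue)
qed

lemma sum_residue_shift:
  assumes "\<And>a b. a \<in> D 0 \<Longrightarrow> b \<in> D 0 \<Longrightarrow> a - b \<in> D 1 \<Longrightarrow> F a = F b" "c \<in> D 0"
  shows "(\<Sum>a\<in>residue_reps. F (a + c)) = sum F residue_reps"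
proof (rule sum_residue_reindex[of F "\<lambda>a. a + c"])
  fix b assume "b \<in> D 0"
  then show "\<exists>a\<in>D 0. a + c = b" using assms(2) by (intro bexI[of _ "b - c"]) (auto intro: D_diff)
next
  show "a + c \<in> D 0" if "a \<in> D 0" for a using that assms(2) by (rule D_add)
qed (rule assms(1), simp_all)

lemma residue_rep_exists: "a \<in> D 0 \<Longrightarrow> \<exists>r\<in>residue_reps. a - r \<in> D 1"
  unfolding residue_reps_def using class_rep(2)[of "residue_class a" residue_class "D 0"]
  by (auto simp: residue_class_eq_iff[symmetric])

lemma residue_rep_unique: "a \<in> residue_reps \<Longrightarrow> b \<in> residue_reps \<Longrightarrow> a - b \<in> D 1 \<Longrightarrow> a = b"
proof -
  assume a: "a \<in> residue_reps" "b \<in> residue_reps" "a - b \<in> D 1"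
  obtain c d where "c \<in> residue_class ` D 0" "a = (SOME a. a \<in> D 0 \<and> residue_class a = c)"
      "d \<in> residue_class ` D 0" "b = (SOME a. a \<in> D 0 \<and> residue_class a = d)"
    using a unfolding residue_reps_def by blast
  then show "a = b" using class_rep(2)[of c residue_class "D 0"] class_rep(2)[of d residue_class "D 0"]
    a(3) unfolding residue_class_eq_iff[symmetric] by simp
qed

end

section \<open>Quadratic and braid relations; simultaneous eigenvectors\<close>

context weight
begin

text \<open>The double coset of a simple reflection under the pro-p-Iwahori subgroup is the union of
  q left cosets, represented by the matrices \<open>srefl s a\<close>; this is the corresponding
  Hecke operator on invariants.\<close>

definition hop :: "bool \<Rightarrow> 'v \<Rightarrow> 'v" where
  "hop s w = (\<Sum>a\<in>residue_reps. \<sigma> (srefl s a) w)"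

lemma reps_D0: "a \<in> residue_reps \<Longrightarrow> a \<in> D 0"
  using residue_reps(2) by blast

lemma sg_srefl_congruent: "a \<in> D 0 \<Longrightarrow> b \<in> D 0 \<Longrightarrow> a - b \<in> D 1 \<Longrightarrow> \<sigma> (srefl s a) w = \<sigma> (srefl s b) w"
  by (intro sg_congruent srefl_congruent) auto

lemma hop_add: "hop s (w + w') = hop s w + hop s w'"
  by (simp add: hop_def sg_add reps_D0 sum.distrib)

lemma hop_scale: "hop s (smul c w) = smul c (hop s w)"
  by (simp add: hop_def sg_scale reps_D0 V.scale_sum_right)

lemma hop_conj:
  assumes g: "g \<in> Iw" and w: "\<And>a. a \<in> D 0 \<Longrightarrow> \<sigma> (coset_elt s g a) w = w'"
  shows "\<sigma> g (hop s w) = hop s w'"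
proof -
  have "\<sigma> g (\<sigma> (srefl s a) w) = \<sigma> (srefl s (coset_arg s g a)) w'" if "a \<in> D 0" for a
    using sg_mult[of g "srefl s a" w] sg_mult[of "srefl s (coset_arg s g a)" "coset_elt s g a" w]
      coset_elt[OF g that, of s] coset_elt_entries(1)[OF g that] coset_arg_D0[OF g that, of s] g that w
    by (auto simp: Iw_K)
  then have "\<sigma> g (hop s w) = (\<Sum>a\<in>residue_reps. \<sigma> (srefl s (coset_arg s g a)) w')"
    unfolding hop_def sg_sum[OF Iw_K[OF g]] using reps_D0 by (intro sum.cong) auto
  also have "\<dots> = hop s w'"
    unfolding hop_def using coset_arg_D0[OF g] coset_arg_diff[OF g] coset_arg_surj[OF g]
    by (intro sum_residue_reindex[of "\<lambda>a. \<sigma> (srefl s a) w'" "coset_arg s g"] sg_srefl_congruent) auto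
  finally show ?thesis .
qed

lemma hop_inv1: "w \<in> inv1 \<Longrightarrow> hop s w \<in> inv1"
  unfolding inv1_def using hop_conj[of _ s w w] coset_elt_Iwr Iwr_Iw by auto

lemma hop_Iw: "w \<in> inv1 \<Longrightarrow> g \<in> Iw \<Longrightarrow> \<sigma> g (hop s w) = hop s (\<sigma> (coset_elt s g 0) w)"
  by (intro hop_conj sg_inv1_congruent coset_elt_congruent coset_elt_entries) auto

definition eig :: "'v \<Rightarrow> bool" where
  "eig w \<longleftrightarrow> w \<in> inv1 \<and> (\<forall>g\<in>Iw. \<exists>c. \<sigma> g w = smul c w)"

lemma eig_hop: "eig w \<Longrightarrow> eig (hop s w)"
  unfolding eig_def using hop_inv1 hop_Iw coset_elt_entries(1)[of _ 0 s] by (metis D_zero hop_scale)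

text \<open>For unit b the shift a \<mapsto> a + 1/b reproduces \<open>hop s w\<close> up to the
  scalar by which the triangular factor acts. The class of b = 0 contributes q copies of
  \<open>w\<close>, and q = 0 in the coefficients. So no multiple of \<open>w\<close> itself
  remains, and every nonzero \<open>hop s w\<close> is an eigenvector.\<close>

lemma hop_square: "eig w \<Longrightarrow> \<exists>c. hop s (hop s w) = smul c (hop s w)"
proof -
  assume w: "eig w"
  define G where "G b = (\<Sum>a\<in>residue_reps. \<sigma> (srefl s a ** srefl s b) w)" for b
  have "hop s (hop s w) = (\<Sum>a\<in>residue_reps. \<Sum>b\<in>residue_reps. \<sigma> (srefl s a ** srefl s b) w)"
    unfolding hop_def using reps_D0 by (intro sum.cong) (auto simp: sg_sum sg_mult)
  also have "\<dots> = (\<Sum>b\<in>residue_reps. G b)"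
    unfolding G_def by (rule sum.swap)
  finally have eq: "hop s (hop s w) = sum G residue_reps" .
  have "\<exists>c. G b = smul c (hop s w)" if b: "b \<in> residue_reps" for b
  proof (cases "b \<in> D 1")
    case True
    have "\<sigma> (srefl s a ** srefl s b) w = w" if "a \<in> residue_reps" for a
    proof -
      have "\<sigma> (srefl s a ** srefl s b) w = \<sigma> (srefl s a) (\<sigma> (srefl s 0) w)"
        using sg_mult[of "srefl s a" "srefl s b" w] sg_srefl_congruent[of b 0 s w] b that True reps_D0 by simp
      also have "\<dots> = \<sigma> (root_elt s a) w"
        using sg_mult[of "srefl s a" "srefl s 0" w] that reps_D0 by (simp add: srefl_srefl_0)
      also have "\<dots> = w" using w that by (intro inv1_D root_elt_Iwr reps_D0) (auto simp: eig_def)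
      finally show ?thesis .
    qed
    then have "G b = (\<Sum>a\<in>residue_reps. w)" by (simp add: G_def)
    also have "\<dots> = (\<Sum>a\<in>residue_reps. smul 1 w)" by simp
    also have "\<dots> = smul (of_nat (card residue_reps)) w"
      unfolding V.scale_sum_left[symmetric] by simp
    also have "\<dots> = smul 0 (hop s w)" by (simp add: card_residue_reps card_residue_zero)
    finally show ?thesis by blast
  next
    case False
    then have b0: "b \<in> D 0" "b \<noteq> 0" "inverse b \<in> D 0" using b reps_D0 unit_inverse[of b] by auto
    let ?h = "upper_elt s b"
    have h: "?h \<in> Iw" using upper_Iw[OF b0(1) False] .
    then obtain c where c: "\<sigma> ?h w = smul c w" using w by (auto simp: eig_def)
    have "\<sigma> (srefl s a ** srefl s b) w = smul c (\<sigma> (srefl s (a + inverse b)) w)" if "a \<in> residue_reps" for a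
      using sg_mult[of "srefl s (a + inverse b)" ?h w] srefl_srefl[OF b0(2), of s a] Iw_K[OF h] c b0 that reps_D0
      by (auto simp: D_add sg_scale)
    then have "G b = smul c (\<Sum>a\<in>residue_reps. \<sigma> (srefl s (a + inverse b)) w)"
      unfolding G_def V.scale_sum_right by (intro sum.cong) auto
    also have "(\<Sum>a\<in>residue_reps. \<sigma> (srefl s (a + inverse b)) w) = hop s w"
      unfolding hop_def using b0 by (intro sum_residue_shift[of "\<lambda>a. \<sigma> (srefl s a) w"] sg_srefl_congruent) auto
    finally show ?thesis by blast
  qed
  then obtain c where "\<And>b. b \<in> residue_reps \<Longrightarrow> G b = smul (c b) (hop s w)" by metis
  then have "hop s (hop s w) = smul (sum c residue_reps) (hop s w)"
    unfolding eq V.scale_sum_left by (intro sum.cong) auto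
  then show ?thesis by blast
qed

lemma hop_braid: "hop True (hop False (hop True w)) = hop False (hop True (hop False w))"
proof -
  let ?R = residue_reps
  let ?F = "\<lambda>a b c. \<sigma> (srefl False c ** (srefl True b ** srefl False a)) w"
  have F: "?F a b c = ?F a b' c" if "a \<in> D 0" "c \<in> D 0" "b \<in> D 0" "b' \<in> D 0" "b - b' \<in> D 1" for a b b' c
    using that sg_srefl_congruent[of b b' True] by (simp add: sg_mult K_mult)
  have "hop True (hop False (hop True w)) = (\<Sum>a\<in>?R. \<Sum>b\<in>?R. \<Sum>c\<in>?R. ?F a (b + a * c) c)"
    unfolding hop_def using reps_D0
    by (intro sum.cong refl) (simp add: sg_sum sg_mult K_mult srefl_braid[symmetric])
  also have "\<dots> = (\<Sum>a\<in>?R. \<Sum>c\<in>?R. \<Sum>b\<in>?R. ?F a (b + a * c) c)"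
    by (rule sum.cong[OF refl], rule sum.swap)
  also have "\<dots> = (\<Sum>a\<in>?R. \<Sum>c\<in>?R. \<Sum>b\<in>?R. ?F a b c)"
  proof (rule sum.cong[OF refl], rule sum.cong[OF refl])
    fix a c assume ac: "a \<in> ?R" "c \<in> ?R"
    show "(\<Sum>b\<in>?R. ?F a (b + a * c) c) = (\<Sum>b\<in>?R. ?F a b c)"
      by (rule sum_residue_shift[of "\<lambda>b. ?F a b c" "a * c"])
        (assumption | rule F D_mult0(1) reps_D0[OF ac(1)] reps_D0[OF ac(2)])+
  qed
  also have "\<dots> = (\<Sum>c\<in>?R. \<Sum>b\<in>?R. \<Sum>a\<in>?R. ?F a b c)"
    by (subst sum.swap, rule sum.cong[OF refl], rule sum.swap)
  also have "\<dots> = hop False (hop True (hop False w))"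
    unfolding hop_def using reps_D0 by (intro sum.cong refl) (simp add: sg_sum sg_mult K_mult)
  finally show ?thesis .
qed

definition heig :: "'v \<Rightarrow> bool" where
  "heig m \<longleftrightarrow> m \<noteq> 0 \<and> eig m \<and> (\<forall>s. \<exists>\<mu>. hop s m = smul \<mu> m)"

lemma heigI: "m \<noteq> 0 \<Longrightarrow> eig m \<Longrightarrow> \<exists>c. hop True m = smul c m \<Longrightarrow> \<exists>d. hop False m = smul d m \<Longrightarrow> heig m"
  unfolding heig_def by (metis (full_types))

text \<open>On invariants the Iwahori subgroup acts by commuting operators of finite order, and
  finitely many of them account for the whole action.\<close>

lemma exists_eig:
  assumes A: "V.subspace A" "A \<subseteq> inv1" "A \<noteq> {0}" and Iw: "\<And>g w. g \<in> Iw \<Longrightarrow> w \<in> A \<Longrightarrow> \<sigma> g w \<in> A"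
  shows "\<exists>w\<in>A. w \<noteq> 0 \<and> eig w"
proof -
  have "Iw \<subseteq> L 0" using K_L0 Iw_K by blast
  then obtain S where S: "finite S" "S \<subseteq> Iw" "\<And>g. g \<in> Iw \<Longrightarrow> \<exists>s\<in>S. g - s \<in> L 1"
    using finite_L_quotient[of Iw 0 1] by blast
  have "\<exists>w\<in>A. w \<noteq> 0 \<and> (\<forall>s\<in>S. \<exists>c. \<sigma> s w = smul c w)"
  proof (rule common_eigenvector[OF V.vector_space_axioms S(1) A(1,3)])
    fix s assume "s \<in> S"
    then have s: "s \<in> Iw" "s \<in> K" using S(2) Iw_K by blast+
    show "Vector_Spaces.linear smul smul (\<sigma> s)" using s sg_linear by blast
    show "\<sigma> s w \<in> A" if "w \<in> A" for w using Iw that s by blast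
    show "\<sigma> s (\<sigma> t w) = \<sigma> t (\<sigma> s w)" if "t \<in> S" "w \<in> A" for t w
    proof -
      have t: "t \<in> Iw" "t \<in> K" using that S(2) Iw_K by blast+
      obtain u where u: "u \<in> Iwr 1" "s ** t = t ** s ** u"
        using Iw_commute[OF s(1) t(1) Iw_commutator_diff[OF s(1) t(1)]] by blast
      have "\<sigma> (t ** s ** u) w = \<sigma> (t ** s) w"
        using sg_mult[of "t ** s" u w] inv1_D[of w u] u(1) that A(2) s t by (auto simp: K_mult Iwr_K)
      then show ?thesis using sg_mult[of s t w] sg_mult[of t s w] s t u(2) by simp
    qed
    have pow: "(\<sigma> s ^^ n) w = \<sigma> (mat_pow s n) w" for n w
      by (induction n) (auto simp: sg_mult mat_pow_K s)
    \<comment> \<open>Pigeonhole: two powers of s agree modulo \<open>L 1\<close>, hence act alike,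
      and the smaller one cancels by invertibility.\<close>
    have "range (mat_pow s) \<subseteq> L 0" using mat_pow_K[OF s(2)] K_L0 by blast
    from finite_L_quotient[OF this, of 1]
    obtain P where P: "finite P" "\<forall>A\<in>range (mat_pow s). \<exists>B\<in>P. A - B \<in> L 1" by meson
    then have "\<forall>n. \<exists>B. B \<in> P \<and> mat_pow s n - B \<in> L 1" by auto
    then obtain f where f: "\<And>n. f n \<in> P" "\<And>n. mat_pow s n - f n \<in> L 1" by metis
    have "finite (range f)" using f(1) P(1) by (auto intro: finite_subset)
    then have "\<not> inj f" using range_inj_infinite by blast
    then obtain i j where ij: "i < j" "f i = f j" unfolding inj_on_def by (metis linorder_neqE_nat)
    have "mat_pow s i - mat_pow s j \<in> L 1"
      using f(2)[of i] f(2)[of j] ij(2) L_diff_trans L_diff_commute by metis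
    then have "\<sigma> (mat_pow s i) w = \<sigma> (mat_pow s j) w" for w
      using mat_pow_K[OF s(2)] by (intro sg_congruent) auto
    then have eq: "\<sigma> (mat_pow s i) w = \<sigma> (mat_pow s i) (\<sigma> (mat_pow s (j - i)) w)" for w
      using mat_pow_add[of s i "j - i"] ij(1) sg_mult[of "mat_pow s i" "mat_pow s (j - i)" w] mat_pow_K[OF s(2)]
      by simp
    have "\<sigma> (mat_pow s (j - i)) w = w" for w
      using sg_inv_cancel(1)[OF mat_pow_K[OF s(2), of i]] eq[of w] by metis
    then show "\<exists>N>0. \<forall>w\<in>A. (\<sigma> s ^^ N) w = w"
      using ij(1) pow by (intro exI[of _ "j - i"]) auto
  qed
  then obtain w where w: "w \<in> A" "w \<noteq> 0" "\<And>s. s \<in> S \<Longrightarrow> \<exists>c. \<sigma> s w = smul c w" by blast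
  have "\<exists>c. \<sigma> g w = smul c w" if "g \<in> Iw" for g
    using S(3)[OF that] w(3) sg_congruent[of g _ w] that S(2) Iw_K by (metis subsetD)
  then show ?thesis using w A(2) by (auto simp: eig_def)
qed

text \<open>A nonzero vector \<open>T\<^sub>w m\<close> with \<open>w\<close> of maximal length is an eigenvector of both operators.\<close>

lemma exists_heig:
  assumes A: "V.subspace A" "A \<subseteq> inv1" "A \<noteq> {0}" and Iw: "\<And>g w. g \<in> Iw \<Longrightarrow> w \<in> A \<Longrightarrow> \<sigma> g w \<in> A"
    and hop: "\<And>s w. w \<in> A \<Longrightarrow> hop s w \<in> A"
  shows "\<exists>m\<in>A. heig m"
proof -
  obtain w where w: "w \<in> A" "w \<noteq> 0" "eig w" using exists_eig[OF A Iw] by blast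
  let ?S = "hop True" and ?T = "hop False"
  have zero: "\<exists>c. hop s u = smul c u" if "hop s u = 0" for s u using that by (intro exI[of _ 0]) simp
  have sq: "\<exists>c. hop s (hop s u) = smul c (hop s u)" if "eig u" for s u using hop_square that by blast
  note e = eig_hop
  have "heig w \<or> heig (?S w) \<or> heig (?T w) \<or> heig (?T (?S w)) \<or> heig (?S (?T w)) \<or> heig (?S (?T (?S w)))"
  proof (cases "?S (?T (?S w)) = 0")
    case False
    \<comment> \<open>By the braid relation the longest product also begins with the other operator,
      so the quadratic relation applies to both.\<close>
    have "\<exists>c. ?T (?S (?T (?S w))) = smul c (?S (?T (?S w)))"
      unfolding hop_braid by (intro sq e w)
    then have "heig (?S (?T (?S w)))" using False by (intro heigI sq e w)
    then show ?thesis by blast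
  next
    case STS: True
    then have TST: "?T (?S (?T w)) = 0" using hop_braid by simp
    consider "?T (?S w) \<noteq> 0" | "?S (?T w) \<noteq> 0" | "?T (?S w) = 0" "?S (?T w) = 0" by blast
    then show ?thesis
    proof cases
      case 1
      then have "heig (?T (?S w))" using STS by (intro heigI sq e w zero)
      then show ?thesis by blast
    next
      case 2
      then have "heig (?S (?T w))" using TST by (intro heigI sq e w zero)
      then show ?thesis by blast
    next
      case 3
      consider "?S w \<noteq> 0" | "?T w \<noteq> 0" | "?S w = 0" "?T w = 0" by blast
      then show ?thesis
      proof cases
        case 1
        then have "heig (?S w)" using 3 by (intro heigI sq e w zero)
        then show ?thesis by blast
      next
        case 2
        then have "heig (?T w)" using 3 by (intro heigI sq e w zero)
        then show ?thesis by blast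
      next
        case 3
        then have "heig w" using w by (intro heigI zero)
        then show ?thesis by blast
      qed
    qed
  qed
  then show ?thesis using w hop by blast
qed

end

section \<open>Generation of the maximal compact subgroup\<close>

context nonarch_local_field
begin

text \<open>Gaussian elimination over the ring of integers: a unit is moved to the corner, its row
  and column are cleared, and the remaining block is treated likewise. The upper unipotent factors
  are conjugates of lower ones by reflections, which is why the hypotheses ask for the opposite
  group.\<close>

lemma K_generated:
  assumes mult: "\<And>g h. g \<in> H \<Longrightarrow> h \<in> H \<Longrightarrow> g ** h \<in> H"
    and lower: "\<And>g. g \<in> Iwr 1 \<Longrightarrow> transpose g \<in> H"
    and diag: "\<And>a b c. mat3 a 0 0 0 b 0 0 0 c \<in> Iw \<Longrightarrow> mat3 a 0 0 0 b 0 0 0 c \<in> H"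
    and srefl: "\<And>s. srefl s 0 \<in> H" and k: "k \<in> K"
  shows "k \<in> H"
proof -
  have low: "mat3 1 0 0 a 1 0 b c 1 \<in> H" if "a \<in> D 0" "b \<in> D 0" "c \<in> D 0" for a b c
  proof -
    let ?g = "mat3 1 a b 0 1 c 0 0 1" and ?h = "mat3 1 (- a) (a * c - b) 0 1 (- c) 0 0 1"
    have "?g \<in> K" using that
      by (intro K_I[of ?g ?h]) (auto simp: mat3_eq_iff mat_mult3 mat_nth L_iff3 intro!: D_diff D_mult0)
    then have "?g \<in> Iwr 1" using that by (auto simp: Iwr_def J1_iff J0_iff L_iff3 mat_nth)
    then have "transpose ?g \<in> H" by (rule lower)
    moreover have "transpose ?g = mat3 1 0 0 a 1 0 b c 1" by (simp add: transpose_def mat3_eq_iff)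
    ultimately show ?thesis by simp
  qed
  have x12: "mat3 1 a 0 0 1 0 0 0 1 \<in> H" if "a \<in> D 0" for a
  proof -
    have "mat3 1 a 0 0 1 0 0 0 1 = srefl True 0 ** (mat3 1 0 0 a 1 0 0 0 1 ** srefl True 0)"
      by (simp add: srefl_def mat3_eq_iff mat_mult3)
    then show ?thesis using that by (simp add: mult srefl low)
  qed
  have x23: "mat3 1 0 0 0 1 a 0 0 1 \<in> H" if "a \<in> D 0" for a
  proof -
    have "mat3 1 0 0 0 1 a 0 0 1 = srefl False 0 ** (mat3 1 0 0 0 1 0 0 a 1 ** srefl False 0)"
      by (simp add: srefl_def mat3_eq_iff mat_mult3)
    then show ?thesis using that by (simp add: mult srefl low)
  qed
  have x1: "mat3 1 a b 0 1 0 0 0 1 \<in> H" if "a \<in> D 0" "b \<in> D 0" for a b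
  proof -
    have "mat3 1 a b 0 1 0 0 0 1
        = mat3 1 a 0 0 1 0 0 0 1 ** (srefl False 0 ** (mat3 1 b 0 0 1 0 0 0 1 ** srefl False 0))"
      by (simp add: srefl_def mat3_eq_iff mat_mult3)
    then show ?thesis using that by (simp add: mult srefl x12)
  qed
  have block1: "mat3 a 0 0 0 b c 0 d e \<in> H" if g: "mat3 a 0 0 0 b c 0 d e \<in> K" "b \<notin> D 1" for a b c d e
  proof -
    let ?g = "mat3 a 0 0 0 b c 0 d e"
    have D0: "b \<in> D 0" "c \<in> D 0" "d \<in> D 0" using K_D0[OF g(1), of 2 2] K_D0[OF g(1), of 2 3] K_D0[OF g(1), of 3 2] by auto
    note u = unit_inverse[OF D0(1) g(2)]
    let ?f = "e - d * c / b"
    let ?l = "mat3 1 0 0 0 1 0 0 (d / b) 1" and ?r = "mat3 1 0 0 0 1 (c / b) 0 0 1"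
      and ?d = "mat3 a 0 0 0 b 0 0 0 ?f"
      and ?l' = "mat3 1 0 0 0 1 0 0 (- d / b) 1" and ?r' = "mat3 1 0 0 0 1 (- c / b) 0 0 1"
    have db: "d / b \<in> D 0" "c / b \<in> D 0" using D0 u by (auto simp: divide_inverse intro!: D_mult0)
    have lr: "?l' \<in> K" "?r' \<in> K"
      using db by (intro K_I[of ?l' ?l] K_I[of ?r' ?r]; simp add: mat3_eq_iff mat_mult3 mat_nth L_iff3)+
    have "?d = ?l' ** ?g ** ?r'" using u by (simp add: mat3_eq_iff mat_mult3)
    then have "?d \<in> K" using lr g(1) by (simp add: K_mult)
    then have "?d \<in> Iw" using K_L0[of ?d] by (simp add: Iw_iff J0_iff)
    then have "?d \<in> H" by (rule diag)
    moreover have "?g = ?l ** (?d ** ?r)" using u by (simp add: mat3_eq_iff mat_mult3)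
    ultimately show ?thesis using db by (simp add: mult low x23)
  qed
  have block: "mat3 a 0 0 0 b c 0 d e \<in> H" if g: "mat3 a 0 0 0 b c 0 d e \<in> K" for a b c d e
  proof (cases "b \<in> D 1")
    case True
    obtain i where "mat3 a 0 0 0 b c 0 d e $ i $ 2 \<notin> D 1" using K_unit_in_column[OF g] by blast
    then have "d \<notin> D 1" using True exhaust_3[of i] by auto
    moreover have "srefl False 0 ** mat3 a 0 0 0 b c 0 d e = mat3 a 0 0 0 d e 0 b c"
      by (simp add: srefl_def mat3_eq_iff mat_mult3)
    moreover from this have "mat3 a 0 0 0 d e 0 b c \<in> K" using K_mult[OF srefl_K g, of 0 False] by simp
    ultimately have "mat3 a 0 0 0 d e 0 b c \<in> H" by (intro block1)
    moreover have "mat3 a 0 0 0 b c 0 d e = srefl False 0 ** mat3 a 0 0 0 d e 0 b c"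
      by (simp add: srefl_def mat3_eq_iff mat_mult3)
    ultimately show ?thesis by (simp add: mult srefl)
  qed (use block1 g in blast)
  have corner: "g \<in> H" if g: "g \<in> K" "g $ 1 $ 1 \<notin> D 1" for g
  proof -
    define u where "u = inverse (g $ 1 $ 1)"
    have u: "u \<in> D 0" "g $ 1 $ 1 * u = 1" "u * g $ 1 $ 1 = 1"
      using unit_inverse[OF K_D0[OF g(1)] g(2)] by (auto simp: u_def)
    define a b c d where "a = g $ 2 $ 1 * u" and "b = g $ 3 $ 1 * u" and "c = u * g $ 1 $ 2" and "d = u * g $ 1 $ 3"
    have abcd: "a \<in> D 0" "b \<in> D 0" "c \<in> D 0" "d \<in> D 0"
      using u K_D0[OF g(1)] by (auto simp: a_def b_def c_def d_def intro!: D_mult0)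
    have e: "g $ 2 $ 1 = a * g $ 1 $ 1" "g $ 3 $ 1 = b * g $ 1 $ 1" "g $ 1 $ 2 = g $ 1 $ 1 * c" "g $ 1 $ 3 = g $ 1 $ 1 * d"
      using u by (simp_all add: a_def b_def c_def d_def mult.assoc mult.assoc[symmetric])
    let ?l = "mat3 1 0 0 a 1 0 b 0 1" and ?l' = "mat3 1 0 0 (- a) 1 0 (- b) 0 1"
      and ?r = "mat3 1 c d 0 1 0 0 0 1" and ?r' = "mat3 1 (- c) (- d) 0 1 0 0 0 1"
      and ?m = "mat3 (g $ 1 $ 1) 0 0 0 (g $ 2 $ 2 - a * g $ 1 $ 1 * c) (g $ 2 $ 3 - a * g $ 1 $ 1 * d)
        0 (g $ 3 $ 2 - b * g $ 1 $ 1 * c) (g $ 3 $ 3 - b * g $ 1 $ 1 * d)"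
    have lr: "?l' \<in> K" "?r' \<in> K"
      using abcd by (intro K_I[of ?l' ?l] K_I[of ?r' ?r]; simp add: mat3_eq_iff mat_mult3 mat_nth L_iff3)+
    have "?m = ?l' ** g ** ?r'" using e by (simp add: mat3_eq_iff mat_mult3 algebra_simps)
    then have "?m \<in> K" using lr g(1) by (simp add: K_mult)
    then have "?m \<in> H" by (rule block)
    moreover have "g = ?l ** (?m ** ?r)" using e by (simp add: mat3_eq_iff mat_mult3 algebra_simps)
    ultimately show ?thesis using mult[OF low[of a b 0] mult[OF \<open>?m \<in> H\<close> x1[of c d]]] abcd by simp
  qed
  obtain i where "k $ i $ 1 \<notin> D 1" using K_unit_in_column[OF k] by blast
  then consider "k $ 1 $ 1 \<notin> D 1" | "k $ 2 $ 1 \<notin> D 1" | "k $ 3 $ 1 \<notin> D 1" using exhaust_3[of i] by auto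
  then show ?thesis
  proof cases
    case 2
    have "srefl True 0 ** k \<in> H"
      using 2 k by (intro corner K_mult srefl_K) (simp_all add: mat_mult3 srefl_def)
    then have "srefl True 0 ** (srefl True 0 ** k) \<in> H" by (rule mult[OF srefl])
    moreover have "srefl True 0 ** (srefl True 0 ** k) = k" by (simp add: mat3_eq_iff mat_mult3 srefl_def)
    ultimately show ?thesis by simp
  next
    case 3
    have "srefl True 0 ** (srefl False 0 ** k) \<in> H"
      using 3 k by (intro corner K_mult srefl_K) (simp_all add: mat_mult3 srefl_def)
    then have "srefl False 0 ** (srefl True 0 ** (srefl True 0 ** (srefl False 0 ** k))) \<in> H"
      by (rule mult[OF srefl mult[OF srefl]])
    moreover have "srefl False 0 ** (srefl True 0 ** (srefl True 0 ** (srefl False 0 ** k))) = k"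
      by (simp add: mat3_eq_iff mat_mult3 srefl_def)
    ultimately show ?thesis by simp
  qed (use corner k in blast)
qed

definition diag_part :: "'f ^ 3 ^ 3 \<Rightarrow> 'f ^ 3 ^ 3" where
  "diag_part g = mat3 (g $ 1 $ 1) 0 0 0 (g $ 2 $ 2) 0 0 0 (g $ 3 $ 3)"

lemma diag_part_Iw: "g \<in> Iw \<Longrightarrow> diag_part g \<in> Iw"
proof -
  assume g: "g \<in> Iw"
  let ?h = "mat3 (inverse (g $ 1 $ 1)) 0 0 0 (inverse (g $ 2 $ 2)) 0 0 0 (inverse (g $ 3 $ 3))"
  have "diag_part g \<in> K"
    using Iw_unit[OF g] K_D0[OF Iw_K[OF g]]
    by (intro K_I[of _ ?h]) (auto simp: diag_part_def mat3_eq_iff mat_mult3 mat_nth L_iff3)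
  then show ?thesis using K_L0[of "diag_part g"] by (simp add: Iw_iff J0_iff diag_part_def)
qed

lemma diag_part_diff: "g \<in> Iw \<Longrightarrow> g - diag_part g \<in> J 1"
  using diag_part_Iw[of g] by (auto simp: J1_iff Iw_iff intro!: J_diff) (simp_all add: diag_part_def)

lemma transpose_diag_part: "transpose (diag_part g) = diag_part g"
  by (simp add: diag_part_def transpose_def mat3_eq_iff)

text \<open>Torus times pro-p part; the torus factor is the actual diagonal of the matrix rather
  than a lift of its residues.\<close>

lemma Iw_eq_diag_part:
  assumes "g \<in> Iw"
  obtains u where "u \<in> Iwr 1" "g = diag_part g ** u"
proof
  let ?d = "diag_part g"
  note d = diag_part_Iw[OF assms]
  show "matrix_inv ?d ** g \<in> Iwr 1"
    using assms d Iw_inv[OF d] diag_part_diff[OF assms] by (intro Iwr_quotient) (auto simp: Iw_iff)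
  show "g = ?d ** (matrix_inv ?d ** g)"
    by (rule GL3_inv_cancel(1)[OF K_GL3[OF Iw_K[OF d]], symmetric])
qed

end

section \<open>Uniqueness of the invariant line\<close>

context nonarch_local_field
begin

text \<open>Transposing the coset identity moves the extra factor to the left, because
  \<open>srefl\<close> is symmetric. In this way the same computation serves the opposite
  group.\<close>

lemma srefl_transpose:
  assumes "g \<in> Iw" "a \<in> D 0"
  shows "srefl s a ** transpose g = transpose (coset_elt s g a) ** srefl s (coset_arg s g a)"
proof -
  have "transpose (g ** srefl s a) = transpose (srefl s (coset_arg s g a) ** coset_elt s g a)"
    using coset_elt[OF assms] by simp
  then show ?thesis by (simp only: matrix_transpose_mul transpose_srefl)
qed

lemma symmetric_transpose:
  assumes d: "d \<in> Iw" "transpose d = d" and g: "g \<in> Iwr 1"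
  obtains u where "u \<in> Iwr 1" "d ** transpose g = transpose u ** d"
proof
  have dG: "d \<in> GL3" using d(1) K_GL3 Iw_K by blast
  show "matrix_inv d ** g ** d \<in> Iwr 1" using Iwr_conj[OF g Iw_inv[OF d(1)]] GL3_inv[OF dG] by simp
  have "g ** d = d ** (matrix_inv d ** g ** d)"
    using GL3_inv_cancel(1)[OF dG, of "g ** d"] by (simp add: matrix_mul_assoc)
  then have "transpose (g ** d) = transpose (d ** (matrix_inv d ** g ** d))" by simp
  then show "d ** transpose g = transpose (matrix_inv d ** g ** d) ** d"
    by (simp only: matrix_transpose_mul d(2))
qed

end

context weight
begin

text \<open>For a unit parameter the reflection can be traded for a lower unipotent times an upper
  triangular matrix, which acts on an eigenvector by a scalar.\<close>

lemma root_elt_transpose: "b \<in> D 0 \<Longrightarrow> b \<notin> D 1 \<Longrightarrow> srefl s b = transpose (root_elt s (inverse b)) ** upper_elt s b"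
  using unit_inverse[of b]
  by (cases s) (simp_all add: srefl_def upper_elt_def root_elt_def transpose_def mat3_eq_iff mat_mult3)

text \<open>The span is stable under the generators of \<open>K_generated\<close>. The critical
  generator is a reflection: for a unit \<open>a\<close> the opposite factorisation puts
  \<open>\<sigma> (srefl s a) m\<close> into the span, and the one remaining class, that of 0, is
  then obtained from the eigenvalue equation of \<open>hop s\<close>.\<close>

lemma heig_span:
  assumes m: "heig m"
  shows "V.span {\<sigma> (transpose g) m | g. g \<in> Iwr 1} = UNIV" (is "?M = _")
proof -
  have base: "\<sigma> (transpose g) m \<in> ?M" if "g \<in> Iwr 1" for g
    using that by (intro V.span_base) blast
  have eig: "eig m" and m0: "m \<noteq> 0" using m by (auto simp: heig_def)
  have sub: "g \<in> Iwr 1 \<Longrightarrow> g \<in> K" "g \<in> Iwr 1 \<Longrightarrow> transpose g \<in> K" for g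
    using Iwr_K K_transpose by blast+
  have stable: "\<sigma> h w \<in> ?M" if h: "h \<in> K" and *: "\<And>g. g \<in> Iwr 1 \<Longrightarrow> \<sigma> h (\<sigma> (transpose g) m) \<in> ?M"
      and w: "w \<in> ?M" for h w
    using w
  proof (induction rule: V.span_induct_alt)
    case base
    then show ?case using sg_zero[OF h] V.span_zero by simp
  next
    case (step c x y)
    then show ?case using * sg_add[OF h] sg_scale[OF h] V.span_add V.span_scale by auto
  qed
  have refl_m: "\<sigma> (srefl s a) m \<in> ?M" if a: "a \<in> D 0" for s a
  proof -
    have unit: "\<sigma> (srefl s b) m \<in> ?M" if b: "b \<in> D 0" "b \<notin> D 1" for b
    proof -
      let ?h = "upper_elt s b"
      have h: "?h \<in> Iw" by (rule upper_Iw[OF b])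
      obtain c where c: "\<sigma> ?h m = smul c m" using eig h by (auto simp: eig_def)
      have r: "root_elt s (inverse b) \<in> Iwr 1" using unit_inverse[OF b] by (intro root_elt_Iwr) auto
      have "\<sigma> (srefl s b) m = \<sigma> (transpose (root_elt s (inverse b))) (\<sigma> ?h m)"
        unfolding root_elt_transpose[OF b, of s] by (intro sg_mult Iw_K h sub r)
      also have "\<dots> = smul c (\<sigma> (transpose (root_elt s (inverse b))) m)"
        unfolding c by (intro sg_scale sub r)
      finally show ?thesis using base[OF r] by (simp add: V.span_scale)
    qed
    show ?thesis
    proof (cases "a \<in> D 1")
      case True
      \<comment> \<open>Here r represents the class of 0, so every other representative is a
        unit.\<close>
      obtain r where r: "r \<in> residue_reps" "a - r \<in> D 1" using residue_rep_exists[OF a] by blast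
      obtain \<mu> where \<mu>: "hop s m = smul \<mu> m" using m by (auto simp: heig_def)
      have "\<sigma> (srefl s b) m \<in> ?M" if "b \<in> residue_reps - {r}" for b
      proof (rule unit)
        show "b \<in> D 0" using that reps_D0 by blast
        show "b \<notin> D 1"
        proof
          assume "b \<in> D 1"
          then have "b - r \<in> D 1" using True r(2) D_diff_trans[of b a 1 r] D_diff[of b 1 a] by blast
          then show False using residue_rep_unique[of b r] that r(1) by blast
        qed
      qed
      then have "(\<Sum>b\<in>residue_reps - {r}. \<sigma> (srefl s b) m) \<in> ?M" by (rule V.span_sum)
      moreover have "hop s m = \<sigma> (srefl s r) m + (\<Sum>b\<in>residue_reps - {r}. \<sigma> (srefl s b) m)"
        unfolding hop_def by (rule sum.remove[OF residue_reps(1) r(1)])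
      moreover have "smul \<mu> m \<in> ?M" using V.span_scale[OF base[OF Iwr_one]] by (simp add: transpose_mat)
      ultimately have "\<sigma> (srefl s r) m \<in> ?M"
        using V.span_diff[of "smul \<mu> m" _ "\<Sum>b\<in>residue_reps - {r}. \<sigma> (srefl s b) m"] \<mu> by simp
      then show ?thesis using sg_srefl_congruent[OF a reps_D0[OF r(1)] r(2), of s m] by simp
    qed (use unit a in blast)
  qed
  define H where "H = {g \<in> K. \<forall>w\<in>?M. \<sigma> g w \<in> ?M}"
  have "K \<subseteq> H"
  proof
    fix k assume "k \<in> K"
    show "k \<in> H"
    proof (rule K_generated[OF _ _ _ _ \<open>k \<in> K\<close>])
      show "g ** h \<in> H" if "g \<in> H" "h \<in> H" for g h
        using that by (simp add: H_def sg_mult K_mult)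
      show "transpose g \<in> H" if g: "g \<in> Iwr 1" for g
      proof -
        have "\<sigma> (transpose g) (\<sigma> (transpose h) m) \<in> ?M" if h: "h \<in> Iwr 1" for h
          using base[of "h ** g"] Iwr_mult[OF h g] sg_mult[of "transpose g" "transpose h" m] sub g h
          by (simp add: matrix_transpose_mul)
        then show ?thesis using stable[of "transpose g"] sub g by (simp add: H_def)
      qed
      show "mat3 a 0 0 0 b 0 0 0 c \<in> H" if d: "mat3 a 0 0 0 b 0 0 0 c \<in> Iw" (is "?d \<in> _") for a b c
      proof -
        have dt: "transpose ?d = ?d" by (simp add: transpose_def mat3_eq_iff)
        obtain e where e: "\<sigma> ?d m = smul e m" using eig d by (auto simp: eig_def)
        have "\<sigma> ?d (\<sigma> (transpose g) m) \<in> ?M" if g: "g \<in> Iwr 1" for g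
        proof -
          obtain u where u: "u \<in> Iwr 1" "?d ** transpose g = transpose u ** ?d"
            by (rule symmetric_transpose[OF d dt g])
          then have "\<sigma> ?d (\<sigma> (transpose g) m) = \<sigma> (transpose u) (\<sigma> ?d m)"
            using sg_mult[of ?d "transpose g" m] sg_mult[of "transpose u" ?d m] sub g Iw_K[OF d] by simp
          also have "\<dots> = smul e (\<sigma> (transpose u) m)" unfolding e by (intro sg_scale sub u)
          finally show ?thesis using base[OF u(1)] by (simp add: V.span_scale)
        qed
        then show ?thesis using stable[of ?d] Iw_K[OF d] by (simp add: H_def)
      qed
      show "srefl s 0 \<in> H" for s
      proof -
        have "\<sigma> (srefl s 0) (\<sigma> (transpose g) m) \<in> ?M" if g: "g \<in> Iwr 1" for g
        proof -
          have gI: "g \<in> Iw" using g Iwr_Iw by auto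
          let ?a = "coset_arg s g 0" and ?u = "coset_elt s g 0"
          have u: "?u \<in> Iwr 1" and a: "?a \<in> D 0"
            using coset_elt_Iwr[OF g, of 0 s] coset_arg_D0[OF gI, of 0 s] by auto
          have "srefl s 0 ** transpose g = transpose ?u ** srefl s ?a" by (rule srefl_transpose[OF gI]) simp
          then have "\<sigma> (srefl s 0) (\<sigma> (transpose g) m) = \<sigma> (transpose ?u) (\<sigma> (srefl s ?a) m)"
            using sg_mult[of "srefl s 0" "transpose g" m] sg_mult[of "transpose ?u" "srefl s ?a" m] sub g u a by simp
          moreover have "\<sigma> (transpose ?u) w \<in> ?M" if "w \<in> ?M" for w
          proof (rule stable[OF sub(2)[OF u] _ that])
            fix h assume h: "h \<in> Iwr 1"
            show "\<sigma> (transpose ?u) (\<sigma> (transpose h) m) \<in> ?M"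
              using base[of "h ** ?u"] Iwr_mult[OF h u] sg_mult[of "transpose ?u" "transpose h" m] sub u h
              by (simp add: matrix_transpose_mul)
          qed
          ultimately show ?thesis using refl_m[OF a] by simp
        qed
        then show ?thesis using stable[of "srefl s 0"] by (simp add: H_def)
      qed
    qed
  qed
  then have "\<And>g w. g \<in> K \<Longrightarrow> w \<in> ?M \<Longrightarrow> \<sigma> g w \<in> ?M" by (auto simp: H_def)
  moreover have "m \<in> ?M" using base[OF Iwr_one] by (simp add: transpose_mat)
  ultimately show ?thesis using m0 by (intro irreducibleD[of ?M m]) auto
qed

text \<open>Linear forms on the coinvariants of the opposite pro-p group, whose elements are the
  transposes of those of the pro-p-Iwahori subgroup.\<close>

definition lowfun :: "('v \<Rightarrow> 'k) \<Rightarrow> bool" where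
  "lowfun \<phi> \<longleftrightarrow> Vector_Spaces.linear smul (*) \<phi> \<and> (\<forall>g\<in>Iwr 1. \<forall>w. \<phi> (\<sigma> (transpose g) w) = \<phi> w)"

lemma functional_add: "lowfun \<phi> \<Longrightarrow> \<phi> (w + w') = \<phi> w + \<phi> w'"
  and functional_scale: "lowfun \<phi> \<Longrightarrow> \<phi> (smul c w) = c * \<phi> w"
  and functional_zero: "lowfun \<phi> \<Longrightarrow> \<phi> 0 = 0"
  and functional_sum: "lowfun \<phi> \<Longrightarrow> \<phi> (sum F A) = (\<Sum>x\<in>A. \<phi> (F x))"
  unfolding lowfun_def linear_iff_module_hom
  by (blast intro: module_hom.add module_hom.scale module_hom.zero module_hom.sum)+

lemma lowfun_transpose: "lowfun \<phi> \<Longrightarrow> g \<in> Iwr 1 \<Longrightarrow> \<phi> (\<sigma> (transpose g) w) = \<phi> w"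
  by (simp add: lowfun_def)

lemma exists_lowfun: "\<exists>\<phi> w. lowfun \<phi> \<and> \<phi> w \<noteq> 0"
proof -
  obtain w0 :: 'v where w0: "w0 \<noteq> 0" using nonzero_vector by blast
  define B where "B = V.extend_basis {w0}"
  have ind: "V.independent {w0}" using w0 V.dependent_single by blast
  have B: "V.independent B" "w0 \<in> B" "V.span B = UNIV"
    using V.independent_extend_basis[OF ind] V.extend_basis_superset[OF ind] V.span_extend_basis[OF ind]
    by (auto simp: B_def)
  define \<phi>0 where "\<phi>0 = (\<lambda>w. V.representation B w w0)"
  have \<phi>0: "Vector_Spaces.linear smul (*) \<phi>0" "\<phi>0 \<noteq> 0"
  proof -
    show "Vector_Spaces.linear smul (*) \<phi>0"
      using B by unfold_locales
        (auto simp: \<phi>0_def V.representation_add V.representation_scale algebra_simps)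
    have "\<phi>0 w0 = 1" using V.representation_basis[OF B(1,2)] by (simp add: \<phi>0_def)
    then show "\<phi>0 \<noteq> 0" by (metis zero_fun_apply zero_neq_one)
  qed
  let ?A = "{\<phi>. Vector_Spaces.linear smul (*) \<phi>}"
  \<comment> \<open>Precomposition and transposition both reverse products, so this is a left action
    of the pro-p-Iwahori subgroup on functionals.\<close>
  let ?act = "\<lambda>g \<phi> w. \<phi> (\<sigma> (transpose g) w)"
  have "vector_space ((*) :: 'k \<Rightarrow> 'k \<Rightarrow> 'k)" by (rule vector_space_over_itself.vector_space_axioms)
  then interpret F: vector_space "fun_scale (*) :: 'k \<Rightarrow> ('v \<Rightarrow> 'k) \<Rightarrow> 'v \<Rightarrow> 'k"
    by (rule vector_space_fun_scale)
  have "\<exists>\<phi>\<in>?A. \<phi> \<noteq> 0 \<and> (\<forall>g\<in>Iwr 1. ?act g \<phi> = \<phi>)"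
  proof (rule pro_p_fixed_vector[OF F.vector_space_axioms prime_char char_D1, of _ _ \<phi>0 3])
    show "F.subspace ?A"
    proof (rule F.subspaceI)
      show "0 \<in> ?A"
        by (auto simp: linear_iff_module_hom module_hom_iff V.module_axioms vector_space_over_itself.module_axioms)
      show "x + y \<in> ?A" if "x \<in> ?A" "y \<in> ?A" for x y :: "'v \<Rightarrow> 'k"
        using that by (auto simp: linear_iff_module_hom module_hom_iff V.module_axioms
            vector_space_over_itself.module_axioms algebra_simps)
      show "fun_scale (*) c x \<in> ?A" if "x \<in> ?A" for c and x :: "'v \<Rightarrow> 'k"
        using that by (auto simp: linear_iff_module_hom module_hom_iff V.module_axioms fun_scale_def
            vector_space_over_itself.module_axioms algebra_simps)
    qed
    fix g assume g: "g \<in> Iwr 1"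
    show "Vector_Spaces.linear (fun_scale (*)) (fun_scale (*)) (?act g)"
      by unfold_locales (auto simp: fun_scale_def fun_eq_iff algebra_simps)
    show "?act g \<phi> \<in> ?A" if "\<phi> \<in> ?A" for \<phi>
      using Vector_Spaces.linear_compose[OF sg_linear[OF K_transpose[OF Iwr_K[OF g]]], of "(*)" \<phi>] that by (simp add: o_def)
    show "?act (g ** h) \<phi> = ?act g (?act h \<phi>)" if "h \<in> Iwr 1" for h \<phi>
      using that g by (simp add: matrix_transpose_mul sg_mult K_transpose Iwr_K)
  next
    \<comment> \<open>\<open>J 3\<close> is contained in \<open>L 1\<close>, and \<sigma> is trivial
      on matrices congruent to 1, so level 3 fixes every functional. This replaces smoothness of the
      dual space.\<close>
    show "?act g \<phi>0 = \<phi>0" if "g \<in> Iwr 3" for g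
    proof -
      have "transpose g - mat 1 = transpose (g - mat 1)" by (simp add: vec_eq_iff transpose_def mat_nth)
      then have "transpose g - mat 1 \<in> L 1" using that J_subset_L[of 1] L_transpose by (auto simp: Iwr_def)
      then show ?thesis using sg_near_one[OF K_transpose[OF Iwr_K[OF that]]] by simp
    qed
  qed (use \<phi>0 in \<open>auto simp: transpose_mat\<close>)
  then obtain \<phi> where \<phi>: "\<phi> \<in> ?A" "\<phi> \<noteq> 0" "\<And>g. g \<in> Iwr 1 \<Longrightarrow> ?act g \<phi> = \<phi>" by blast
  have "lowfun \<phi>" unfolding lowfun_def using \<phi>(1) \<phi>(3) by (metis mem_Collect_eq)
  moreover have "\<exists>w. \<phi> w \<noteq> 0" using \<phi>(2) by (auto simp: fun_eq_iff)
  ultimately show ?thesis by blast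
qed

text \<open>A lower invariant functional is constant on the orbit of \<open>m\<close> under the
  opposite group, and this orbit spans \<sigma>.\<close>

lemma lowfun_zero:
  assumes "heig m" "lowfun \<phi>" "\<phi> m = 0"
  shows "\<phi> w = 0"
proof -
  have "w \<in> V.span {\<sigma> (transpose g) m | g. g \<in> Iwr 1}" using heig_span[OF assms(1)] by simp
  then show ?thesis
  proof (induction rule: V.span_induct_alt)
    case (step c x y)
    then have "\<phi> x = 0" using assms(3) lowfun_transpose[OF assms(2)] by auto
    then show ?case using step(2) by (simp add: functional_add functional_scale assms(2))
  qed (simp add: functional_zero assms)
qed

text \<open>Lower invariant functionals form a line, as the combination vanishing at
  \<open>m\<close> vanishes everywhere. Any operator that preserves them therefore acts by a
  scalar.\<close>

lemma lowfun_unique: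
  assumes "heig m" "lowfun \<phi>" "lowfun \<phi>'" "\<phi> m \<noteq> 0"
  shows "\<phi>' w = \<phi>' m / \<phi> m * \<phi> w"
proof -
  let ?f = "\<lambda>w. \<phi>' w - \<phi>' m / \<phi> m * \<phi> w"
  have "lowfun ?f" unfolding lowfun_def
  proof
    show "Vector_Spaces.linear smul (*) ?f"
      by unfold_locales (simp_all add: functional_add functional_scale assms algebra_simps add_divide_distrib)
  qed (simp add: lowfun_transpose assms)
  from lowfun_zero[OF assms(1) this, of w] have "?f w = 0" using assms(4) by simp
  then show ?thesis by simp
qed

text \<open>With \<open>lowfun_unique\<close> this makes the functional an eigenvector of the
  transposed operators, so that its kernel is stable under \<open>hop s\<close>.\<close>

lemma lowfun_hop: "lowfun \<phi> \<Longrightarrow> lowfun (\<lambda>w. \<phi> (hop s w))"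
proof -
  assume \<phi>: "lowfun \<phi>"
  have "\<phi> (hop s (\<sigma> (transpose g) w)) = \<phi> (hop s w)" if g: "g \<in> Iwr 1" for g w
  proof -
    have gI: "g \<in> Iw" using g Iwr_Iw by auto
    have *: "\<phi> (\<sigma> (srefl s a) (\<sigma> (transpose g) w)) = \<phi> (\<sigma> (srefl s (coset_arg s g a)) w)" if a: "a \<in> D 0" for a
    proof -
      let ?u = "coset_elt s g a" and ?b = "coset_arg s g a"
      have u: "?u \<in> Iwr 1" and b: "?b \<in> D 0" using coset_elt_Iwr[OF g a] coset_arg_D0[OF gI a] by auto
      have "srefl s a ** transpose g = transpose ?u ** srefl s ?b" by (rule srefl_transpose[OF gI a])
      then have "\<sigma> (srefl s a) (\<sigma> (transpose g) w) = \<sigma> (transpose ?u) (\<sigma> (srefl s ?b) w)"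
        using sg_mult[of "srefl s a" "transpose g" w] sg_mult[of "transpose ?u" "srefl s ?b" w] a b
          K_transpose[OF Iwr_K[OF g]] K_transpose[OF Iwr_K[OF u]] by simp
      then show ?thesis using lowfun_transpose[OF \<phi> u] by simp
    qed
    have "\<phi> (hop s (\<sigma> (transpose g) w)) = (\<Sum>a\<in>residue_reps. \<phi> (\<sigma> (srefl s (coset_arg s g a)) w))"
      unfolding hop_def functional_sum[OF \<phi>] using * reps_D0 by (intro sum.cong) auto
    also have "\<dots> = (\<Sum>a\<in>residue_reps. \<phi> (\<sigma> (srefl s a) w))"
      by (rule sum_residue_reindex[of "\<lambda>a. \<phi> (\<sigma> (srefl s a) w)" "coset_arg s g"])
        (assumption | rule arg_cong[of _ _ \<phi>] sg_srefl_congruent coset_arg_D0[OF gI] coset_arg_diff[OF gI]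
          coset_arg_surj[OF gI])+
    finally show ?thesis by (simp add: hop_def functional_sum[OF \<phi>])
  qed
  moreover have "Vector_Spaces.linear smul (*) (\<lambda>w. \<phi> (hop s w))"
    by unfold_locales (simp_all add: hop_add hop_scale functional_add[OF \<phi>] functional_scale[OF \<phi>] algebra_simps)
  ultimately show ?thesis by (simp add: lowfun_def)
qed

lemma lowfun_diag:
  assumes \<phi>: "lowfun \<phi>" and d: "diag_part d \<in> Iw"
  shows "lowfun (\<lambda>w. \<phi> (\<sigma> (diag_part d) w))"
proof -
  let ?d = "diag_part d"
  have "\<phi> (\<sigma> ?d (\<sigma> (transpose g) w)) = \<phi> (\<sigma> ?d w)" if g: "g \<in> Iwr 1" for g w
  proof -
    obtain u where u: "u \<in> Iwr 1" "?d ** transpose g = transpose u ** ?d"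
      by (rule symmetric_transpose[OF d transpose_diag_part g])
    then have "\<sigma> ?d (\<sigma> (transpose g) w) = \<sigma> (transpose u) (\<sigma> ?d w)"
      using sg_mult[of ?d "transpose g" w] sg_mult[of "transpose u" ?d w] Iw_K[OF d]
        K_transpose[OF Iwr_K[OF g]] K_transpose[OF Iwr_K[OF u(1)]] by simp
    then show ?thesis using lowfun_transpose[OF \<phi> u(1)] by simp
  qed
  moreover have "Vector_Spaces.linear smul (*) (\<lambda>w. \<phi> (\<sigma> ?d w))"
    using sg_add[OF Iw_K[OF d]] sg_scale[OF Iw_K[OF d]] by unfold_locales
     (simp_all add: functional_add[OF \<phi>] functional_scale[OF \<phi>] algebra_simps)
  ultimately show ?thesis by (simp add: lowfun_def)
qed

text \<open>The kernel of a lower invariant functional on the invariants is stable under the Hecke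
  operators, but contains no simultaneous eigenvector.\<close>

lemma exists_invariant_line:
  "\<exists>m \<phi>. heig m \<and> inv1 = range (\<lambda>c. smul c m) \<and> lowfun \<phi> \<and> \<phi> m = 1"
proof -
  have "inv1 \<noteq> {0}" using exists_inv1_in[of UNIV] nonzero_vector by auto
  then obtain m where m: "m \<in> inv1" "heig m"
    using exists_heig[of inv1] inv1_subspace sg_Iw_inv1 hop_inv1 by blast
  obtain \<phi>0 w0 where \<phi>0: "lowfun \<phi>0" "\<phi>0 w0 \<noteq> 0" using exists_lowfun by blast
  have nz: "\<phi>0 m' \<noteq> 0" if "heig m'" for m' using lowfun_zero[OF that \<phi>0(1)] \<phi>0(2) by blast
  let ?A = "{w \<in> inv1. \<phi>0 w = 0}"
  have A0: "?A = {0}"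
  proof (rule ccontr)
    assume "?A \<noteq> {0}"
    have "\<exists>m\<in>?A. heig m"
    proof (rule exists_heig[OF _ _ \<open>?A \<noteq> {0}\<close>])
      show "V.subspace ?A" using inv1_subspace
        by (auto simp: V.subspace_def functional_add functional_scale functional_zero \<phi>0(1))
      show "hop s w \<in> ?A" if "w \<in> ?A" for s w
        using that lowfun_unique[OF m(2) \<phi>0(1) lowfun_hop[OF \<phi>0(1)] nz[OF m(2)], of s w] by (simp add: hop_inv1)
      show "\<sigma> g w \<in> ?A" if g: "g \<in> Iw" and w: "w \<in> ?A" for g w
      proof -
        have eq: "\<sigma> g w = \<sigma> (diag_part g) w"
          using g w by (intro sg_inv1_congruent diag_part_Iw diag_part_diff) auto
        have "\<phi>0 (\<sigma> g w) = 0" unfolding eq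
          using w lowfun_unique[OF m(2) \<phi>0(1) lowfun_diag[OF \<phi>0(1) diag_part_Iw[OF g]] nz[OF m(2)], of w] by simp
        moreover have "\<sigma> g w \<in> inv1" using sg_Iw_inv1[OF g] w by simp
        ultimately show ?thesis by simp
      qed
    qed blast
    then show False using nz by blast
  qed
  have line: "w = smul (\<phi>0 w / \<phi>0 m) m" if w: "w \<in> inv1" for w
  proof -
    let ?u = "w + smul (- (\<phi>0 w / \<phi>0 m)) m"
    have "?u \<in> inv1" using inv1_subspace w m(1) by (intro V.subspace_add V.subspace_scale) auto
    moreover have "\<phi>0 ?u = 0" using nz[OF m(2)] by (simp only: functional_add functional_scale \<phi>0(1)) simp
    ultimately have "?u = 0" using A0 by blast
    then show ?thesis by (simp add: V.scale_minus_left)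
  qed
  have "inv1 = range (\<lambda>c. smul c m)"
    using line V.subspace_scale[OF inv1_subspace m(1)] by blast
  moreover have "lowfun (\<lambda>w. \<phi>0 w / \<phi>0 m)" unfolding lowfun_def
  proof
    show "Vector_Spaces.linear smul (*) (\<lambda>w. \<phi>0 w / \<phi>0 m)"
      by unfold_locales (simp_all add: functional_add functional_scale \<phi>0(1) algebra_simps add_divide_distrib)
  qed (simp add: lowfun_transpose \<phi>0(1))
  moreover have "\<phi>0 m / \<phi>0 m = 1" using nz[OF m(2)] by simp
  ultimately show ?thesis using m(2) by blast
qed

end

section \<open>Topology of the group\<close>

context uniformized_field
begin

text \<open>A vector x killed by g equals (1 - g) x, which would raise the least valuation of its
  coordinates by one; hence x = 0 and g is invertible.\<close>

lemma near_one_K: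
  assumes "g - mat 1 \<in> L 1"
  shows "g \<in> K"
proof -
  have "x = 0" if x: "g *v x = 0" for x
  proof (rule ccontr)
    assume "x \<noteq> 0"
    define Z where "Z = {i. x $ i \<noteq> 0}"
    have Z: "finite Z" "Z \<noteq> {}" using \<open>x \<noteq> 0\<close> by (auto simp: Z_def vec_eq_iff)
    define c where "c = Min ((\<lambda>i. v (x $ i)) ` Z)"
    have "c \<in> (\<lambda>i. v (x $ i)) ` Z" unfolding c_def using Z by (intro Min_in) auto
    then obtain i where i: "i \<in> Z" "v (x $ i) = c" by blast
    have "c \<le> v (x $ j)" if "j \<in> Z" for j unfolding c_def using that Z(1) by (intro Min_le) auto
    then have xc: "x $ j \<in> D c" for j by (auto simp: frac_ideal_def Z_def)
    have "(g *v x) $ i = (\<Sum>j\<in>UNIV. g $ i $ j * x $ j)" by (simp add: matrix_vector_mult_def)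
    also have "\<dots> = (\<Sum>j\<in>UNIV. (g - mat 1) $ i $ j * x $ j) + (\<Sum>j\<in>UNIV. mat 1 $ i $ j * x $ j)"
      by (simp add: sum.distrib[symmetric] algebra_simps)
    also have "(\<Sum>j\<in>UNIV. mat 1 $ i $ j * x $ j) = x $ i"
      by (simp add: sum_3 mat_nth) (use exhaust_3[of i] in auto)
    finally have "x $ i = - (\<Sum>j\<in>UNIV. (g - mat 1) $ i $ j * x $ j)" using x by (simp add: add_eq_0_iff2)
    moreover have "(\<Sum>j\<in>UNIV. (g - mat 1) $ i $ j * x $ j) \<in> D (1 + c)"
      unfolding sum_3 by (intro D_add D_mult L_nth[OF assms] xc)
    ultimately have "x $ i \<in> D (1 + c)" by simp
    then show False using i by (auto simp: frac_ideal_def Z_def)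
  qed
  then have "\<exists>B. B ** g = mat 1" unfolding matrix_left_invertible_ker by simp
  then obtain B where "B ** g = mat 1" ..
  then have "g \<in> GL3" by (rule GL3_I[OF matrix_inv_unique(2)])
  then show ?thesis using assms by (rule K_near_one)
qed

lemma GL3_near:
  assumes "g \<in> GL3"
  shows "\<exists>N. \<forall>h. h - g \<in> L N \<longrightarrow> h ** matrix_inv g - mat 1 \<in> L n \<and> matrix_inv g ** h - mat 1 \<in> L n"
proof -
  obtain b where b: "matrix_inv g \<in> L b" using L_exists by blast
  have "h ** matrix_inv g - mat 1 \<in> L n \<and> matrix_inv g ** h - mat 1 \<in> L n" if h: "h - g \<in> L (n - b)" for h
  proof -
    have "h ** matrix_inv g - mat 1 = (h - g) ** matrix_inv g" "matrix_inv g ** h - mat 1 = matrix_inv g ** (h - g)"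
      using GL3_inv[OF assms] by (simp_all add: matrix_diff_ldistrib matrix_diff_rdistrib)
    then show ?thesis using L_mult[OF h b] L_mult[OF b h] by simp
  qed
  then show ?thesis by blast
qed

lemma topspace_GL3: "topspace (GL3_topology v) = GL3"
proof -
  have "openin (mat_topology v) UNIV" unfolding openin_mat_topology by simp
  then have "topspace (mat_topology v) = UNIV" using openin_subset by blast
  then show ?thesis by (simp add: GL3_topology_def)
qed

lemma openin_GL3:
  "openin (GL3_topology v) U \<longleftrightarrow> U \<subseteq> GL3 \<and> (\<forall>g\<in>U. \<exists>n. \<forall>h. h - g \<in> L n \<longrightarrow> h \<in> U)"
proof
  assume "openin (GL3_topology v) U"
  then obtain T where T: "openin (mat_topology v) T" "U = T \<inter> GL3"
    unfolding GL3_topology_def openin_subtopology by blast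
  have "\<exists>n. \<forall>h. h - g \<in> L n \<longrightarrow> h \<in> U" if g: "g \<in> U" for g
  proof -
    have gT: "g \<in> T" "g \<in> GL3" using g T(2) by simp_all
    obtain n where n: "\<forall>h. (\<forall>i j. h $ i $ j - g $ i $ j \<in> D n) \<longrightarrow> h \<in> T"
      using T(1) gT(1) unfolding openin_mat_topology by meson
    obtain N where N: "\<forall>h. h - g \<in> L N \<longrightarrow> h ** matrix_inv g - mat 1 \<in> L 1"
      using GL3_near[OF gT(2), of 1] by meson
    have "h \<in> U" if h: "h - g \<in> L (max n N)" for h
    proof -
      have "h - g \<in> L n" "h - g \<in> L N" using L_mono[OF h] by simp_all
      then have "h \<in> T" "h ** matrix_inv g \<in> K" using n N near_one_K by (auto simp: L_iff)
      moreover have "h = (h ** matrix_inv g) ** g" using GL3_inv_cancel(4)[OF gT(2)] by simp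
      ultimately show ?thesis using T(2) GL3_mult[OF K_GL3 gT(2), of "h ** matrix_inv g"] by simp
    qed
    then show ?thesis by blast
  qed
  moreover have "U \<subseteq> GL3" using T(2) by blast
  ultimately show "U \<subseteq> GL3 \<and> (\<forall>g\<in>U. \<exists>n. \<forall>h. h - g \<in> L n \<longrightarrow> h \<in> U)" by blast
next
  assume U: "U \<subseteq> GL3 \<and> (\<forall>g\<in>U. \<exists>n. \<forall>h. h - g \<in> L n \<longrightarrow> h \<in> U)"
  then have "openin (mat_topology v) U" unfolding openin_mat_topology by (simp add: L_iff)
  moreover have "U = U \<inter> GL3" using U by blast
  ultimately show "openin (GL3_topology v) U"
    unfolding GL3_topology_def openin_subtopology by blast
qed

text \<open>Ranges over all matrices near \<open>g\<close>, invertible or not; as the invertible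
  ones form an open set, this is continuity into a discrete space.\<close>

definition locally_constant :: "('f ^ 3 ^ 3 \<Rightarrow> 'a) \<Rightarrow> bool" where
  "locally_constant f \<longleftrightarrow> (\<forall>g\<in>GL3. \<exists>n. \<forall>h. h - g \<in> L n \<longrightarrow> f h = f g)"

lemma continuous_map_discrete_iff:
  "continuous_map (GL3_topology v) (discrete_topology UNIV) f \<longleftrightarrow> locally_constant f"
proof
  assume f: "continuous_map (GL3_topology v) (discrete_topology UNIV) f"
  show "locally_constant f" unfolding locally_constant_def
  proof
    fix g :: "'f ^ 3 ^ 3" assume g: "g \<in> GL3"
    have "openin (GL3_topology v) {x \<in> topspace (GL3_topology v). f x \<in> {f g}}"
      using f by (intro openin_continuous_map_preimage[OF f]) simp
    then have "\<exists>n. \<forall>h. h - g \<in> L n \<longrightarrow> h \<in> {x \<in> GL3. f x \<in> {f g}}"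
      unfolding openin_GL3 topspace_GL3 using g by blast
    then show "\<exists>n. \<forall>h. h - g \<in> L n \<longrightarrow> f h = f g" by auto
  qed
next
  assume f: "locally_constant f"
  have "openin (GL3_topology v) {x \<in> GL3. f x \<in> U}" for U
  proof -
    have open_GL3: "\<forall>g\<in>GL3. \<exists>n. \<forall>h. h - g \<in> L n \<longrightarrow> h \<in> GL3"
      using openin_topspace[of "GL3_topology v"] unfolding topspace_GL3 openin_GL3 by simp
    have "\<exists>n. \<forall>h. h - g \<in> L n \<longrightarrow> h \<in> GL3 \<and> f h \<in> U" if g: "g \<in> GL3" "f g \<in> U" for g
    proof -
      obtain n where n: "\<forall>h. h - g \<in> L n \<longrightarrow> f h = f g" using f g(1) unfolding locally_constant_def by meson
      obtain N where N: "\<forall>h. h - g \<in> L N \<longrightarrow> h \<in> GL3" using open_GL3 g(1) by meson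
      have "h \<in> GL3 \<and> f h \<in> U" if "h - g \<in> L (max n N)" for h
      proof -
        have "h - g \<in> L n" "h - g \<in> L N" using L_mono[OF that] by simp_all
        from n[rule_format, OF this(1)] N[rule_format, OF this(2)] show ?thesis using g(2) by simp
      qed
      then show ?thesis by blast
    qed
    then show ?thesis unfolding openin_GL3 by simp
  qed
  then show "continuous_map (GL3_topology v) (discrete_topology UNIV) f"
    unfolding continuous_map_def topspace_GL3 by simp
qed

lemma locally_constantI:
  assumes "\<And>g k. g \<in> GL3 \<Longrightarrow> k \<in> K \<Longrightarrow> k - mat 1 \<in> L 1 \<Longrightarrow> f (g ** k) = f g"
  shows "locally_constant f"
  unfolding locally_constant_def
proof
  fix g :: "'f ^ 3 ^ 3" assume g: "g \<in> GL3"
  obtain N where N: "\<forall>h. h - g \<in> L N \<longrightarrow> matrix_inv g ** h - mat 1 \<in> L 1" using GL3_near[OF g, of 1] by meson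
  have "f h = f g" if "h - g \<in> L N" for h
    using assms[OF g near_one_K, of "matrix_inv g ** h"] N that GL3_inv_cancel(1)[OF g] by simp
  then show "\<exists>n. \<forall>h. h - g \<in> L n \<longrightarrow> f h = f g" by blast
qed

lemma locally_constant_compose2:
  assumes "locally_constant f" "locally_constant f'"
  shows "locally_constant (\<lambda>g. F (f g) (f' g))"
  unfolding locally_constant_def
proof
  fix g :: "'f ^ 3 ^ 3" assume g: "g \<in> GL3"
  obtain n n' where n: "\<forall>h. h - g \<in> L n \<longrightarrow> f h = f g" "\<forall>h. h - g \<in> L n' \<longrightarrow> f' h = f' g"
    using assms g unfolding locally_constant_def by meson
  have "F (f h) (f' h) = F (f g) (f' g)" if "h - g \<in> L (max n n')" for h
  proof -
    have "h - g \<in> L n" "h - g \<in> L n'" using L_mono[OF that] by simp_all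
    from n(1)[rule_format, OF this(1)] n(2)[rule_format, OF this(2)] show ?thesis by simp
  qed
  then show "\<exists>n. \<forall>h. h - g \<in> L n \<longrightarrow> F (f h) (f' h) = F (f g) (f' g)" by blast
qed

lemma locally_constant_const: "locally_constant (\<lambda>g. c)"
  by (simp add: locally_constant_def)

lemma locally_constant_compose: "locally_constant f \<Longrightarrow> locally_constant (\<lambda>g. F (f g))"
  using locally_constant_compose2[of f f "\<lambda>x y. F x"] by simp

lemma locally_constant_sum:
  "(\<And>y. y \<in> S \<Longrightarrow> locally_constant (f y)) \<Longrightarrow> locally_constant (\<lambda>g. \<Sum>y\<in>S. f y g)"
  by (induction S rule: infinite_finite_induct)
    (simp_all add: locally_constant_const locally_constant_compose2[of _ _ "(+)"])

lemma locally_constant_translate: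
  assumes "locally_constant f" "x \<in> GL3" "y \<in> GL3"
  shows "locally_constant (\<lambda>g. f (x ** g ** y))"
  unfolding locally_constant_def
proof
  fix g :: "'f ^ 3 ^ 3" assume g: "g \<in> GL3"
  obtain a b where ab: "x \<in> L a" "y \<in> L b" using L_exists by meson
  have "x ** g ** y \<in> GL3" using assms g by (simp add: GL3_mult)
  then obtain n where n: "\<forall>h. h - x ** g ** y \<in> L n \<longrightarrow> f h = f (x ** g ** y)"
    using assms(1) unfolding locally_constant_def by meson
  have "f (x ** h ** y) = f (x ** g ** y)" if h: "h - g \<in> L (n - a - b)" for h
  proof -
    have "x ** h ** y - x ** g ** y = x ** (h - g) ** y" by (simp add: matrix_diff_ldistrib matrix_diff_rdistrib)
    also have "\<dots> \<in> L (a + (n - a - b) + b)" by (intro L_mult ab h)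
    finally have "x ** h ** y - x ** g ** y \<in> L n" by simp
    then show ?thesis by (rule n[rule_format])
  qed
  then show "\<exists>n. \<forall>h. h - g \<in> L n \<longrightarrow> f (x ** h ** y) = f (x ** g ** y)" by blast
qed

section \<open>Height and compactness modulo the centre\<close>

text \<open>If \<pi>^e1, \<pi>^e2, \<pi>^e3 with e1 \<le> e2 \<le> e3 are the elementary divisors of
  \<open>g\<close>, the two memberships say a \<le> e1 and e3 \<le> a + n, so the condition is e3 -
  e1 \<le> n. It is invariant under scaling.\<close>

definition bounded_height :: "int \<Rightarrow> 'f ^ 3 ^ 3 \<Rightarrow> bool" where
  "bounded_height n g \<longleftrightarrow> g \<in> GL3 \<and> (\<exists>a. g \<in> L a \<and> matrix_inv g \<in> L (- n - a))"

lemma Cauchy_matrices: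
  assumes "\<And>k. B (Suc k) - B k \<in> L (int k)"
  shows "\<exists>M. \<forall>k. \<exists>N. \<forall>i\<ge>N. B i - M \<in> L k"
proof -
  have step: "B (i + d) - B i \<in> L (int i)" for i d
  proof (induction d)
    case (Suc d)
    have "B (i + Suc d) - B (i + d) \<in> L (int i)" using L_mono[OF assms[of "i + d"], of "int i"] by simp
    then show ?case using Suc by (rule L_diff_trans)
  qed simp
  have cauchy: "B i - B j \<in> L (int N)" if "i \<ge> N" "j \<ge> N" for i j N
    using step[of N "i - N"] step[of N "j - N"] that L_diff_trans L_diff_commute
    by (metis le_add_diff_inverse)
  have "\<exists>l. \<forall>n. \<exists>N::nat. \<forall>i\<ge>N. B i $ a $ b - l \<in> D n" for a b
  proof (rule complete)
    show "\<forall>n. \<exists>N. \<forall>i\<ge>N. \<forall>j\<ge>N. B i $ a $ b - B j $ a $ b \<in> D n"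
    proof
      fix n :: int
      have "B i $ a $ b - B j $ a $ b \<in> D n" if "i \<ge> nat n" "j \<ge> nat n" for i j
        using L_nth[OF L_mono[OF cauchy[OF that], of n], of a b] by simp
      then show "\<exists>N. \<forall>i\<ge>N. \<forall>j\<ge>N. B i $ a $ b - B j $ a $ b \<in> D n" by blast
    qed
  qed
  then obtain l where l: "\<And>a b n. \<exists>N::nat. \<forall>i\<ge>N. B i $ a $ b - l a b \<in> D n" by metis
  have "\<exists>N. \<forall>i\<ge>N. B i - (\<chi> a b. l a b) \<in> L k" for k
  proof -
    define N where "N a b = (SOME N. \<forall>i\<ge>N. B i $ a $ b - l a b \<in> D k)" for a b
    have N: "i \<ge> N a b \<Longrightarrow> B i $ a $ b - l a b \<in> D k" for a b i
      using someI_ex[OF l[of a b k]] unfolding N_def by blast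
    have le: "N a b \<le> (\<Sum>a\<in>UNIV. \<Sum>b\<in>UNIV. N a b)" for a b
      by (rule order_trans[OF member_le_sum[of b] member_le_sum[of a]]) auto
    then have "B i - (\<chi> a b. l a b) \<in> L k" if "i \<ge> (\<Sum>a\<in>UNIV. \<Sum>b\<in>UNIV. N a b)" for i
      unfolding L_iff using N[OF order_trans[OF _ that]] le by simp
    then show ?thesis by blast
  qed
  then show ?thesis by blast
qed

text \<open>If no finite subcover existed, one could choose nested balls of growing precision, none
  of them finitely covered. Their centres converge by completeness, the bound on inverses keeps the
  limit in the set, and one member of the cover contains a whole ball around it.\<close>

lemma compactin_bounded: "compactin (GL3_topology v) {g \<in> GL3. g \<in> L 0 \<and> matrix_inv g \<in> L n}"
  (is "compactin _ ?S")
  unfolding compactin_def topspace_GL3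
proof (intro conjI allI impI)
  show "?S \<subseteq> GL3" by blast
  fix \<U> assume \<U>: "(\<forall>U\<in>\<U>. openin (GL3_topology v) U) \<and> ?S \<subseteq> \<Union>\<U>"
  show "\<exists>\<F>. finite \<F> \<and> \<F> \<subseteq> \<U> \<and> ?S \<subseteq> \<Union>\<F>"
  proof (rule ccontr)
    assume no: "\<not> (\<exists>\<F>. finite \<F> \<and> \<F> \<subseteq> \<U> \<and> ?S \<subseteq> \<Union>\<F>)"
    define good where "good H \<longleftrightarrow> (\<exists>\<F>. finite \<F> \<and> \<F> \<subseteq> \<U> \<and> H \<subseteq> \<Union>\<F>)" for H
    define ball where "ball B k = {g \<in> ?S. g - B \<in> L k}" for B k
    have good_union: "good (\<Union>B\<in>T. f B)" if T: "finite T" and gd: "\<And>B. B \<in> T \<Longrightarrow> good (f B)" for T and f :: "'f ^ 3 ^ 3 \<Rightarrow> _"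
    proof -
      obtain \<F> where \<F>: "\<And>B. B \<in> T \<Longrightarrow> finite (\<F> B) \<and> \<F> B \<subseteq> \<U> \<and> f B \<subseteq> \<Union>(\<F> B)"
        using gd unfolding good_def by metis
      have "f B \<subseteq> \<Union>(\<Union>B\<in>T. \<F> B)" if "B \<in> T" for B
        using \<F>[OF that] that by (meson Sup_subset_mono UN_upper order_trans)
      then have "(\<Union>B\<in>T. f B) \<subseteq> \<Union>(\<Union>B\<in>T. \<F> B)" by (rule UN_least)
      moreover have "finite (\<Union>B\<in>T. \<F> B)" "(\<Union>B\<in>T. \<F> B) \<subseteq> \<U>" using T \<F> by auto
      ultimately show ?thesis unfolding good_def by blast
    qed
    have split: "\<exists>B\<in>H. \<not> good {g \<in> H. g - B \<in> L k}" if H: "H \<subseteq> ?S" "\<not> good H" for H k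
    proof (rule ccontr)
      assume a: "\<not> (\<exists>B\<in>H. \<not> good {g \<in> H. g - B \<in> L k})"
      have "H \<subseteq> L 0" using H(1) by blast
      from finite_L_quotient[OF this, of k]
      obtain T where T: "finite T" "T \<subseteq> H" "\<forall>g\<in>H. \<exists>B\<in>T. g - B \<in> L k" by meson
      have "good (\<Union>B\<in>T. {g \<in> H. g - B \<in> L k})" using T a by (intro good_union) auto
      moreover have "(\<Union>B\<in>T. {g \<in> H. g - B \<in> L k}) = H" using T by auto
      ultimately show False using H(2) by simp
    qed
    have good_mono: "good H" if "good H'" "H \<subseteq> H'" for H H'
      using that unfolding good_def by (meson order_trans)
    have "\<exists>B. \<forall>k. (B k \<in> ?S \<and> \<not> good (ball (B k) (int k))) \<and> B (Suc k) - B k \<in> L (int k)"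
    proof (rule dependent_nat_choice)
      have "\<not> good ?S" using no by (simp add: good_def)
      then obtain B where B: "B \<in> ?S" "\<not> good {g \<in> ?S. g - B \<in> L 0}" using split[of ?S 0] by blast
      then show "\<exists>B. B \<in> ?S \<and> \<not> good (ball B (int 0))" by (intro exI[of _ B]) (simp add: ball_def)
      fix B k assume B: "B \<in> ?S \<and> \<not> good (ball B (int k))"
      have "ball B (int k) \<subseteq> ?S" by (auto simp: ball_def)
      then obtain C where C: "C \<in> ball B (int k)" "\<not> good {g \<in> ball B (int k). g - C \<in> L (int (Suc k))}"
        using split[of "ball B (int k)" "int (Suc k)"] B by blast
      have "\<not> good (ball C (int (Suc k)))"
        using good_mono[of "ball C (int (Suc k))" "{g \<in> ball B (int k). g - C \<in> L (int (Suc k))}"] C(2)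
        by (auto simp: ball_def)
      then show "\<exists>C. (C \<in> ?S \<and> \<not> good (ball C (int (Suc k)))) \<and> C - B \<in> L (int k)"
        using C(1) by (intro exI[of _ C]) (auto simp: ball_def)
    qed
    then obtain B where B: "\<And>k. B k \<in> ?S" "\<And>k. \<not> good (ball (B k) (int k))" "\<And>k. B (Suc k) - B k \<in> L (int k)"
      by blast
    obtain M where M: "\<forall>k. \<exists>N. \<forall>i\<ge>N. B i - M \<in> L k" using Cauchy_matrices[of B] B(3) by blast
    have "M \<in> ?S"
    proof -
      \<comment> \<open>Precision 1 - n makes the inverse of \<open>B i\<close> times M congruent to
        1, so that M is invertible; precision 0 keeps M integral.\<close>
      obtain i where i: "B i - M \<in> L (max 0 (1 - n))" using M by blast
      then have i': "M - B i \<in> L 0" "M - B i \<in> L (1 - n)" using L_mono[of "M - B i" _ 0] L_mono[of "M - B i" _ "1 - n"]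
        L_diff_commute by auto
      have Bi: "B i \<in> GL3" "B i \<in> L 0" "matrix_inv (B i) \<in> L n" using B(1)[of i] by auto
      let ?u = "matrix_inv (B i) ** M"
      have "?u - mat 1 = matrix_inv (B i) ** (M - B i)"
        using GL3_inv[OF Bi(1)] by (simp add: matrix_diff_ldistrib)
      then have u: "?u \<in> K" using near_one_K[of ?u] L_mult[OF Bi(3) i'(2)] by simp
      have Mu: "M = B i ** ?u" using GL3_inv_cancel(1)[OF Bi(1)] by simp
      have "M \<in> GL3" using GL3_mult[OF Bi(1) K_GL3[OF u]] unfolding GL3_inv_cancel(1)[OF Bi(1)] .
      moreover have "M \<in> L 0" using L_add[OF i'(1) Bi(2)] by simp
      moreover have "matrix_inv (B i ** ?u) = matrix_inv ?u ** matrix_inv (B i)"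
        by (rule matrix_inv_mult[OF Bi(1) K_GL3[OF u]])
      then have "matrix_inv M \<in> L n"
        using K_L_left[OF K_inv[OF u], of "matrix_inv (B i)" n] Bi(3) Mu by simp
      ultimately show ?thesis by blast
    qed
    then obtain U where U: "U \<in> \<U>" "M \<in> U" using \<U> by blast
    then obtain k where k: "\<forall>h. h - M \<in> L k \<longrightarrow> h \<in> U" using \<U> unfolding openin_GL3 by meson
    obtain N where N: "\<forall>i\<ge>N. B i - M \<in> L k" using M by blast
    define i where "i = max N (nat k)"
    have "ball (B i) (int i) \<subseteq> U"
    proof
      fix h assume "h \<in> ball (B i) (int i)"
      then have "h - B i \<in> L k" by (auto simp: ball_def i_def intro: L_mono)
      moreover have "B i - M \<in> L k" using N by (simp add: i_def)
      ultimately have "h - M \<in> L k" by (rule L_diff_trans)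
      then show "h \<in> U" using k by simp
    qed
    then have "good (ball (B i) (int i))" unfolding good_def using U(1) by (intro exI[of _ "{U}"]) simp
    then show False using B(2) by blast
  qed
qed

text \<open>The sets of matrices that have, together with their inverses, denominators at most
  \<pi>^n are open and exhaust the group.\<close>

lemma compactin_imp_bounded:
  assumes "compactin (GL3_topology v) C"
  shows "\<exists>n. \<forall>g\<in>C. g \<in> L (- int n) \<and> matrix_inv g \<in> L (- int n)"
proof -
  define U where "U n = {g \<in> GL3. g \<in> L (- int n) \<and> matrix_inv g \<in> L (- int n)}" for n
  have "openin (GL3_topology v) (U n)" for n
    unfolding openin_GL3
  proof (intro conjI ballI)
    fix g assume "g \<in> U n"
    then have g: "g \<in> GL3" "g \<in> L (- int n)" "matrix_inv g \<in> L (- int n)" by (auto simp: U_def)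
    obtain N where N: "\<forall>h. h - g \<in> L N \<longrightarrow> matrix_inv g ** h - mat 1 \<in> L 1" using GL3_near[OF g(1), of 1] by meson
    have "h \<in> U n" if h: "h - g \<in> L N" for h
    proof -
      let ?u = "matrix_inv g ** h"
      have u: "?u \<in> K" using N h near_one_K by blast
      have hu: "g ** ?u = h" by (rule GL3_inv_cancel(1)[OF g(1)])
      have "matrix_inv (g ** ?u) = matrix_inv ?u ** matrix_inv g" by (rule matrix_inv_mult[OF g(1) K_GL3[OF u]])
      then have "matrix_inv h \<in> L (- int n)" using K_L_left[OF K_inv[OF u]] g(3) hu by simp
      moreover have "g ** ?u \<in> L (- int n)" using K_L_right[OF u] g(2) by simp
      moreover have "g ** ?u \<in> GL3" using GL3_mult[OF g(1) K_GL3[OF u]] .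
      ultimately show ?thesis unfolding hu by (simp add: U_def)
    qed
    then show "\<exists>N. \<forall>h. h - g \<in> L N \<longrightarrow> h \<in> U n" by blast
  qed (auto simp: U_def)
  moreover have "C \<subseteq> (\<Union>n. U n)"
  proof
    fix g assume "g \<in> C"
    then have g: "g \<in> GL3" using compactin_subset_topspace[OF assms] by (auto simp: topspace_GL3)
    obtain a b where "g \<in> L a" "matrix_inv g \<in> L b" using L_exists by meson
    then have "g \<in> U (nat (- a) + nat (- b))" using g by (auto simp: U_def intro: L_mono)
    then show "g \<in> (\<Union>n. U n)" by blast
  qed
  ultimately obtain \<F> where \<F>: "finite \<F>" "\<F> \<subseteq> range U" "C \<subseteq> \<Union>\<F>"
    using assms unfolding compactin_def by (metis (no_types, lifting) image_iff)
  then obtain S where S: "finite S" "\<F> = U ` S" using finite_subset_image by metis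
  have "g \<in> L (- int (Max (insert 0 S))) \<and> matrix_inv g \<in> L (- int (Max (insert 0 S)))" if "g \<in> C" for g
  proof -
    from subsetD[OF \<F>(3) that] obtain n where n: "n \<in> S" "g \<in> U n" unfolding S(2) by auto
    then have "n \<le> Max (insert 0 S)" using S(1) by simp
    then show ?thesis using n(2) by (auto simp: U_def intro: L_mono)
  qed
  then show ?thesis by blast
qed

end

section \<open>Compact induction\<close>

lemma right_translation_mult:
  "right_translation g (right_translation h f) = right_translation (g ** h) f"
  by (simp add: right_translation_def matrix_mul_assoc)

lemma right_translation_one [simp]: "right_translation (mat 1) f = f"
  by (simp add: right_translation_def)

context uniformized_field
begin

lemma bounded_height_GL3: "bounded_height n g \<Longrightarrow> g \<in> GL3"
  by (simp add: bounded_height_def)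

lemma bounded_height_mono: "bounded_height n g \<Longrightarrow> n \<le> n' \<Longrightarrow> bounded_height n' g"
  unfolding bounded_height_def using L_mono[of "matrix_inv g" "- n - _" "- n' - _"] by auto

lemma bounded_height_mult:
  assumes "bounded_height n g" "bounded_height n' h"
  shows "bounded_height (n + n') (g ** h)"
proof -
  obtain a b where ab: "g \<in> L a" "matrix_inv g \<in> L (- n - a)" "h \<in> L b" "matrix_inv h \<in> L (- n' - b)"
    using assms unfolding bounded_height_def by blast
  have "matrix_inv (g ** h) \<in> L ((- n' - b) + (- n - a))"
    using matrix_inv_mult[of g h] assms[THEN bounded_height_GL3] L_mult[OF ab(4,2)] by simp
  moreover have "(- n' - b) + (- n - a) = - (n + n') - (a + b)" by simp
  ultimately show ?thesis
    using L_mult[OF ab(1,3)] GL3_mult assms[THEN bounded_height_GL3] unfolding bounded_height_def by metis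
qed

lemma bounded_height_K: "k \<in> K \<Longrightarrow> bounded_height 0 k"
  unfolding bounded_height_def K_iff by (auto intro!: exI[of _ 0])

lemma bounded_height_scalar: "c \<noteq> 0 \<Longrightarrow> bounded_height 0 (mat c)"
  unfolding bounded_height_def
  by (auto simp: GL3_scalar matrix_inv_scalar L_iff mat_nth frac_ideal_def v_inverse intro!: exI[of _ "v c"])

lemma bounded_height_exists: "g \<in> GL3 \<Longrightarrow> \<exists>n. bounded_height n g"
proof -
  assume g: "g \<in> GL3"
  obtain a b where ab: "g \<in> L a" "matrix_inv g \<in> L b" using L_exists by meson
  have "b = - (- a - b) - a" by simp
  then show ?thesis using ab g unfolding bounded_height_def by metis
qed

lemma bounded_height_normal_form:
  assumes "bounded_height n g"
  obtains c r where "g = c ** mat (\<pi> powi r)" "c \<in> GL3" "c \<in> L 0" "matrix_inv c \<in> L (- n)"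
proof -
  obtain a where a: "g \<in> GL3" "g \<in> L a" "matrix_inv g \<in> L (- n - a)"
    using assms unfolding bounded_height_def by blast
  define c where "c = g ** mat (\<pi> powi (- a))"
  have z: "(mat (\<pi> powi (- a)) :: 'f ^ 3 ^ 3) \<in> GL3" by (rule GL3_scalar) simp
  have p: "inverse (\<pi> powi (- a)) = \<pi> powi a" by (simp add: power_int_minus)
  show thesis
  proof
    show "g = c ** mat (\<pi> powi a)"
      unfolding c_def matrix_mul_assoc[symmetric] mat_mat_mult by (simp add: power_int_minus)
    show "c \<in> GL3" unfolding c_def by (rule GL3_mult[OF a(1) z])
    show "c \<in> L 0" using L_scalar[of "\<pi> powi (- a)" "- a" g a] a(2) by (simp add: c_def pi_powi_D)
    have "matrix_inv c = matrix_inv g ** mat (\<pi> powi a)"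
      unfolding c_def matrix_inv_mult[OF a(1) z] using matrix_inv_scalar[of "\<pi> powi (- a)"]
      by (simp add: p mat_scalar_commute)
    then show "matrix_inv c \<in> L (- n)" using L_scalar[of "\<pi> powi a" a "matrix_inv g" "- n - a"] a(3) by (simp add: pi_powi_D)
  qed
qed

text \<open>Translates the support condition into lattices: modulo scalars, the matrices of height
  at most n are integral with inverse in \<open>L (- n)\<close>, and these form a compact
  set.\<close>

lemma compact_support_iff:
  fixes f :: "'f ^ 3 ^ 3 \<Rightarrow> 'a::zero"
  assumes "\<And>g. g \<notin> GL3 \<Longrightarrow> f g = 0"
  shows "(\<exists>C. compactin (GL3_topology v) C \<and> {g \<in> GL3. f g \<noteq> 0} \<subseteq> times_center C)
    \<longleftrightarrow> (\<exists>n. \<forall>g. f g \<noteq> 0 \<longrightarrow> bounded_height n g)"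
proof
  assume "\<exists>C. compactin (GL3_topology v) C \<and> {g \<in> GL3. f g \<noteq> 0} \<subseteq> times_center C"
  then obtain C where C: "compactin (GL3_topology v) C" "{g \<in> GL3. f g \<noteq> 0} \<subseteq> times_center C" by blast
  obtain n where n: "\<forall>g\<in>C. g \<in> L (- int n) \<and> matrix_inv g \<in> L (- int n)"
    using compactin_imp_bounded[OF C(1)] by blast
  have "bounded_height (2 * int n + 0) g" if "f g \<noteq> 0" for g
  proof -
    have "g \<in> times_center C" using assms that C(2) by blast
    then obtain h c where hc: "g = h ** mat c" "h \<in> C" "c \<noteq> 0" by (auto simp: times_center_def)
    have "h \<in> GL3" using compactin_subset_topspace[OF C(1)] hc(2) by (auto simp: topspace_GL3)
    then have "bounded_height (2 * int n) h" using n hc(2) unfolding bounded_height_def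
      by (auto intro!: exI[of _ "- int n"])
    then show ?thesis unfolding hc(1) by (rule bounded_height_mult[OF _ bounded_height_scalar[OF hc(3)]])
  qed
  then show "\<exists>n. \<forall>g. f g \<noteq> 0 \<longrightarrow> bounded_height n g" by blast
next
  assume "\<exists>n. \<forall>g. f g \<noteq> 0 \<longrightarrow> bounded_height n g"
  then obtain n where n: "\<forall>g. f g \<noteq> 0 \<longrightarrow> bounded_height n g" by blast
  have "g \<in> times_center {g \<in> GL3. g \<in> L 0 \<and> matrix_inv g \<in> L (- n)}" if g: "f g \<noteq> 0" for g
  proof -
    from n g have "bounded_height n g" by blast
    then obtain c r where c: "g = c ** mat (\<pi> powi r)" "c \<in> GL3" "c \<in> L 0" "matrix_inv c \<in> L (- n)"
      by (rule bounded_height_normal_form)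
    then show ?thesis unfolding times_center_def mem_Collect_eq
      by (intro exI[of _ c] exI[of _ "\<pi> powi r"]) simp
  qed
  then show "\<exists>C. compactin (GL3_topology v) C \<and> {g \<in> GL3. f g \<noteq> 0} \<subseteq> times_center C"
    using compactin_bounded[of "- n"] by (intro exI[of _ "{g \<in> GL3. g \<in> L 0 \<and> matrix_inv g \<in> L (- n)}"]) blast
qed

lemma compact_induction_iff:
  "f \<in> compact_induction v H \<tau> \<longleftrightarrow> (\<forall>g. g \<notin> GL3 \<longrightarrow> f g = 0) \<and> locally_constant f \<and>
    (\<exists>n. \<forall>g. f g \<noteq> 0 \<longrightarrow> bounded_height n g) \<and> (\<forall>h\<in>H. \<forall>g\<in>GL3. f (h ** g) = \<tau> h (f g))"
  unfolding compact_induction_def mem_Collect_eq continuous_map_discrete_iff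
  using compact_support_iff[of f] by blast

lemma compact_induction_translate:
  assumes f: "f \<in> compact_induction v H \<tau>" and g: "g \<in> GL3"
  shows "right_translation g f \<in> compact_induction v H \<tau>"
proof -
  note F = f[unfolded compact_induction_iff]
  from F obtain n where n: "\<forall>g. f g \<noteq> 0 \<longrightarrow> bounded_height n g" by blast
  obtain n' where n': "bounded_height n' (matrix_inv g)" using bounded_height_exists GL3_inv(3)[OF g] by blast
  have "bounded_height (n + n') x" if "f (x ** g) \<noteq> 0" for x
    using bounded_height_mult[OF n[rule_format, OF that] n'] GL3_inv_cancel(3)[OF g] by simp
  moreover have "locally_constant (\<lambda>x. f (mat 1 ** x ** g))"
    using F g by (intro locally_constant_translate) auto
  moreover have "f (x ** g) = 0" if "x \<notin> GL3" for x
    using F GL3_mult_right_iff[OF g] that by simp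
  moreover have "f (h ** x ** g) = \<tau> h (f (x ** g))" if "h \<in> H" "x \<in> GL3" for h x
  proof -
    have "f (h ** (x ** g)) = \<tau> h (f (x ** g))" using F that GL3_mult[OF that(2) g] by blast
    then show ?thesis by (simp add: matrix_mul_assoc)
  qed
  ultimately show ?thesis unfolding compact_induction_iff right_translation_def by auto
qed

lemma compact_induction_subspace:
  assumes "vector_space smul" and add: "\<And>h x y. h \<in> H \<Longrightarrow> \<tau> h (x + y) = \<tau> h x + \<tau> h y"
    and scale: "\<And>h c x. h \<in> H \<Longrightarrow> \<tau> h (smul c x) = smul c (\<tau> h x)"
  shows "module.subspace (fun_scale smul) (compact_induction v H \<tau>)"
proof -
  interpret vector_space smul by fact
  interpret F: vector_space "fun_scale smul :: _ \<Rightarrow> ('f ^ 3 ^ 3 \<Rightarrow> _) \<Rightarrow> _"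
    by (rule vector_space_fun_scale[OF assms(1)])
  show ?thesis
  proof (rule F.subspaceI)
    have "\<tau> h 0 = 0" if "h \<in> H" for h using add[OF that, of 0 0] by simp
    then show "0 \<in> compact_induction v H \<tau>"
      unfolding compact_induction_iff zero_fun_def by (auto simp: locally_constant_const)
    fix x y c assume x: "x \<in> compact_induction v H \<tau>"
    note x' = x[unfolded compact_induction_iff]
    show "fun_scale smul c x \<in> compact_induction v H \<tau>"
      unfolding compact_induction_iff fun_scale_def
      using x' scale locally_constant_compose[of x "smul c"] by auto
    assume y: "y \<in> compact_induction v H \<tau>"
    note y' = y[unfolded compact_induction_iff]
    from x' y' obtain n n' where n: "\<forall>g. x g \<noteq> 0 \<longrightarrow> bounded_height n g" "\<forall>g. y g \<noteq> 0 \<longrightarrow> bounded_height n' g"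
      by blast
    have "bounded_height (max n n') g" if "x g + y g \<noteq> 0" for g
    proof (cases "x g = 0")
      case True
      then have "y g \<noteq> 0" using that by simp
      then show ?thesis using n(2) bounded_height_mono[of n' g "max n n'"] by simp
    next
      case False
      then show ?thesis using n(1) bounded_height_mono[of n g "max n n'"] by simp
    qed
    then have "\<exists>n. \<forall>g. x g + y g \<noteq> 0 \<longrightarrow> bounded_height n g" by blast
    moreover have "locally_constant (\<lambda>g. x g + y g)"
      using x' y' locally_constant_compose2[of x y "(+)"] by simp
    ultimately show "x + y \<in> compact_induction v H \<tau>"
      unfolding compact_induction_iff plus_fun_def using x' y' add by simp
  qed
qed

lemma unit_scalar_Iw: "u \<noteq> 0 \<Longrightarrow> v u = 0 \<Longrightarrow> mat u \<in> Iw"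
proof -
  assume u: "u \<noteq> 0" "v u = 0"
  have "(mat u :: 'f ^ 3 ^ 3) \<in> K"
    using u by (intro K_I[of "mat u" "mat (inverse u)"])
      (auto simp: mat_mat_mult L_iff mat_nth frac_ideal_def v_inverse)
  then show ?thesis using K_L0 by (simp add: Iw_iff J0_iff mat_nth)
qed

text \<open>A scalar is a unit times a power of the uniformizer, and unit scalars lie in the Iwahori
  subgroup, so they are absorbed into \<open>H\<close>. The result has the shape on which
  \<open>extend_trivially\<close> computes.\<close>

lemma times_center_cases:
  assumes "g \<in> times_center H" "\<And>h u. h \<in> H \<Longrightarrow> u \<in> Iw \<Longrightarrow> h ** u \<in> H"
  obtains h n where "h \<in> H" "g = h ** mat (\<pi> powi n)"
proof -
  obtain h c where hc: "h \<in> H" "c \<noteq> 0" "g = h ** mat c" using assms(1) by (auto simp: times_center_def)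
  define u where "u = c * \<pi> powi (- v c)"
  have "u \<noteq> 0" "v u = 0" using hc by (simp_all add: u_def v_mult v_powi v_pi)
  then have "h ** mat u \<in> H" using assms(2) hc(1) unit_scalar_Iw by blast
  moreover have "u * \<pi> powi (v c) = c" by (simp add: u_def power_int_minus)
  then have "g = h ** mat u ** mat (\<pi> powi (v c))"
    unfolding hc(3) matrix_mul_assoc[symmetric] mat_mat_mult by simp
  ultimately show thesis by (rule that)
qed

lemma times_centerI: "h \<in> H \<Longrightarrow> h ** mat (\<pi> powi n) \<in> times_center H"
  unfolding times_center_def mem_Collect_eq by (intro exI conjI) (rule HOL.refl, simp_all)

lemma scalar_mult_swap:
  "((h :: 'f ^ 3 ^ 3) ** mat c) ** (h' ** mat d) = (h ** h' :: 'f ^ 3 ^ 3) ** mat (c * d)"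
proof -
  have "(h ** mat c) ** (h' ** mat d) = h ** (mat c ** h') ** mat d" by (simp add: matrix_mul_assoc)
  also have "\<dots> = h ** h' ** (mat c ** mat d)" unfolding mat_scalar_commute[of c h'] by (simp only: matrix_mul_assoc)
  finally show ?thesis by (simp only: mat_mat_mult)
qed

section \<open>The groups KZ and IZ and their cosets\<close>

abbreviation "KZ \<equiv> times_center (GL3_int v)"
abbreviation "IZ \<equiv> times_center (iwahori v)"

lemma KZ_cases:
  assumes "g \<in> KZ" obtains h n where "h \<in> K" "g = h ** mat (\<pi> powi n)"
  using times_center_cases[OF assms] K_mult Iw_K by metis

lemma IZ_cases:
  assumes "g \<in> IZ" obtains h n where "h \<in> Iw" "g = h ** mat (\<pi> powi n)"
  using times_center_cases[OF assms] Iw_mult by metis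

lemma IZ_KZ: "g \<in> IZ \<Longrightarrow> g \<in> KZ"
  using Iw_K by (auto simp: times_center_def)

lemma KZ_GL3: "g \<in> KZ \<Longrightarrow> g \<in> GL3"
  using K_GL3 GL3_mult GL3_scalar by (auto simp: times_center_def)

lemma IZ_GL3: "g \<in> IZ \<Longrightarrow> g \<in> GL3"
  using IZ_KZ KZ_GL3 by blast

lemma KZ_bounded: "g \<in> KZ \<Longrightarrow> bounded_height 0 g"
  using bounded_height_mult[OF bounded_height_K bounded_height_scalar] by (auto simp: times_center_def)

lemma IZ_mult: "g \<in> IZ \<Longrightarrow> h \<in> IZ \<Longrightarrow> g ** h \<in> IZ"
proof -
  assume "g \<in> IZ" "h \<in> IZ"
  then obtain a c b d where "a \<in> Iw" "c \<noteq> 0" "g = a ** mat c" "b \<in> Iw" "d \<noteq> 0" "h = b ** mat d"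
    by (auto simp: times_center_def)
  then have "g ** h = (a ** b) ** mat (c * d)" "a ** b \<in> Iw" "c * d \<noteq> 0"
    by (simp_all add: scalar_mult_swap Iw_mult)
  then show ?thesis unfolding times_center_def by blast
qed

lemma IZ_inv: "g \<in> IZ \<Longrightarrow> matrix_inv g \<in> IZ"
proof -
  assume "g \<in> IZ"
  then obtain h c where hc: "h \<in> Iw" "c \<noteq> 0" "g = h ** mat c" by (auto simp: times_center_def)
  have "matrix_inv g = matrix_inv h ** mat (inverse c)"
    unfolding hc(3) matrix_inv_mult[OF K_GL3[OF Iw_K[OF hc(1)]] GL3_scalar[OF hc(2)]]
    using matrix_inv_scalar[OF hc(2)] by (simp add: mat_scalar_commute)
  then show ?thesis using Iw_inv[OF hc(1)] hc(2) unfolding times_center_def mem_Collect_eq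
    by (intro exI[of _ "matrix_inv h"] exI[of _ "inverse c"]) simp
qed

lemma Iw_IZ: "g \<in> Iw \<Longrightarrow> g \<in> IZ"
  using times_centerI[of g Iw 0] by simp

lemma K_KZ: "g \<in> K \<Longrightarrow> g \<in> KZ"
  using times_centerI[of g K 0] by simp

definition IZ_coset :: "'f ^ 3 ^ 3 \<Rightarrow> ('f ^ 3 ^ 3) set" where
  "IZ_coset g = (\<lambda>h. h ** g) ` IZ"

lemma IZ_coset_eq_iff:
  assumes "g \<in> GL3" "g' \<in> GL3"
  shows "IZ_coset g = IZ_coset g' \<longleftrightarrow> g' ** matrix_inv g \<in> IZ"
proof
  assume "IZ_coset g = IZ_coset g'"
  moreover have "g' \<in> IZ_coset g'" unfolding IZ_coset_def using Iw_IZ[OF Iw_one] by (intro image_eqI[of _ _ "mat 1"]) simp_all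
  ultimately obtain h where "h \<in> IZ" "g' = h ** g" by (auto simp: IZ_coset_def)
  then show "g' ** matrix_inv g \<in> IZ" using GL3_inv_cancel(3)[OF assms(1)] by simp
next
  assume h: "g' ** matrix_inv g \<in> IZ" (is "?h \<in> _")
  have g': "g' = ?h ** g" "g = matrix_inv ?h ** g'"
    using GL3_inv_cancel(4)[OF assms(1)] GL3_inv_cancel(2)[OF IZ_GL3[OF h], of g] by simp_all
  show "IZ_coset g = IZ_coset g'"
  proof (intro equalityI subsetI)
    fix x assume "x \<in> IZ_coset g"
    then obtain y where "y \<in> IZ" "x = y ** g" by (auto simp: IZ_coset_def)
    then have "x = (y ** matrix_inv ?h) ** g'" "y ** matrix_inv ?h \<in> IZ"
      using g'(2) IZ_mult IZ_inv[OF h] by (simp_all add: matrix_mul_assoc[symmetric])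
    then show "x \<in> IZ_coset g'" unfolding IZ_coset_def by blast
  next
    fix x assume "x \<in> IZ_coset g'"
    then obtain y where "y \<in> IZ" "x = y ** g'" by (auto simp: IZ_coset_def)
    then have "x = (y ** ?h) ** g" "y ** ?h \<in> IZ"
      using g'(1) IZ_mult h by (simp_all add: matrix_mul_assoc[symmetric])
    then show "x \<in> IZ_coset g" unfolding IZ_coset_def by blast
  qed
qed

lemma IZ_coset_mult: "h \<in> IZ \<Longrightarrow> g \<in> GL3 \<Longrightarrow> IZ_coset (h ** g) = IZ_coset g"
  using IZ_coset_eq_iff[of g "h ** g"] GL3_mult[OF IZ_GL3] GL3_inv_cancel(3)[of g h] by metis

text \<open>Modulo scalars the matrices are integral with inverses in \<open>L (- n)\<close>. Two of
  them that agree modulo \<open>L (n + 1)\<close> differ by a left factor congruent to 1, which lies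
  in the Iwahori subgroup.\<close>

lemma finite_IZ_cosets: "finite (IZ_coset ` {g. bounded_height n g})"
proof -
  let ?C = "{g \<in> GL3. g \<in> L 0 \<and> matrix_inv g \<in> L (- n)}"
  have "?C \<subseteq> L 0" by blast
  from finite_L_quotient[OF this, of "n + 1"]
  obtain S where S: "finite S" "S \<subseteq> ?C" "\<forall>g\<in>?C. \<exists>s\<in>S. g - s \<in> L (n + 1)" by meson
  have "IZ_coset g \<in> IZ_coset ` S" if g: "bounded_height n g" for g
  proof -
    obtain c r where c: "g = c ** mat (\<pi> powi r)" "c \<in> GL3" "c \<in> L 0" "matrix_inv c \<in> L (- n)"
      using bounded_height_normal_form[OF g] .
    then obtain s where s: "s \<in> S" "c - s \<in> L (n + 1)" using S(3) by blast
    have sG: "s \<in> GL3" "matrix_inv s \<in> L (- n)" using s(1) S(2) by blast+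
    have "c ** matrix_inv s - mat 1 = (c - s) ** matrix_inv s"
      using GL3_inv[OF sG(1)] by (simp add: matrix_diff_rdistrib)
    then have near: "c ** matrix_inv s - mat 1 \<in> L 1" using L_mult[OF s(2) sG(2)] by simp
    then have "c ** matrix_inv s \<in> Iwr 1"
      using near_one_K L_subset_J[of 1] by (auto simp: Iwr_def)
    then have cs: "c ** matrix_inv s \<in> IZ" using Iwr_Iw Iw_IZ by auto
    have "c = (c ** matrix_inv s) ** s" using GL3_inv_cancel(4)[OF sG(1)] by simp
    then have "IZ_coset c = IZ_coset s" using IZ_coset_mult[OF cs sG(1)] by simp
    moreover have "g = mat (\<pi> powi r) ** c" using c(1) by (simp add: mat_scalar_commute)
    moreover have "mat (\<pi> powi r) \<in> IZ" using times_centerI[OF Iw_one, of r] by simp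
    ultimately show ?thesis using IZ_coset_mult[of "mat (\<pi> powi r)" c] c(2) s(1) by simp
  qed
  then show ?thesis using S(1) by (meson finite_surj image_subsetI mem_Collect_eq)
qed

end

section \<open>Frobenius reciprocity\<close>

locale weight_line = weight v \<pi> smul \<sigma>
  for v :: "'f::field \<Rightarrow> int" and \<pi> :: 'f
    and smul :: "'k::alg_closed_field \<Rightarrow> 'v::ab_group_add \<Rightarrow> 'v" and \<sigma> :: "'f ^ 3 ^ 3 \<Rightarrow> 'v \<Rightarrow> 'v" +
  fixes m :: 'v and \<phi> :: "'v \<Rightarrow> 'k"
  assumes m_heig: "heig m" and inv1_line: "inv1 = range (\<lambda>c. smul c m)"
    and \<phi>_low: "lowfun \<phi>" and \<phi>_m: "\<phi> m = 1"
begin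

lemma m_nonzero: "m \<noteq> 0" and m_eig: "eig m" and m_inv1: "m \<in> inv1"
  using m_heig by (auto simp: heig_def eig_def)

lemma invariant_character: "g \<in> Iw \<Longrightarrow> \<sigma> g m = smul (invariant_character v smul \<sigma> g) m"
proof -
  assume g: "g \<in> Iw"
  obtain c where c: "\<sigma> g m = smul c m" using m_eig g by (auto simp: eig_def)
  have "invariant_character v smul \<sigma> g = c"
    unfolding invariant_character_def inv1_eq[symmetric]
  proof (rule the_equality)
    show "\<forall>w\<in>inv1. \<sigma> g w = smul c w"
      unfolding inv1_line using c sg_scale[OF Iw_K[OF g]] by (auto simp: mult.commute)
    show "d = c" if "\<forall>w\<in>inv1. \<sigma> g w = smul d w" for d
      using that m_inv1 c m_nonzero by auto
  qed
  then show ?thesis using c by simp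
qed

definition ext :: "'f ^ 3 ^ 3 \<Rightarrow> 'v \<Rightarrow> 'v" where
  "ext = extend_trivially \<pi> (GL3_int v) \<sigma>"

definition chi :: "'f ^ 3 ^ 3 \<Rightarrow> 'k" where
  "chi = extend_trivially \<pi> (iwahori v) (invariant_character v smul \<sigma>)"

lemma ext_eq: "k \<in> K \<Longrightarrow> ext (k ** mat (\<pi> powi n)) = \<sigma> k"
  unfolding ext_def using extend_trivially_eq[OF nonarch_local_field_axioms pi] by blast

lemma chi_eq: "g \<in> Iw \<Longrightarrow> chi (g ** mat (\<pi> powi n)) = invariant_character v smul \<sigma> g"
  unfolding chi_def using extend_trivially_eq[OF nonarch_local_field_axioms pi] Iw_K by blast

lemma ext_K: "k \<in> K \<Longrightarrow> ext k = \<sigma> k"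
  using ext_eq[of k 0] by simp

lemma ext_mult: "g \<in> KZ \<Longrightarrow> h \<in> KZ \<Longrightarrow> ext (g ** h) w = ext g (ext h w)"
proof -
  assume "g \<in> KZ" "h \<in> KZ"
  then obtain a i b j where a: "a \<in> K" "g = a ** mat (\<pi> powi i)" and b: "b \<in> K" "h = b ** mat (\<pi> powi j)"
    using KZ_cases by metis
  have "g ** h = (a ** b) ** mat (\<pi> powi (i + j))"
    unfolding a(2) b(2) scalar_mult_swap by (simp add: power_int_add)
  then show ?thesis using a b by (simp add: ext_eq K_mult sg_mult)
qed

lemma ext_add: "g \<in> KZ \<Longrightarrow> ext g (x + y) = ext g x + ext g y"
  by (rule KZ_cases) (auto simp: ext_eq sg_add)

lemma ext_scale: "g \<in> KZ \<Longrightarrow> ext g (smul c x) = smul c (ext g x)"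
  by (rule KZ_cases) (auto simp: ext_eq sg_scale)

lemma ext_zero: "g \<in> KZ \<Longrightarrow> ext g 0 = 0"
  by (rule KZ_cases) (auto simp: ext_eq sg_zero)

lemma ext_m: "g \<in> IZ \<Longrightarrow> ext g m = smul (chi g) m"
  by (rule IZ_cases) (auto simp: ext_eq chi_eq Iw_K invariant_character)

text \<open>The character is given only by a definite description; its multiplicativity is inherited
  from the action on the nonzero vector \<open>m\<close>.\<close>

lemma chi_mult: "g \<in> IZ \<Longrightarrow> h \<in> IZ \<Longrightarrow> chi (g ** h) = chi g * chi h"
proof -
  assume g: "g \<in> IZ" "h \<in> IZ"
  have "smul (chi (g ** h)) m = ext (g ** h) m" using ext_m[OF IZ_mult[OF g]] by simp
  also have "\<dots> = smul (chi h * chi g) m"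
    using ext_mult[OF g[THEN IZ_KZ], of m] ext_m[OF g(1)] ext_m[OF g(2)] ext_scale[OF IZ_KZ[OF g(1)]] by simp
  finally have "chi (g ** h) = chi h * chi g"
    using m_nonzero V.scale_cancel_right[of "chi (g ** h)" m "chi h * chi g"] by simp
  then show ?thesis by (simp add: mult.commute)
qed

lemma chi_one: "chi (mat 1) = 1"
  using ext_m[OF Iw_IZ[OF Iw_one]] ext_K[of "mat 1"] m_nonzero V.scale_right_imp_eq[of m "chi (mat 1)" 1] by simp

lemma chi_inv: "h \<in> IZ \<Longrightarrow> chi (matrix_inv h) * chi h = 1" "h \<in> IZ \<Longrightarrow> chi h * chi (matrix_inv h) = 1"
  using chi_mult[OF IZ_inv, of h h] chi_mult[OF _ IZ_inv, of h h] GL3_inv[OF IZ_GL3] chi_one by auto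

lemma chi_near_one: "u \<in> Iwr 1 \<Longrightarrow> chi u = 1"
proof -
  assume u: "u \<in> Iwr 1"
  have "smul (chi u) m = \<sigma> u m" using ext_m[OF Iw_IZ[OF Iwr_Iw[OF u]]] ext_K[OF Iwr_K[OF u]] by simp
  also have "\<dots> = smul 1 m" using inv1_D[OF m_inv1 u] by simp
  finally show ?thesis using m_nonzero V.scale_cancel_right[of "chi u" m 1] by simp
qed

definition W :: "('f ^ 3 ^ 3 \<Rightarrow> 'v) set" where "W = ind_KZ v \<pi> \<sigma>"

definition F :: "('f ^ 3 ^ 3 \<Rightarrow> 'k) set" where "F = ind_IZ v chi"

lemma W_iff: "f \<in> W \<longleftrightarrow> (\<forall>g. g \<notin> GL3 \<longrightarrow> f g = 0) \<and> locally_constant f \<and>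
    (\<exists>n. \<forall>g. f g \<noteq> 0 \<longrightarrow> bounded_height n g) \<and> (\<forall>h\<in>KZ. \<forall>g\<in>GL3. f (h ** g) = ext h (f g))"
  unfolding W_def ind_KZ_def ext_def[symmetric] by (rule compact_induction_iff)

lemma F_iff: "f \<in> F \<longleftrightarrow> (\<forall>g. g \<notin> GL3 \<longrightarrow> f g = 0) \<and> locally_constant f \<and>
    (\<exists>n. \<forall>g. f g \<noteq> 0 \<longrightarrow> bounded_height n g) \<and> (\<forall>h\<in>IZ. \<forall>g\<in>GL3. f (h ** g) = chi h * f g)"
  unfolding F_def ind_IZ_def by (rule compact_induction_iff)

lemma W_translate: "f \<in> W \<Longrightarrow> g \<in> GL3 \<Longrightarrow> right_translation g f \<in> W"
  unfolding W_def ind_KZ_def by (rule compact_induction_translate)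

lemma F_translate: "f \<in> F \<Longrightarrow> g \<in> GL3 \<Longrightarrow> right_translation g f \<in> F"
  unfolding F_def ind_IZ_def by (rule compact_induction_translate)

sublocale WV: vector_space "fun_scale smul :: 'k \<Rightarrow> ('f ^ 3 ^ 3 \<Rightarrow> 'v) \<Rightarrow> 'f ^ 3 ^ 3 \<Rightarrow> 'v"
  by (rule vector_space_fun_scale[OF V.vector_space_axioms])

sublocale FV: vector_space "fun_scale (*) :: 'k \<Rightarrow> ('f ^ 3 ^ 3 \<Rightarrow> 'k) \<Rightarrow> 'f ^ 3 ^ 3 \<Rightarrow> 'k"
  by (rule vector_space_fun_scale[OF vector_space_over_itself.vector_space_axioms])

lemma W_subspace: "WV.subspace W"
  unfolding W_def ind_KZ_def ext_def[symmetric]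
  by (rule compact_induction_subspace[OF V.vector_space_axioms]) (simp_all add: ext_add ext_scale)

lemma F_subspace: "FV.subspace F"
  unfolding F_def ind_IZ_def
  by (rule compact_induction_subspace[OF vector_space_over_itself.vector_space_axioms]) (simp_all add: algebra_simps)

definition ev :: "'f ^ 3 ^ 3 \<Rightarrow> 'k" where "ev = frobenius_vector v chi"

lemma ev_eq: "ev g = (if g \<in> IZ then chi g else 0)"
  by (simp add: ev_def frobenius_vector_def)

lemma IZ_mult_iff: "h \<in> IZ \<Longrightarrow> h ** g \<in> IZ \<longleftrightarrow> g \<in> IZ" "h \<in> IZ \<Longrightarrow> g ** h \<in> IZ \<longleftrightarrow> g \<in> IZ"
proof -
  assume h: "h \<in> IZ"
  note hG = IZ_GL3[OF h] and hi = IZ_inv[OF h]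
  show "h ** g \<in> IZ \<longleftrightarrow> g \<in> IZ"
    using IZ_mult[OF h, of g] IZ_mult[OF hi, of "h ** g"] unfolding GL3_inv_cancel(2)[OF hG] by blast
  show "g ** h \<in> IZ \<longleftrightarrow> g \<in> IZ"
    using IZ_mult[OF _ h, of g] IZ_mult[OF _ hi, of "g ** h"] unfolding GL3_inv_cancel(3)[OF hG] by blast
qed

lemma ev_right: "h \<in> IZ \<Longrightarrow> ev (g ** h) = chi h * ev g"
  by (simp add: ev_eq IZ_mult_iff chi_mult mult.commute)

lemma ev_F: "ev \<in> F"
proof -
  have "locally_constant ev"
  proof (rule locally_constantI)
    fix g k :: "'f ^ 3 ^ 3" assume "k \<in> K" "k - mat 1 \<in> L 1"
    then have k: "k \<in> Iwr 1" using L_subset_J[of 1] by (auto simp: Iwr_def)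
    then show "ev (g ** k) = ev g" using ev_right[of k g] chi_near_one[OF k] Iw_IZ Iwr_Iw by simp
  qed
  moreover have "\<exists>n. \<forall>g. ev g \<noteq> 0 \<longrightarrow> bounded_height n g"
    using KZ_bounded IZ_KZ by (intro exI[of _ 0]) (auto simp: ev_eq)
  ultimately show ?thesis unfolding F_iff
    using IZ_GL3 IZ_mult_iff(1) chi_mult by (auto simp: ev_eq)
qed

lemma ev_eigen: "h \<in> IZ \<Longrightarrow> right_translation h ev = fun_scale (*) (chi h) ev"
  by (simp add: right_translation_def fun_scale_def ev_right)

definition summand :: "('k \<Rightarrow> 'a \<Rightarrow> 'a) \<Rightarrow> ('f ^ 3 ^ 3 \<Rightarrow> 'a) \<Rightarrow> ('f ^ 3 ^ 3 \<Rightarrow> 'k) \<Rightarrow> 'f ^ 3 ^ 3 \<Rightarrow> 'f ^ 3 ^ 3 \<Rightarrow> 'a" where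
  "summand s w f g = fun_scale s (f g) (right_translation (matrix_inv g) w)"

text \<open>The homomorphism attached to an eigenvector \<open>w\<close> by Frobenius reciprocity: f
  is the sum of f(g) g^-1 \<open>ev\<close> over the cosets IZ g, so its image is the sum of f(g)
  g^-1 w. The scalar action \<open>s\<close> is a parameter so that \<open>w = ev\<close> is covered
  as well.\<close>

definition Phi :: "('k \<Rightarrow> 'a \<Rightarrow> 'a::ab_group_add) \<Rightarrow> ('f ^ 3 ^ 3 \<Rightarrow> 'a) \<Rightarrow> ('f ^ 3 ^ 3 \<Rightarrow> 'k) \<Rightarrow> 'f ^ 3 ^ 3 \<Rightarrow> 'a" where
  "Phi s w f = class_sum IZ_coset GL3 (summand s w f)"

text \<open>The factor \<open>chi h\<close> coming from \<open>f\<close> cancels the factor of the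
  inverse coming from the eigenvector \<open>w\<close>.\<close>

lemma summand_class_function:
  assumes s: "vector_space s" and w: "\<And>h. h \<in> IZ \<Longrightarrow> right_translation h w = fun_scale s (chi h) w" and f: "f \<in> F"
  shows "class_function IZ_coset GL3 (summand s w f)"
  unfolding class_function_def
proof (intro ballI impI)
  fix g g' :: "'f ^ 3 ^ 3" assume g: "g \<in> GL3" "g' \<in> GL3" "IZ_coset g = IZ_coset g'"
  interpret vector_space s by fact
  let ?h = "g' ** matrix_inv g"
  have h: "?h \<in> IZ" using g IZ_coset_eq_iff by blast
  have g': "g' = ?h ** g" using GL3_inv_cancel(4)[OF g(1)] by simp
  have "f (?h ** g) = chi ?h * f g" using f h g(1) unfolding F_iff by blast
  then have fg: "f g' = chi ?h * f g" using g' by simp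
  have "matrix_inv (?h ** g) = matrix_inv g ** matrix_inv ?h" by (rule matrix_inv_mult[OF IZ_GL3[OF h] g(1)])
  then have "right_translation (matrix_inv g') w = right_translation (matrix_inv g) (right_translation (matrix_inv ?h) w)"
    using g' by (simp add: right_translation_mult)
  also have "\<dots> = fun_scale s (chi (matrix_inv ?h)) (right_translation (matrix_inv g) w)"
    unfolding w[OF IZ_inv[OF h]] by (simp add: right_translation_def fun_scale_def)
  finally show "summand s w f g = summand s w f g'"
    unfolding summand_def fg using chi_inv(2)[OF h]
    by (simp add: fun_scale_def fun_eq_iff mult.assoc mult.left_commute[of _ "f g"])
qed

lemma summand_finite:
  assumes "vector_space s" "f \<in> F"
  shows "finite (IZ_coset ` {g \<in> GL3. summand s w f g \<noteq> 0})"
proof -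
  interpret vector_space s by fact
  obtain n where n: "\<And>g. f g \<noteq> 0 \<Longrightarrow> bounded_height n g" using assms(2) unfolding F_iff by blast
  have "f g \<noteq> 0" if "summand s w f g \<noteq> 0" for g
    using that by (auto simp: summand_def fun_scale_def zero_fun_def)
  then have "IZ_coset ` {g \<in> GL3. summand s w f g \<noteq> 0} \<subseteq> IZ_coset ` {g. bounded_height n g}" using n by blast
  then show ?thesis using finite_IZ_cosets finite_subset by blast
qed

lemma Phi_at:
  assumes "vector_space s" "\<And>h. h \<in> IZ \<Longrightarrow> right_translation h w = fun_scale s (chi h) w" "f \<in> F"
  shows "Phi s w f x = class_sum IZ_coset GL3 (\<lambda>g. summand s w f g x)"
  unfolding Phi_def
  by (rule class_sum_hom[OF summand_class_function[OF assms] summand_finite[OF assms(1,3)], of "\<lambda>u. u x", symmetric]) simp_all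

lemma class_sum_zero: "(\<And>x. x \<in> A \<Longrightarrow> G x = 0) \<Longrightarrow> class_sum q A G = 0"
  unfolding class_sum_def by (rule sum.neutral) auto

text \<open>The translates of \<open>ev\<close> span the induced representation, which is the
  uniqueness half of Frobenius reciprocity. At the point x only the coset of x contributes.\<close>

lemma Phi_ev: "f \<in> F \<Longrightarrow> Phi (*) ev f = f"
proof
  fix x assume f: "f \<in> F"
  note vs = vector_space_over_itself.vector_space_axioms
  have t: "summand (*) ev f g x = f g * ev (x ** matrix_inv g)" for g
    by (simp add: summand_def fun_scale_def right_translation_def)
  show "Phi (*) ev f x = f x"
  proof (cases "x \<in> GL3")
    case True
    have "class_sum IZ_coset GL3 (\<lambda>g. summand (*) ev f g x) = summand (*) ev f x x"
    proof (rule class_sum_single[OF _ True])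
      show "class_function IZ_coset GL3 (\<lambda>g. summand (*) ev f g x)"
        using summand_class_function[OF vs ev_eigen f] unfolding class_function_def by metis
      fix g :: "'f ^ 3 ^ 3" assume "g \<in> GL3" "summand (*) ev f g x \<noteq> 0"
      then show "IZ_coset g = IZ_coset x"
        using IZ_coset_eq_iff[OF _ True, of g] unfolding t by (auto simp: ev_eq split: if_splits)
    qed
    then show ?thesis using Phi_at[OF vs ev_eigen f] GL3_inv(1)[OF True] chi_one Iw_IZ[OF Iw_one]
      by (simp add: t ev_eq)
  next
    case False
    have "ev (x ** matrix_inv g) = 0" if "g \<in> GL3" for g
      using False GL3_mult_right_iff[OF GL3_inv(3)[OF that], of x] IZ_GL3 by (auto simp: ev_eq)
    then have "class_sum IZ_coset GL3 (\<lambda>g. summand (*) ev f g x) = 0" by (intro class_sum_zero) (simp add: t)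
    then show ?thesis using Phi_at[OF vs ev_eigen f, of x] f False unfolding F_iff by simp
  qed
qed

definition E :: "('f ^ 3 ^ 3 \<Rightarrow> 'v) set" where
  "E = eigenspace_IZ v chi (fun_scale smul) right_translation W"

lemma E_iff: "w \<in> E \<longleftrightarrow> w \<in> W \<and> (\<forall>h\<in>IZ. right_translation h w = fun_scale smul (chi h) w)"
  by (simp add: E_def eigenspace_IZ_def)

lemma E_eigen: "w \<in> E \<Longrightarrow> h \<in> IZ \<Longrightarrow> right_translation h w = fun_scale smul (chi h) w"
  by (simp add: E_iff)

lemma summand_W: "w \<in> W \<Longrightarrow> g \<in> GL3 \<Longrightarrow> summand smul w f g \<in> W"
  unfolding summand_def using W_translate GL3_inv(3) WV.subspace_scale[OF W_subspace] by blast

lemma Phi_W: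
  assumes "w \<in> W"
  shows "Phi smul w f \<in> W"
  unfolding Phi_def class_sum_def
proof (rule WV.subspace_sum[OF W_subspace])
  fix c assume "c \<in> IZ_coset ` {x \<in> GL3. summand smul w f x \<noteq> 0}"
  then have "c \<in> IZ_coset ` GL3" by blast
  then show "summand smul w f (SOME x. x \<in> GL3 \<and> IZ_coset x = c) \<in> W"
    by (intro summand_W assms class_rep(1))
qed

lemma summand_E:
  assumes "w \<in> E" "f \<in> F"
  shows "class_function IZ_coset GL3 (summand smul w f)"
    "finite (IZ_coset ` {g \<in> GL3. summand smul w f g \<noteq> 0})"
  using summand_class_function[OF V.vector_space_axioms _ assms(2)] E_eigen[OF assms(1)]
    summand_finite[OF V.vector_space_axioms assms(2)] by blast+

lemma Phi_add:
  assumes "w \<in> E" "f \<in> F" "f' \<in> F"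
  shows "Phi smul w (f + f') = Phi smul w f + Phi smul w f'"
proof -
  have eq: "summand smul w (f + f') = (\<lambda>g. summand smul w f g + summand smul w f' g)"
    by (simp add: summand_def fun_scale_def V.scale_left_distrib fun_eq_iff)
  show ?thesis unfolding Phi_def eq
    using class_sum_add[OF summand_E[OF assms(1,2)] summand_E[OF assms(1,3)]] by simp
qed

lemma Phi_scale:
  assumes "w \<in> E" "f \<in> F"
  shows "Phi smul w (fun_scale (*) c f) = fun_scale smul c (Phi smul w f)"
proof -
  note t = summand_E[OF assms(1,2)]
  have eq: "summand smul w (fun_scale (*) c f) = (\<lambda>g. fun_scale smul c (summand smul w f g))"
    by (simp add: summand_def fun_scale_def fun_eq_iff)
  show ?thesis unfolding Phi_def eq
    using class_sum_hom[OF t, of "fun_scale smul c"] by (simp add: WV.scale_right_distrib)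
qed

lemma Phi_translate:
  assumes "w \<in> E" "f \<in> F" "h \<in> GL3"
  shows "Phi smul w (right_translation h f) = right_translation h (Phi smul w f)"
proof -
  note t = summand_E[OF assms(1,2)]
  let ?G = "\<lambda>g. right_translation h (summand smul w f g)"
  have eq: "summand smul w (right_translation h f) g = ?G (g ** h)" if "g \<in> GL3" for g
  proof -
    have "matrix_inv g = h ** matrix_inv (g ** h)"
      unfolding matrix_inv_mult[OF that assms(3)] GL3_inv_cancel(1)[OF assms(3)] ..
    then show ?thesis
      by (simp add: summand_def fun_scale_def right_translation_def matrix_mul_assoc[symmetric])
  qed
  have "Phi smul w (right_translation h f) = class_sum IZ_coset GL3 (\<lambda>g. ?G (g ** h))"
    unfolding Phi_def by (rule class_sum_cong) (rule eq)
  also have "\<dots> = class_sum IZ_coset GL3 ?G"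
  proof (rule class_sum_reindex)
    show "class_function IZ_coset GL3 ?G" using t(1) unfolding class_function_def by metis
    show "g ** h \<in> GL3" if "g \<in> GL3" for g using GL3_mult[OF that assms(3)] .
    show "IZ_coset (x ** h) = IZ_coset (y ** h) \<longleftrightarrow> IZ_coset x = IZ_coset y" if "x \<in> GL3" "y \<in> GL3" for x y
    proof -
      have "y ** h ** (matrix_inv h ** matrix_inv x) = y ** matrix_inv x"
        using GL3_inv_cancel(3)[OF assms(3), of y] by (simp add: matrix_mul_assoc)
      then show ?thesis
        using IZ_coset_eq_iff[OF GL3_mult[OF that(1) assms(3)] GL3_mult[OF that(2) assms(3)]]
          IZ_coset_eq_iff[OF that] matrix_inv_mult[OF that(1) assms(3)] by simp
    qed
    show "\<exists>x\<in>GL3. IZ_coset (x ** h) = IZ_coset y" if "y \<in> GL3" for y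
      using GL3_mult[OF that GL3_inv(3)[OF assms(3)]] GL3_inv_cancel(4)[OF assms(3), of y]
      by (intro bexI[of _ "y ** matrix_inv h"]) simp_all
  qed
  also have "\<dots> = right_translation h (Phi smul w f)"
    unfolding Phi_def by (rule class_sum_hom[OF t]) (simp_all add: right_translation_def fun_eq_iff)
  finally show ?thesis .
qed

lemma Phi_at_ev:
  assumes "w \<in> E"
  shows "Phi smul w ev = w"
proof -
  have one: "mat 1 \<in> IZ" using Iw_IZ Iw_one by blast
  have "Phi smul w ev = summand smul w ev (mat 1)"
    unfolding Phi_def
  proof (rule class_sum_single[OF summand_E(1)[OF assms ev_F]])
    fix g :: "'f ^ 3 ^ 3" assume g: "g \<in> GL3" "summand smul w ev g \<noteq> 0"
    have "ev g \<noteq> 0" using g(2) by (auto simp: summand_def fun_scale_def zero_fun_def)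
    then have "g \<in> IZ" by (auto simp: ev_eq split: if_splits)
    then show "IZ_coset g = IZ_coset (mat 1)" using IZ_coset_mult[of g "mat 1"] by simp
  qed simp
  also have "\<dots> = w" using one chi_one by (simp add: summand_def fun_scale_def ev_eq)
  finally show ?thesis .
qed

abbreviation HomFW :: "(('f ^ 3 ^ 3 \<Rightarrow> 'k) \<Rightarrow> ('f ^ 3 ^ 3 \<Rightarrow> 'v)) set" where
  "HomFW \<equiv> Hom_GL3 (fun_scale (*)) right_translation F (fun_scale smul) right_translation W"

lemma Hom_determined:
  assumes \<psi>: "\<psi> \<in> HomFW" and f: "f \<in> F"
  shows "\<psi> f = Phi smul (\<psi> ev) f" "\<psi> ev \<in> E"
proof -
  have W: "\<And>x. x \<in> F \<Longrightarrow> \<psi> x \<in> W" and add: "\<And>x y. x \<in> F \<Longrightarrow> y \<in> F \<Longrightarrow> \<psi> (x + y) = \<psi> x + \<psi> y"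
    and scale: "\<And>c x. x \<in> F \<Longrightarrow> \<psi> (fun_scale (*) c x) = fun_scale smul c (\<psi> x)"
    and equi: "\<And>g x. g \<in> GL3 \<Longrightarrow> x \<in> F \<Longrightarrow> \<psi> (right_translation g x) = right_translation g (\<psi> x)"
    using \<psi> unfolding Hom_GL3_def by auto
  show E: "\<psi> ev \<in> E"
    unfolding E_iff using W[OF ev_F] equi[OF IZ_GL3 ev_F] ev_eigen scale[OF ev_F] by metis
  have zero: "\<psi> 0 = 0" using add[of 0 0] FV.subspace_0[OF F_subspace] by simp
  let ?r = "\<lambda>c. SOME x. x \<in> GL3 \<and> IZ_coset x = c"
  \<comment> \<open>The union of both supports, so that the sum for f and the sum for its image run
    over the same representatives.\<close>
  let ?C = "IZ_coset ` {g \<in> GL3. summand (*) ev f g \<noteq> 0} \<union> IZ_coset ` {g \<in> GL3. summand smul (\<psi> ev) f g \<noteq> 0}"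
  note vs = vector_space_over_itself.vector_space_axioms
  have C: "finite ?C" "?C \<subseteq> IZ_coset ` GL3" using summand_finite[OF vs f] summand_finite[OF V.vector_space_axioms f] by auto
  have r: "?r c \<in> GL3" if "c \<in> ?C" for c using that C(2) by (intro class_rep(1)) blast
  have tF: "summand (*) ev f g \<in> F" if "g \<in> GL3" for g
    unfolding summand_def using F_translate[OF ev_F GL3_inv(3)[OF that]] FV.subspace_scale[OF F_subspace] by blast
  have sum: "\<psi> (sum G S) = (\<Sum>c\<in>S. \<psi> (G c))" if "finite S" "\<forall>c\<in>S. G c \<in> F"
    for S and G :: "('f ^ 3 ^ 3) set \<Rightarrow> 'f ^ 3 ^ 3 \<Rightarrow> 'k"
    using that
  proof (induction S rule: finite_induct)
    case (insert c S)
    have "sum G S \<in> F" using insert.prems by (intro FV.subspace_sum[OF F_subspace]) blast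
    then have "\<psi> (G c + sum G S) = \<psi> (G c) + \<psi> (sum G S)" using insert.prems by (intro add) blast+
    moreover have "\<psi> (sum G S) = (\<Sum>c\<in>S. \<psi> (G c))" using insert.prems by (intro insert.IH) blast
    ultimately show ?case unfolding sum.insert[OF insert.hyps] by (simp only:)
  qed (simp add: zero)
  have "f = (\<Sum>c\<in>?C. summand (*) ev f (?r c))"
    using Phi_ev[OF f] class_sum_superset[OF summand_class_function[OF vs ev_eigen f] C] unfolding Phi_def by auto
  then have "\<psi> f = \<psi> (\<Sum>c\<in>?C. summand (*) ev f (?r c))" by (rule arg_cong)
  also have "\<dots> = (\<Sum>c\<in>?C. \<psi> (summand (*) ev f (?r c)))"
    using tF[OF r] by (intro sum[OF C(1)] ballI)
  also have "\<dots> = (\<Sum>c\<in>?C. summand smul (\<psi> ev) f (?r c))"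
  proof (rule sum.cong[OF HOL.refl])
    fix c assume "c \<in> ?C"
    then have g: "matrix_inv (?r c) \<in> GL3" using r GL3_inv(3) by blast
    then show "\<psi> (summand (*) ev f (?r c)) = summand smul (\<psi> ev) f (?r c)"
      unfolding summand_def using scale[OF F_translate[OF ev_F g]] equi[OF g ev_F] by simp
  qed
  also have "\<dots> = Phi smul (\<psi> ev) f"
    unfolding Phi_def
    by (rule class_sum_superset[OF summand_E(1)[OF E f] C, symmetric]) blast
  finally show "\<psi> f = Phi smul (\<psi> ev) f" .
qed

lemma Phi_Hom:
  assumes "w \<in> E"
  shows "restrict (Phi smul w) F \<in> HomFW"
proof -
  have "w \<in> W" using assms by (simp add: E_iff)
  have "x + y \<in> F" if "x \<in> F" "y \<in> F" for x y using FV.subspace_add[OF F_subspace that] .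
  moreover have "fun_scale (*) c x \<in> F" if "x \<in> F" for c x using FV.subspace_scale[OF F_subspace that] .
  ultimately show ?thesis unfolding Hom_GL3_def
    using Phi_W[OF \<open>w \<in> W\<close>] Phi_add[OF assms] Phi_scale[OF assms] Phi_translate[OF assms] F_translate
    by (auto simp: restrict_def)
qed

text \<open>Evaluation at \<open>ev\<close> is inverted by w \<mapsto> \<open>Phi smul w\<close>, so
  \<open>w\<close> acted on by \<open>T\<close> is the value of that homomorphism at
  \<open>T ev\<close>.\<close>

lemma hecke_action_eq:
  assumes w: "w \<in> E" and T: "T \<in> hecke_algebra v chi"
  shows "hecke_action v chi (fun_scale smul) right_translation W w T = Phi smul w (T ev)"
    and "T ev \<in> F" and "h \<in> IZ \<Longrightarrow> right_translation h (T ev) = fun_scale (*) (chi h) (T ev)"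
proof -
  have T': "\<And>x. x \<in> F \<Longrightarrow> T x \<in> F" "\<And>c x. x \<in> F \<Longrightarrow> T (fun_scale (*) c x) = fun_scale (*) c (T x)"
    "\<And>g x. g \<in> GL3 \<Longrightarrow> x \<in> F \<Longrightarrow> T (right_translation g x) = right_translation g (T x)"
    using T unfolding hecke_algebra_def Hom_GL3_def F_def by auto
  show TF: "T ev \<in> F" using T'(1) ev_F by blast
  show "right_translation h (T ev) = fun_scale (*) (chi h) (T ev)" if "h \<in> IZ"
    using T'(2)[OF ev_F] T'(3)[OF IZ_GL3[OF that] ev_F] ev_eigen[OF that] by simp
  have "the_inv_into HomFW (\<lambda>\<psi>. \<psi> ev) w = restrict (Phi smul w) F"
  proof (rule the_inv_into_f_eq[OF _ _ Phi_Hom[OF w]])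
    show "inj_on (\<lambda>\<psi>. \<psi> ev) HomFW"
    proof (rule inj_onI)
      fix \<psi> \<psi>' assume a: "\<psi> \<in> HomFW" "\<psi>' \<in> HomFW" "\<psi> ev = \<psi>' ev"
      show "\<psi> = \<psi>'"
      proof
        fix x show "\<psi> x = \<psi>' x"
        proof (cases "x \<in> F")
          case True
          then show ?thesis using Hom_determined(1)[OF a(1) True] Hom_determined(1)[OF a(2) True] a(3) by simp
        next
          case False
          then show ?thesis using a(1,2) unfolding Hom_GL3_def by (auto simp: PiE_def extensional_def)
        qed
      qed
    qed
    show "restrict (Phi smul w) F ev = w" using ev_F Phi_at_ev[OF w] by simp
  qed
  then show "hecke_action v chi (fun_scale smul) right_translation W w T = Phi smul w (T ev)"
    unfolding hecke_action_def Let_def ev_def[symmetric] F_def[symmetric]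
    using ev_F TF by (simp add: compose_def)
qed

lemma Phi_E:
  assumes w: "w \<in> E" and f: "f \<in> F" "\<And>h. h \<in> IZ \<Longrightarrow> right_translation h f = fun_scale (*) (chi h) f"
  shows "Phi smul w f \<in> E"
  unfolding E_iff
proof (intro conjI ballI)
  show "Phi smul w f \<in> W" using Phi_W w by (simp add: E_iff)
  show "right_translation h (Phi smul w f) = fun_scale smul (chi h) (Phi smul w f)" if "h \<in> IZ" for h
    using Phi_translate[OF w f(1) IZ_GL3[OF that]] f(2)[OF that] Phi_scale[OF w f(1)] by simp
qed

end

section \<open>A spherical Hecke operator\<close>

context uniformized_field
begin

definition t :: "'f ^ 3 ^ 3" where "t = mat3 1 0 0 0 \<pi> 0 0 0 (\<pi> ^ 2)"
definition t' :: "'f ^ 3 ^ 3" where "t' = mat3 1 0 0 0 (inverse \<pi>) 0 0 0 (inverse (\<pi> ^ 2))"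

lemma t_t': "t ** t' = mat 1" "t' ** t = mat 1"
  by (simp_all add: t_def t'_def mat3_eq_iff mat_mult3 mat_nth)

lemma t_GL3: "t \<in> GL3" "t' \<in> GL3" "matrix_inv t = t'" "matrix_inv t' = t"
  using GL3_I[OF t_t'(1)] GL3_I[OF t_t'(2)] matrix_inv_unique(1)[OF t_t'(1)] matrix_inv_unique(1)[OF t_t'(2)]
  by auto

lemma t_cancel: "t ** (t' ** g) = g" "t' ** (t ** g) = g" "g ** t ** t' = g" "g ** t' ** t = g"
  using GL3_inv_cancel[OF t_GL3(1)] unfolding t_GL3(3) by blast+

lemma pi_D1: "\<pi> \<in> D 1" "\<pi> ^ 2 \<in> D 2" "inverse \<pi> \<in> D (- 1)" "inverse (\<pi> ^ 2) \<in> D (- 2)"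
  using v_powi[of \<pi> 2] by (simp_all add: frac_ideal_def v_pi v_inverse)

lemma t_L: "t \<in> L 0" "t' \<in> L (- 2)"
  using pi_D1 D_mono[of \<pi> 1 0] D_mono[of "\<pi> ^ 2" 2 0] D_mono[of "inverse \<pi>" "- 1" "- 2"]
  by (auto simp: t_def t'_def L_iff3 one_D)

lemma t_bounded: "bounded_height 2 t"
  unfolding bounded_height_def using t_GL3 t_L by (auto intro!: exI[of _ 0])

text \<open>The group K \<inter> t K t^-1, the stabiliser in K of the coset t K; its cosets in K
  index the left cosets of K in K t K.\<close>

definition tsub :: "('f ^ 3 ^ 3) set" where
  "tsub = {y \<in> K. t' ** y ** t \<in> K}"

lemma tsub_mult: "x \<in> tsub \<Longrightarrow> y \<in> tsub \<Longrightarrow> x ** y \<in> tsub"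
proof -
  assume xy: "x \<in> tsub" "y \<in> tsub"
  have "t' ** (x ** y) ** t = (t' ** x ** t) ** (t' ** y ** t)"
    by (simp add: matrix_mul_assoc t_cancel)
  then show ?thesis using xy K_mult by (simp add: tsub_def)
qed

lemma tsub_inv: "y \<in> tsub \<Longrightarrow> matrix_inv y \<in> tsub"
proof -
  assume y: "y \<in> tsub"
  then have yK: "y \<in> K" by (simp add: tsub_def)
  have "(t' ** y ** t) ** (t' ** matrix_inv y ** t) = mat 1"
    using GL3_inv_cancel(3)[OF K_GL3[OF yK], of t'] by (simp add: matrix_mul_assoc t_cancel t_t')
  then have "matrix_inv (t' ** y ** t) = t' ** matrix_inv y ** t" by (rule matrix_inv_unique)
  then show ?thesis using y K_inv[of "t' ** y ** t"] K_inv[OF yK] by (simp add: tsub_def)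
qed

lemma tsub_one: "mat 1 \<in> tsub"
  by (simp add: tsub_def t_t')

lemma t_conj: "t' ** y ** t = mat3 (y $ 1 $ 1) (\<pi> * y $ 1 $ 2) (\<pi> ^ 2 * y $ 1 $ 3)
    (inverse \<pi> * y $ 2 $ 1) (y $ 2 $ 2) (\<pi> * y $ 2 $ 3)
    (inverse (\<pi> ^ 2) * y $ 3 $ 1) (inverse \<pi> * y $ 3 $ 2) (y $ 3 $ 3)"
  by (simp add: t_def t'_def mat3_eq_iff mat_mult3 power2_eq_square field_simps)

lemma inverse_pi_D: "inverse \<pi> * x \<in> D 0 \<longleftrightarrow> x \<in> D 1" "inverse (\<pi> ^ 2) * x \<in> D 0 \<longleftrightarrow> x \<in> D 2"
  using pi_powi_mult_D[of "- 1" x 0] pi_powi_mult_D[of "- 2" x 0] by (simp_all add: power_int_minus)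

text \<open>Conjugation divides the entries below the diagonal by powers of \<pi> and multiplies
  those above it. Integrality before and after hence makes one matrix upper and the other lower
  triangular modulo the maximal ideal.\<close>

lemma tsub_Iw: "y \<in> tsub \<Longrightarrow> y \<in> Iw \<and> transpose (t' ** y ** t) \<in> Iw"
proof -
  assume y: "y \<in> tsub"
  then have K: "y \<in> K" "t' ** y ** t \<in> K" by (auto simp: tsub_def)
  have "t' ** y ** t \<in> L 0" using K K_L0 by blast
  then have "y $ 2 $ 1 \<in> D 1" "y $ 3 $ 1 \<in> D 2" "y $ 3 $ 2 \<in> D 1"
    unfolding t_conj L_iff3 by (simp_all add: inverse_pi_D)
  then have 1: "y \<in> Iw" using K K_L0 D_mono[of "y $ 3 $ 1" 2 1] by (auto simp: Iw_iff J0_iff)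
  have "transpose (t' ** y ** t) \<in> K" using K K_transpose by blast
  moreover have "\<pi> * y $ 1 $ 2 \<in> D 1" "\<pi> ^ 2 * y $ 1 $ 3 \<in> D 1" "\<pi> * y $ 2 $ 3 \<in> D 1"
    using D_mult0(1)[OF pi_D1(1) K_D0[OF K(1)]] D_mult0(1)[OF D_mono[OF pi_D1(2), of 1] K_D0[OF K(1)]] by auto
  ultimately have "transpose (t' ** y ** t) \<in> Iw"
    using K_L0[of "transpose (t' ** y ** t)"] by (auto simp: Iw_iff J0_iff t_conj transpose_def)
  then show ?thesis using 1 by blast
qed

text \<open>Entry (3, 1) is divided by \<pi> twice, so it carries the only condition beyond the
  Iwahori ones. The inverse inherits this condition from entry (3, 1) of y^-1 y = 1.\<close>

lemma tsubI: "y \<in> Iw \<Longrightarrow> y $ 3 $ 1 \<in> D 2 \<Longrightarrow> y \<in> tsub"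
proof -
  assume y: "y \<in> Iw" "y $ 3 $ 1 \<in> D 2"
  let ?z = "matrix_inv y"
  have L0: "t' ** u ** t \<in> L 0" if u: "u \<in> Iw" "u $ 3 $ 1 \<in> D 2" for u
  proof -
    have d: "u $ i $ j \<in> D 0" for i j using K_D0 Iw_K u by blast
    have "\<pi> * u $ i $ j \<in> D 0" "\<pi> ^ 2 * u $ i $ j \<in> D 0" for i j
      using D_mult0(1)[OF D_mono[OF pi_D1(1), of 0] d] D_mult0(1)[OF D_mono[OF pi_D1(2), of 0] d] by auto
    then show ?thesis using u d unfolding t_conj L_iff3 by (simp add: inverse_pi_D Iw_iff J0_iff)
  qed
  have z: "?z \<in> Iw" using Iw_inv y by blast
  have one: "?z ** y = mat 1" "y ** ?z = mat 1" using GL3_inv K_GL3 Iw_K y(1) by blast+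
  have d: "?z $ i $ j \<in> D 0" for i j using K_D0 Iw_K z by blast
  have "?z $ 3 $ 2 * y $ 2 $ 1 \<in> D (1 + 1)" using z y by (intro D_mult) (auto simp: Iw_iff J0_iff)
  moreover have "?z $ 3 $ 3 * y $ 3 $ 1 \<in> D 2" using d y(2) by (intro D_mult0)
  ultimately have "?z $ 3 $ 2 * y $ 2 $ 1 + ?z $ 3 $ 3 * y $ 3 $ 1 \<in> D 2" by (intro D_add) auto
  moreover have "(?z ** y) $ 3 $ 1 = 0" by (simp add: one mat_nth)
  then have "y $ 1 $ 1 * ?z $ 3 $ 1 = - (?z $ 3 $ 2 * y $ 2 $ 1 + ?z $ 3 $ 3 * y $ 3 $ 1)"
    unfolding mat_mult3 by (simp add: algebra_simps eq_neg_iff_add_eq_0)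
  ultimately have "y $ 1 $ 1 * ?z $ 3 $ 1 \<in> D 2" by (simp del: minus_add_distrib)
  then have "?z $ 3 $ 1 \<in> D 2" using D_cancel_unit Iw_diag_unit[OF y(1)] by blast
  then have "t' ** ?z ** t \<in> L 0" using L0 z by blast
  moreover have "(t' ** y ** t) ** (t' ** ?z ** t) = mat 1"
    using GL3_inv_cancel(3)[OF K_GL3[OF Iw_K[OF y(1)]], of t'] by (simp add: matrix_mul_assoc t_cancel t_t')
  ultimately have "t' ** y ** t \<in> K" using L0[OF y] by (intro K_I[of "t' ** y ** t"])
  then show ?thesis using y Iw_K by (simp add: tsub_def)
qed

definition tcoset :: "'f ^ 3 ^ 3 \<Rightarrow> ('f ^ 3 ^ 3) set" where
  "tcoset y = {z \<in> K. matrix_inv y ** z \<in> tsub}"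

lemma tcoset_eq_iff: "y \<in> K \<Longrightarrow> z \<in> K \<Longrightarrow> tcoset y = tcoset z \<longleftrightarrow> matrix_inv y ** z \<in> tsub"
proof
  assume yz: "y \<in> K" "z \<in> K"
  note G = yz[THEN K_GL3]
  {
    assume "tcoset y = tcoset z"
    moreover have "z \<in> tcoset z" using yz GL3_inv[OF G(2)] tsub_one by (simp add: tcoset_def)
    ultimately show "matrix_inv y ** z \<in> tsub" by (auto simp: tcoset_def)
  }
  assume h: "matrix_inv y ** z \<in> tsub" (is "?h \<in> _")
  have hi: "matrix_inv z ** y \<in> tsub"
    using tsub_inv[OF h] matrix_inv_mult[OF GL3_inv(3)[OF G(1)] G(2)] GL3_inv(4)[OF G(1)] by simp
  have "matrix_inv y ** x \<in> tsub \<longleftrightarrow> matrix_inv z ** x \<in> tsub" for x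
  proof
    assume "matrix_inv y ** x \<in> tsub"
    moreover have "(matrix_inv z ** y) ** (matrix_inv y ** x) = matrix_inv z ** x"
      using GL3_inv_cancel(3)[OF G(1), of "matrix_inv z"] by (simp add: matrix_mul_assoc)
    ultimately show "matrix_inv z ** x \<in> tsub" using tsub_mult[OF hi] by metis
  next
    assume "matrix_inv z ** x \<in> tsub"
    moreover have "(matrix_inv y ** z) ** (matrix_inv z ** x) = matrix_inv y ** x"
      using GL3_inv_cancel(3)[OF G(2), of "matrix_inv y"] by (simp add: matrix_mul_assoc)
    ultimately show "matrix_inv y ** x \<in> tsub" using tsub_mult[OF h] by metis
  qed
  then show "tcoset y = tcoset z" by (auto simp: tcoset_def)
qed

text \<open>Conjugation by \<open>t\<close> loses at most two powers of \<pi>, so precision 3 leaves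
  a matrix congruent to 1.\<close>

lemma finite_tcosets: "finite (tcoset ` K)"
proof -
  have "K \<subseteq> L 0" using K_L0 by blast
  from finite_L_quotient[OF this, of 3]
  obtain S where S: "finite S" "S \<subseteq> K" "\<forall>y\<in>K. \<exists>s\<in>S. y - s \<in> L 3" by meson
  have "tcoset y \<in> tcoset ` S" if y: "y \<in> K" for y
  proof -
    obtain s where s: "s \<in> S" "y - s \<in> L 3" using S(3) y by blast
    have sK: "s \<in> K" using s S by blast
    have e: "matrix_inv s ** y - mat 1 = matrix_inv s ** (y - s)"
      using GL3_inv[OF K_GL3[OF sK]] by (simp add: matrix_diff_ldistrib)
    then have h: "matrix_inv s ** y - mat 1 \<in> L 3" using K_L_left[OF K_inv[OF sK]] s(2) by simp
    have "t' ** (matrix_inv s ** y) ** t - mat 1 = t' ** (matrix_inv s ** y - mat 1) ** t"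
      by (simp add: matrix_diff_ldistrib matrix_diff_rdistrib t_t')
    moreover have "t' ** (matrix_inv s ** y - mat 1) ** t \<in> L ((- 2 + 3) + 0)"
      by (intro L_mult t_L h)
    ultimately have "t' ** (matrix_inv s ** y) ** t \<in> K" using near_one_K by simp
    then have "matrix_inv s ** y \<in> tsub" using K_mult[OF K_inv[OF sK] y] by (simp add: tsub_def)
    then have "tcoset s = tcoset y" using tcoset_eq_iff[OF sK y] by blast
    then show ?thesis using s(1) by blast
  qed
  then show ?thesis using S(1) by (meson finite_surj image_subsetI)
qed

end

section \<open>The operator on the induced representation\<close>

context weight_line
begin

text \<open>The contribution of the neighbour t^-1 y^-1 g to the convolution; the kernel at y t is
  \<sigma>(y) composed with the kernel at t.\<close>

definition kernel_term :: "('f ^ 3 ^ 3 \<Rightarrow> 'v) \<Rightarrow> 'f ^ 3 ^ 3 \<Rightarrow> 'f ^ 3 ^ 3 \<Rightarrow> 'v" where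
  "kernel_term f g y = smul (\<phi> (f (t' ** matrix_inv y ** g))) (\<sigma> y m)"

definition tcoset_reps :: "('f ^ 3 ^ 3) set" where
  "tcoset_reps = (\<lambda>c. SOME y. y \<in> K \<and> tcoset y = c) ` tcoset ` K"

text \<open>The operator with kernel supported on \<open>KZ t K\<close> and value \<open>\<lambda>w. \<phi> w m\<close> at \<open>t\<close>.\<close>

definition Top :: "('f ^ 3 ^ 3 \<Rightarrow> 'v) \<Rightarrow> 'f ^ 3 ^ 3 \<Rightarrow> 'v" where
  "Top f g = (\<Sum>y\<in>tcoset_reps. kernel_term f g y)"

lemma tcoset_reps: "finite tcoset_reps" "tcoset_reps \<subseteq> K"
  using finite_tcosets class_rep(1)[of _ tcoset K] by (auto simp: tcoset_reps_def)

lemma \<phi>_add: "\<phi> (x + y) = \<phi> x + \<phi> y" and \<phi>_scale: "\<phi> (smul c x) = c * \<phi> x" and \<phi>_zero: "\<phi> 0 = 0"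
  using functional_add functional_scale functional_zero \<phi>_low by blast+

lemma Top_add: "Top (f + f') = Top f + Top f'"
  by (simp add: fun_eq_iff Top_def kernel_term_def \<phi>_add V.scale_left_distrib sum.distrib)

lemma Top_zero: "Top 0 = 0"
  by (simp add: fun_eq_iff Top_def kernel_term_def \<phi>_zero)

lemma Top_scale: "Top (fun_scale smul c f) = fun_scale smul c (Top f)"
  by (simp add: fun_eq_iff Top_def kernel_term_def \<phi>_scale fun_scale_def V.scale_sum_right)

lemma Top_translate: "Top (right_translation h f) = right_translation h (Top f)"
  by (simp add: fun_eq_iff Top_def kernel_term_def right_translation_def matrix_mul_assoc)

lemma \<sigma>_Iw_m: "g \<in> Iw \<Longrightarrow> \<sigma> g m = smul (chi g) m"
  using ext_m[OF Iw_IZ] ext_K[OF Iw_K] by simp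

text \<open>The compatibility that makes the kernel well defined. The conjugate of y is a lower
  pro-p factor times the diagonal of y. The first factor is invisible to \<open>\<phi>\<close>, and
  the diagonal acts on \<open>\<phi>\<close> by the same character as on \<open>m\<close>, because
  lower invariant functionals form a line and \<open>\<phi> m = 1\<close>.\<close>

lemma \<phi>_tsub:
  assumes "y \<in> tsub"
  shows "\<phi> (\<sigma> (t' ** y ** t) w) = chi y * \<phi> w"
proof -
  let ?z = "t' ** y ** t"
  have y: "y \<in> Iw" "transpose ?z \<in> Iw" using tsub_Iw[OF assms] by auto
  have d: "diag_part (transpose ?z) = diag_part y" by (simp add: diag_part_def t_conj transpose_def)
  obtain u where u: "u \<in> Iwr 1" "transpose ?z = diag_part y ** u" using Iw_eq_diag_part[OF y(2)] unfolding d by blast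
  have dI: "diag_part y \<in> Iw" by (rule diag_part_Iw[OF y(1)])
  have "transpose (transpose ?z) = transpose u ** diag_part y"
    unfolding u(2) by (simp only: matrix_transpose_mul transpose_diag_part)
  then have "?z = transpose u ** diag_part y" by simp
  then have "\<phi> (\<sigma> ?z w) = \<phi> (\<sigma> (diag_part y) w)"
    using sg_mult[OF K_transpose[OF Iwr_K[OF u(1)]] Iw_K[OF dI]] lowfun_transpose[OF \<phi>_low u(1)] by simp
  also have "\<dots> = \<phi> (\<sigma> (diag_part y) m) * \<phi> w"
    using lowfun_unique[OF m_heig \<phi>_low lowfun_diag[OF \<phi>_low dI], of w] \<phi>_m by simp
  also have "\<sigma> (diag_part y) m = \<sigma> y m"
    using sg_inv1_congruent[OF y(1) dI diag_part_diff[OF y(1)] m_inv1] by simp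
  also have "\<phi> (\<sigma> y m) = chi y" using \<sigma>_Iw_m[OF y(1)] by (simp add: \<phi>_scale \<phi>_m)
  finally show ?thesis .
qed

lemma W_K: "f \<in> W \<Longrightarrow> k \<in> K \<Longrightarrow> g \<in> GL3 \<Longrightarrow> f (k ** g) = \<sigma> k (f g)"
  unfolding W_iff using K_KZ ext_K by metis

lemma W_zero: "f \<in> W \<Longrightarrow> g \<notin> GL3 \<Longrightarrow> f g = 0"
  unfolding W_iff by blast

lemma kernel_arg_GL3: "y \<in> K \<Longrightarrow> t' ** matrix_inv y ** g \<in> GL3 \<longleftrightarrow> g \<in> GL3"
  using GL3_mult_left_iff[OF GL3_mult[OF t_GL3(2) GL3_inv(3)[OF K_GL3]]] by blast

lemma kernel_class_function:
  assumes f: "f \<in> W"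
  shows "class_function tcoset K (kernel_term f g)"
  unfolding class_function_def
proof (intro ballI impI)
  fix y z assume yz: "y \<in> K" "z \<in> K" "tcoset y = tcoset z"
  show "kernel_term f g y = kernel_term f g z"
  proof (cases "g \<in> GL3")
    case True
    let ?j = "matrix_inv z ** y"
    have j: "?j \<in> tsub" using tcoset_eq_iff[OF yz(2,1)] yz(3) by simp
    have y: "y = z ** ?j" using GL3_inv_cancel(1)[OF K_GL3[OF yz(2)]] by simp
    have jK: "t' ** ?j ** t \<in> K" "?j \<in> K" "?j \<in> Iw" using j tsub_Iw by (auto simp: tsub_def)
    have "(t' ** ?j ** t) ** (t' ** matrix_inv y ** g) = t' ** matrix_inv z ** g"
    proof -
      have "(t' ** ?j ** t) ** (t' ** matrix_inv y ** g) = t' ** (?j ** matrix_inv y) ** g"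
        by (simp add: matrix_mul_assoc t_cancel)
      also have "?j ** matrix_inv y = matrix_inv z" using GL3_inv_cancel(3)[OF K_GL3[OF yz(1)]] by simp
      finally show ?thesis .
    qed
    then have "f (t' ** matrix_inv z ** g) = \<sigma> (t' ** ?j ** t) (f (t' ** matrix_inv y ** g))"
      using W_K[OF f jK(1), of "t' ** matrix_inv y ** g"] kernel_arg_GL3[OF yz(1)] True by simp
    then have *: "\<phi> (f (t' ** matrix_inv z ** g)) = chi ?j * \<phi> (f (t' ** matrix_inv y ** g))"
      using \<phi>_tsub[OF j] by simp
    have "\<sigma> (z ** ?j) m = smul (chi ?j) (\<sigma> z m)"
      using sg_mult[OF yz(2) jK(2), of m] \<sigma>_Iw_m[OF jK(3)] sg_scale[OF yz(2)] by simp
    then have "\<sigma> y m = smul (chi ?j) (\<sigma> z m)" using y by simp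
    then show ?thesis unfolding kernel_term_def * by (simp add: mult.commute)
  next
    case False
    then show ?thesis using W_zero[OF f] kernel_arg_GL3 yz by (simp add: kernel_term_def \<phi>_zero)
  qed
qed

lemma Top_eq: "f \<in> W \<Longrightarrow> Top f g = class_sum tcoset K (kernel_term f g)"
  unfolding Top_def tcoset_reps_def using class_sum_reps[OF kernel_class_function finite_tcosets] by simp

lemma Top_nonzero_term:
  assumes "Top f g \<noteq> 0"
  obtains y where "y \<in> K" "f (t' ** matrix_inv y ** g) \<noteq> 0"
proof -
  obtain y where "y \<in> tcoset_reps" "kernel_term f g y \<noteq> 0"
    using assms unfolding Top_def by (metis sum.neutral)
  then have "y \<in> K" "f (t' ** matrix_inv y ** g) \<noteq> 0"
    using tcoset_reps(2) \<phi>_zero by (auto simp: kernel_term_def)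
  then show thesis by (rule that)
qed

lemma Top_bounded:
  assumes "\<And>g. f g \<noteq> 0 \<Longrightarrow> bounded_height n g" "Top f g \<noteq> 0"
  shows "bounded_height (n + 2) g"
proof -
  obtain y where y: "y \<in> K" "f (t' ** matrix_inv y ** g) \<noteq> 0" by (rule Top_nonzero_term[OF assms(2)])
  have "y ** (t ** (t' ** matrix_inv y ** g)) = g"
    using GL3_inv_cancel(1)[OF K_GL3[OF y(1)], of g] by (simp add: t_cancel matrix_mul_assoc[symmetric])
  then show ?thesis
    using bounded_height_mult[OF bounded_height_K[OF y(1)] bounded_height_mult[OF t_bounded assms(1)[OF y(2)]]]
    by (simp add: add.commute)
qed

text \<open>The substitution y \<mapsto> k y permutes the cosets, and by
  \<open>kernel_class_function\<close> the sum does not depend on representatives.\<close>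

lemma Top_K:
  assumes f: "f \<in> W" and k: "k \<in> K"
  shows "Top f (k ** g) = \<sigma> k (Top f g)"
proof -
  note kG = K_GL3[OF k]
  have "kernel_term f (k ** g) (k ** y) = \<sigma> k (kernel_term f g y)" if y: "y \<in> K" for y
  proof -
    have "matrix_inv (k ** y) ** (k ** g) = matrix_inv y ** g"
      unfolding matrix_inv_mult[OF kG K_GL3[OF y]]
      using GL3_inv_cancel(2)[OF kG, of g] by (simp add: matrix_mul_assoc[symmetric])
    then show ?thesis
      using sg_mult[OF k y, of m] sg_scale[OF k] by (simp add: kernel_term_def matrix_mul_assoc[symmetric])
  qed
  then have "class_sum tcoset K (\<lambda>y. kernel_term f (k ** g) (k ** y)) = class_sum tcoset K (\<lambda>y. \<sigma> k (kernel_term f g y))"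
    by (intro class_sum_cong)
  moreover have "class_sum tcoset K (\<lambda>y. kernel_term f (k ** g) (k ** y)) = class_sum tcoset K (kernel_term f (k ** g))"
  proof (rule class_sum_reindex[OF kernel_class_function[OF f]])
    show "k ** y \<in> K" if "y \<in> K" for y using K_mult[OF k that] .
    show "tcoset (k ** x) = tcoset (k ** y) \<longleftrightarrow> tcoset x = tcoset y" if "x \<in> K" "y \<in> K" for x y
    proof -
      have "matrix_inv (k ** x) ** (k ** y) = matrix_inv x ** y"
        unfolding matrix_inv_mult[OF kG K_GL3[OF that(1)]]
        using GL3_inv_cancel(2)[OF kG, of y] by (simp add: matrix_mul_assoc[symmetric])
      then show ?thesis using tcoset_eq_iff[OF that] tcoset_eq_iff[OF K_mult[OF k that(1)] K_mult[OF k that(2)]] by simp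
    qed
    show "\<exists>x\<in>K. tcoset (k ** x) = tcoset y" if "y \<in> K" for y
      using K_mult[OF K_inv[OF k] that] GL3_inv_cancel(1)[OF kG, of y] by (intro bexI[of _ "matrix_inv k ** y"]) simp_all
  qed
  moreover have "class_sum tcoset K (\<lambda>y. \<sigma> k (kernel_term f g y)) = \<sigma> k (class_sum tcoset K (kernel_term f g))"
  proof (rule class_sum_hom[OF kernel_class_function[OF f]])
    show "finite (tcoset ` {y \<in> K. kernel_term f g y \<noteq> 0})"
      by (rule finite_subset[OF _ finite_tcosets]) blast
  qed (simp_all add: sg_zero sg_add k)
  ultimately show ?thesis using Top_eq[OF f] by simp
qed

lemma Top_scalar:
  assumes f: "f \<in> W" and g: "g \<in> GL3"
  shows "Top f (mat (\<pi> powi r) ** g) = Top f g"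
proof -
  have z: "mat (\<pi> powi r) \<in> KZ" using times_centerI[OF K_one, of r] by simp
  have "f (t' ** matrix_inv y ** (mat (\<pi> powi r) ** g)) = f (t' ** matrix_inv y ** g)" if y: "y \<in> K" for y
  proof -
    have "t' ** matrix_inv y ** (mat (\<pi> powi r) ** g) = mat (\<pi> powi r) ** (t' ** matrix_inv y ** g)"
      unfolding matrix_mul_assoc unfolding mat_scalar_commute[of "\<pi> powi r" t'] unfolding mat_scalar_commute[of "\<pi> powi r" "matrix_inv y", symmetric]
      using mat_scalar_commute[of "\<pi> powi r" "t' ** matrix_inv y"] mat_scalar_commute[of "\<pi> powi r" t'] by (simp add: matrix_mul_assoc)
    moreover have "f (mat (\<pi> powi r) ** (t' ** matrix_inv y ** g)) = ext (mat (\<pi> powi r)) (f (t' ** matrix_inv y ** g))"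
      using f z kernel_arg_GL3[OF y] g unfolding W_iff by blast
    moreover have "ext (mat (\<pi> powi r)) w = w" for w using ext_eq[OF K_one, of r] by simp
    ultimately show ?thesis by simp
  qed
  then show ?thesis unfolding Top_def kernel_term_def using tcoset_reps(2) by (intro sum.cong) auto
qed

lemma Top_W:
  assumes f: "f \<in> W"
  shows "Top f \<in> W"
  unfolding W_iff
proof (intro conjI allI impI ballI)
  note f' = f[unfolded W_iff]
  show "Top f g = 0" if "g \<notin> GL3" for g
    unfolding Top_def kernel_term_def using that W_zero[OF f] kernel_arg_GL3 tcoset_reps(2) \<phi>_zero
    by (intro sum.neutral) auto
  have "locally_constant (\<lambda>g. kernel_term f g y)" if y: "y \<in> tcoset_reps" for y
  proof -
    have "y \<in> K" using y tcoset_reps(2) by blast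
    then have "t' ** matrix_inv y \<in> GL3" by (intro GL3_mult t_GL3 GL3_inv K_GL3)
    then have "locally_constant (\<lambda>g. f (t' ** matrix_inv y ** g ** mat 1))"
      using f' by (intro locally_constant_translate) auto
    then show ?thesis unfolding kernel_term_def
      using locally_constant_compose[of "\<lambda>g. f (t' ** matrix_inv y ** g)" "\<lambda>w. smul (\<phi> w) (\<sigma> y m)"] by simp
  qed
  then show "locally_constant (Top f)"
    using locally_constant_sum[of tcoset_reps "\<lambda>y g. kernel_term f g y"] unfolding Top_def[abs_def] by simp
  obtain n where "\<And>g. f g \<noteq> 0 \<Longrightarrow> bounded_height n g" using f' by blast
  then show "\<exists>n. \<forall>g. Top f g \<noteq> 0 \<longrightarrow> bounded_height n g" using Top_bounded[of f n] by blast
  fix h g :: "'f ^ 3 ^ 3" assume h: "h \<in> KZ" and g: "g \<in> GL3"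
  obtain k r where k: "k \<in> K" "h = k ** mat (\<pi> powi r)" using KZ_cases[OF h] .
  have "Top f (h ** g) = \<sigma> k (Top f (mat (\<pi> powi r) ** g))"
    unfolding k(2) using Top_K[OF f k(1), of "mat (\<pi> powi r) ** g"] by (simp add: matrix_mul_assoc)
  then show "Top f (h ** g) = ext h (Top f g)" using Top_scalar[OF f g] ext_eq[OF k(1)] k(2) by simp
qed

lemma Top_E: "f \<in> E \<Longrightarrow> Top f \<in> E"
  unfolding E_iff using Top_W Top_translate Top_scale by metis

text \<open>\<open>Top\<close> is linear and commutes with right translation, while
  \<open>Phi\<close> is a sum of scaled translates. This is what makes the image of
  \<open>Top\<close> stable under the Hecke action.\<close>

lemma Phi_Top:
  assumes "w \<in> E" "f \<in> F"
  shows "Phi smul (Top w) f = Top (Phi smul w f)"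
proof -
  have eq: "summand smul (Top w) f = (\<lambda>g. Top (summand smul w f g))"
    unfolding summand_def[abs_def] Top_scale Top_translate ..
  show ?thesis unfolding Phi_def eq by (rule class_sum_hom[OF summand_E[OF assms]]) (rule Top_zero Top_add)+
qed

end

section \<open>Leading terms\<close>

context uniformized_field
begin

definition xdiag :: "nat \<Rightarrow> 'f ^ 3 ^ 3" where "xdiag N = mat3 1 0 0 0 1 0 0 0 (\<pi> ^ N)"
definition xdiag' :: "nat \<Rightarrow> 'f ^ 3 ^ 3" where "xdiag' N = mat3 1 0 0 0 1 0 0 0 (inverse (\<pi> ^ N))"

lemma xdiag_inverse: "xdiag N ** xdiag' N = mat 1"
  by (simp add: xdiag_def xdiag'_def mat3_eq_iff mat_mult3 mat_nth)

lemma xdiag_GL3: "xdiag N \<in> GL3" "matrix_inv (xdiag N) = xdiag' N"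
  using GL3_I[OF xdiag_inverse] matrix_inv_unique(1)[OF xdiag_inverse] by auto

lemma pi_power_D: "\<pi> ^ N \<in> D k \<longleftrightarrow> k \<le> int N" "inverse (\<pi> ^ N) \<in> D k \<longleftrightarrow> k \<le> - int N"
  using pi_powi_D[of "int N" k] pi_powi_D[of "- int N" k] by (simp_all add: power_int_minus)

lemma xdiag_L: "xdiag N \<in> L 0" "xdiag' N \<in> L (- int N)"
  by (simp_all add: xdiag_def xdiag'_def L_iff3 pi_power_D one_D)

lemma xdiag_bounded: "bounded_height (int N) (xdiag N)"
  unfolding bounded_height_def using xdiag_GL3 xdiag_L by (auto intro!: exI[of _ 0])

lemma xdiag_not_bounded: "bounded_height n (xdiag N) \<Longrightarrow> int N \<le> n"
proof -
  assume "bounded_height n (xdiag N)"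
  then obtain a where a: "xdiag N \<in> L a" "xdiag' N \<in> L (- n - a)" unfolding bounded_height_def xdiag_GL3 by blast
  from L_nth[OF a(1), of 1 1] have "a \<le> 0" by (simp add: xdiag_def one_D)
  moreover from L_nth[OF a(2), of 3 3] have "- n - a \<le> - int N" by (simp add: xdiag'_def pi_power_D)
  ultimately show ?thesis by linarith
qed

lemma bounded_height_nonneg: "bounded_height n g \<Longrightarrow> 0 \<le> n"
proof -
  assume "bounded_height n g"
  then obtain a where a: "g \<in> GL3" "g \<in> L a" "matrix_inv g \<in> L (- n - a)" unfolding bounded_height_def by blast
  have "mat 1 \<in> L (a + (- n - a))" using L_mult[OF a(2,3)] GL3_inv(1)[OF a(1)] by simp
  then show ?thesis by (simp add: L_one)
qed

lemma srefl_False_rows: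
  fixes B :: "'f ^ 3 ^ 3"
  shows "(srefl False 0 ** B) $ 1 $ j = B $ 1 $ j" "(srefl False 0 ** B) $ 2 $ j = B $ 3 $ j"
    "(srefl False 0 ** B) $ 3 $ j = B $ 2 $ j"
  by (simp_all add: mat_mult3 srefl_def)

lemma t'_col: "((B :: 'f ^ 3 ^ 3) ** t') $ i $ 2 = B $ i $ 2 * inverse \<pi>"
  by (simp add: mat_mult3 t'_def)

text \<open>For \<open>g\<close> of height \<open>n\<close>, the matrix \<open>t g\<close> has height \<open>n + 2\<close>, and \<open>g\<close> is its only neighbour of height
  at most \<open>n\<close>, as soon as the first row of \<open>g\<close> and the last column of its inverse both contain an entry
  of minimal valuation.\<close>

lemma unique_neighbour:
  assumes g: "g \<in> GL3" and ab: "g \<in> L a" "matrix_inv g \<in> L b" "a + b = - n"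
    and j: "g $ 1 $ j \<notin> D (a + 1)" and i: "matrix_inv g $ i $ 3 \<notin> D (b + 1)"
    and y: "y \<in> K" and z: "bounded_height n (t' ** matrix_inv y ** (t ** g))"
  shows "y \<in> tsub"
proof -
  let ?z = "t' ** matrix_inv y ** (t ** g)" and ?yi = "matrix_inv y"
  note yG = K_GL3[OF y]
  have zG: "?z \<in> GL3" using z by (rule bounded_height_GL3)
  obtain a' where a': "?z \<in> L a'" "matrix_inv ?z \<in> L (- n - a')" using z unfolding bounded_height_def by blast
  have tg: "y ** (t ** ?z) = t ** g" "?yi ** (t ** g) = t ** ?z"
    using GL3_inv_cancel(1)[OF yG, of "t ** g"] by (simp_all add: t_cancel matrix_mul_assoc[symmetric])
  have zi: "matrix_inv ?z = matrix_inv g ** t' ** y ** t"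
    using matrix_inv_mult[OF GL3_mult[OF t_GL3(2) GL3_inv(3)[OF yG]] GL3_mult[OF t_GL3(1) g]]
      matrix_inv_mult[OF t_GL3(2) GL3_inv(3)[OF yG]] matrix_inv_mult[OF t_GL3(1) g] GL3_inv(4)[OF yG] t_GL3
    by (simp add: matrix_mul_assoc)
  have gi: "matrix_inv ?z ** t' = matrix_inv g ** t' ** y" "matrix_inv ?z ** t' ** ?yi = matrix_inv g ** t'"
    unfolding zi using GL3_inv_cancel(3)[OF yG] by (simp_all add: t_cancel)
  have yD: "y $ k $ l \<in> D 0" "?yi $ k $ l \<in> D 0" for k l using y K_inv K_D0 by blast+
  \<comment> \<open>Multiplication by \<open>t\<close> leaves the pivot (1, j) as it is and
    multiplies the pivot (i, 3) of the inverse by \<pi>^-2; between them they force the scale a' of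
    the neighbour to be a.\<close>
  have "t ** g \<in> L a'" using L_mult0(1)[OF K_L0[OF y] L_mult0(1)[OF t_L(1) a'(1)]] unfolding tg(1) .
  from L_nth[OF this, of 1 j] have "g $ 1 $ j \<in> D a'" by (simp add: t_def mat_mult3)
  then have "a' \<le> a" using j D_mono[of "g $ 1 $ j" a' "a + 1"] by linarith
  moreover have "matrix_inv g ** t' \<in> L (- n - a' - 2)"
    using L_mult0(2)[OF L_mult[OF a'(2) t_L(2)] K_L0[OF K_inv[OF y]]] unfolding gi(2) by simp
  from L_nth[OF this, of i 3] have "\<pi> powi (- 2) * matrix_inv g $ i $ 3 \<in> D (- n - a' - 2)"
    by (simp add: t'_def mat_mult3 power_int_minus mult.commute)
  then have "matrix_inv g $ i $ 3 \<in> D (- n - a')" unfolding pi_powi_mult_D by simp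
  then have "- n - a' \<le> b" using i D_mono[of "matrix_inv g $ i $ 3" "- n - a'" "b + 1"] by linarith
  ultimately have a_eq: "a' = a" using ab(3) by linarith
  have gD: "g $ k $ l \<in> D a" "matrix_inv g $ k $ l \<in> D b" for k l using ab L_nth by blast+
  have row: "(t ** ?z) $ 2 $ j \<in> D (a + 1)" "(t ** ?z) $ 3 $ j \<in> D (a + 2)"
    using D_mult[OF pi_D1(1) L_nth[OF a'(1), of 2 j]] D_mult[OF pi_D1(2) L_nth[OF a'(1), of 3 j]] a_eq
    by (simp_all add: t_def mat_mult3[of "mat3 1 0 0 0 \<pi> 0 0 0 (\<pi>\<^sup>2)"] add.commute)
  have pg: "\<pi> * g $ 2 $ j \<in> D (a + 1)" "\<pi> ^ 2 * g $ 3 $ j \<in> D (a + 2)"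
    using D_mult[OF pi_D1(1) gD(1)] D_mult[OF pi_D1(2) gD(1)] by (simp_all add: add.commute)
  have yi: "?yi $ l $ 1 * g $ 1 $ j = (t ** ?z) $ l $ j - (?yi $ l $ 2 * (\<pi> * g $ 2 $ j) + ?yi $ l $ 3 * (\<pi> ^ 2 * g $ 3 $ j))" for l
    unfolding tg(2)[symmetric] by (simp add: mat_mult3 t_def)
  have pg2: "\<pi> ^ 2 * g $ 3 $ j \<in> D (a + 1)" using D_mono[OF pg(2), of "a + 1"] by simp
  have row3: "(t ** ?z) $ 3 $ j \<in> D (a + 1)" using D_mono[OF row(2), of "a + 1"] by simp
  \<comment> \<open>Rows 2 and 3 of t z are divisible by one power more than the pivot of g;
    cancelling the pivot puts the first column of y^-1 below the diagonal into the maximal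
    ideal.\<close>
  have yi1: "?yi $ l $ 1 \<in> D 1" if "l = 2 \<or> l = 3" for l
  proof -
    have "?yi $ l $ 1 * g $ 1 $ j \<in> D (a + 1)" unfolding yi
      by (rule D_diff[OF _ D_add[OF D_mult0(2)[OF yD(2) pg(1)] D_mult0(2)[OF yD(2) pg2]]]) (use that row(1) row3 in auto)
    then show ?thesis using D_cancel[OF j, of "?yi $ l $ 1" 1] by (simp add: mult.commute)
  qed
  have "?yi $ 1 $ 1 \<notin> D 1"
    using K_unit_in_column[OF K_inv[OF y], of 1] yi1 by (metis exhaust_3)
  moreover have "y $ l $ 1 * ?yi $ 1 $ 1 = - (y $ l $ 2 * ?yi $ 2 $ 1 + y $ l $ 3 * ?yi $ 3 $ 1)" if "l \<noteq> 1" for l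
  proof -
    have "(y ** ?yi) $ l $ 1 = 0" using that GL3_inv(1)[OF yG] by (simp add: mat_nth)
    then show ?thesis unfolding mat_mult3 by (simp add: eq_neg_iff_add_eq_0 algebra_simps)
  qed
  moreover have "y $ l $ 2 * ?yi $ 2 $ 1 + y $ l $ 3 * ?yi $ 3 $ 1 \<in> D 1" for l
    using yD yi1 by (intro D_add D_mult0(2)) auto
  ultimately have y1: "y $ l $ 1 \<in> D 1" if "l \<noteq> 1" for l
    using D_cancel_unit[of "?yi $ 1 $ 1" "y $ l $ 1" 1] that D_uminus by (metis mult.commute)
  \<comment> \<open>Dually, column 2 of z^-1 t^-1 loses only one power of \<pi>, while the term with
    the pivot (i, 3) of g^-1 loses two.\<close>
  have y32: "y $ 3 $ 2 \<in> D 1"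
  proof -
    have col: "(matrix_inv ?z ** t') $ i $ 2 \<in> D (b - 1)"
    proof -
      have "matrix_inv ?z $ i $ 2 \<in> D b" using L_nth[OF a'(2), of i 2] ab(3) a_eq by (metis add_diff_cancel_left')
      then have "matrix_inv ?z $ i $ 2 * inverse \<pi> \<in> D (b + - 1)" by (intro D_mult pi_D1)
      then show ?thesis using t'_col[of "matrix_inv ?z" i] by simp
    qed
    have 1: "matrix_inv g $ i $ 1 * y $ 1 $ 2 \<in> D (b - 1)"
      using D_mono[OF D_mult0(1)[OF gD(2) yD(1)], of "b - 1"] by simp
    have "matrix_inv g $ i $ 2 * inverse \<pi> \<in> D (b + - 1)" by (intro D_mult pi_D1 gD)
    then have 2: "matrix_inv g $ i $ 2 * inverse \<pi> * y $ 2 $ 2 \<in> D (b - 1)"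
      using D_mult0(1)[OF _ yD(1)] by simp
    have "\<pi> powi (- 2) * (matrix_inv g $ i $ 3 * y $ 3 $ 2)
        = (matrix_inv ?z ** t') $ i $ 2 - (matrix_inv g $ i $ 1 * y $ 1 $ 2 + matrix_inv g $ i $ 2 * inverse \<pi> * y $ 2 $ 2)"
      unfolding gi(1) by (simp add: mat_mult3 t'_def power_int_minus mult.commute mult.left_commute)
    also have "\<dots> \<in> D (b - 1)" by (intro D_diff D_add col 1 2)
    finally have "matrix_inv g $ i $ 3 * y $ 3 $ 2 \<in> D (b + 1)" unfolding pi_powi_mult_D by (simp add: add.commute)
    then show ?thesis using D_cancel[OF i] by blast
  qed
  have yI: "y \<in> Iw" using y K_L0 y1 y32 by (simp add: Iw_iff J0_iff)
  \<comment> \<open>Since y is now known to lie in the Iwahori subgroup, entry (3, 2) of its inverse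
    is a non-unit. A second pass improves entry (3, 1) from \<open>D 1\<close> to
    \<open>D 2\<close>, as \<open>tsubI\<close> requires.\<close>
  have "?yi $ 3 $ 2 * (\<pi> * g $ 2 $ j) \<in> D (1 + (a + 1))"
    using Iw_inv[OF yI] by (intro D_mult[OF _ pg(1)]) (simp add: Iw_iff J0_iff)
  then have "?yi $ 3 $ 2 * (\<pi> * g $ 2 $ j) \<in> D (a + 2)" by (simp add: add.commute)
  then have "?yi $ 3 $ 1 * g $ 1 $ j \<in> D (a + 2)"
    unfolding yi by (intro D_diff D_add row(2) D_mult0(2)[OF yD(2) pg(2)])
  then have "?yi $ 3 $ 1 \<in> D 2" using D_cancel[OF j, of "?yi $ 3 $ 1" 2] by (simp add: mult.commute)
  then have "matrix_inv ?yi \<in> tsub" using tsub_inv[OF tsubI[OF Iw_inv[OF yI]]] by simp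
  then show ?thesis using GL3_inv(4)[OF yG] by simp
qed

text \<open>The first pivot still bounds the scale of t g by a, while the second, multiplied by
  \<pi>^-2, worsens the bound on the inverse by two.\<close>

lemma t_height:
  assumes g: "g \<in> GL3" and ab: "a + b = - n"
    and j: "g $ 1 $ j \<notin> D (a + 1)" and i: "matrix_inv g $ i $ 3 \<notin> D (b + 1)"
  shows "\<not> bounded_height (n + 1) (t ** g)"
proof
  assume "bounded_height (n + 1) (t ** g)"
  then obtain a' where a': "t ** g \<in> L a'" "matrix_inv (t ** g) \<in> L (- (n + 1) - a')"
    unfolding bounded_height_def by blast
  from L_nth[OF a'(1), of 1 j] have "g $ 1 $ j \<in> D a'" by (simp add: t_def mat_mult3)
  then have "a' \<le> a" using j D_mono[of "g $ 1 $ j" a' "a + 1"] by linarith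
  have "matrix_inv (t ** g) = matrix_inv g ** t'" using matrix_inv_mult[OF t_GL3(1) g] t_GL3(3) by simp
  then have "\<pi> powi (- 2) * matrix_inv g $ i $ 3 \<in> D (- (n + 1) - a')"
    using L_nth[OF a'(2), of i 3] by (simp add: t'_def mat_mult3 power_int_minus mult.commute)
  then have "matrix_inv g $ i $ 3 \<in> D (- (n + 1) - a' + 2)" unfolding pi_powi_mult_D by simp
  then have "- (n + 1) - a' + 2 \<le> b"
    using i D_mono[of "matrix_inv g $ i $ 3" "- (n + 1) - a' + 2" "b + 1"] by linarith
  then show False using \<open>a' \<le> a\<close> ab by linarith
qed

text \<open>Row operations clear the column of the pivot. Then the pivot times entry (i, 1) of the
  inverse is 0 or 1, so for positive height that entry is not minimal, and operations on the last
  two rows alone move the minimum of row i of the inverse to column 3. Having the other entries more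
  divisible makes both pivots survive multiplication by the pro-p-Iwahori subgroup.\<close>

lemma adapted_translate_pos:
  assumes g: "g \<in> GL3" and ab: "g \<in> L a" "matrix_inv g \<in> L b" "a + b \<le> - 1"
    and "g \<notin> L (a + 1)" "matrix_inv g \<notin> L (b + 1)"
  shows "\<exists>k\<in>K. \<exists>i j. (k ** g) $ 1 $ j \<notin> D (a + 1) \<and> (k ** g) $ 2 $ j \<in> D (a + 1) \<and> (k ** g) $ 3 $ j \<in> D (a + 1) \<and>
    matrix_inv (k ** g) $ i $ 3 \<notin> D (b + 1) \<and> matrix_inv (k ** g) $ i $ 1 \<in> D (b + 1) \<and>
    matrix_inv (k ** g) $ i $ 2 \<in> D (b + 1)"
proof -
  obtain l j where lj: "g $ l $ j \<notin> D (a + 1)" using assms(5) by (auto simp: L_iff)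
  obtain i l' where il: "matrix_inv g $ i $ l' \<notin> D (b + 1)" using assms(6) by (auto simp: L_iff)
  have sK: "srefl s 0 \<in> K" for s by simp
  have "\<exists>k\<in>K. (k ** g) $ 1 $ j \<notin> D (a + 1)"
  proof -
    consider "l = 1" | "l = 2" | "l = 3" using exhaust_3 by blast
    then show ?thesis
    proof cases
      case 1 then show ?thesis using lj by (intro bexI[of _ "mat 1"]) simp_all
    next
      case 2 then show ?thesis using lj by (intro bexI[OF _ sK[of True]]) (simp add: srefl_def mat_mult3)
    next
      case 3 then show ?thesis using lj
        by (intro bexI[OF _ K_mult[OF sK[of True] sK[of False]]]) (simp add: srefl_def mat_mult3)
    qed
  qed
  then obtain k1 where k1: "k1 \<in> K" "(k1 ** g) $ 1 $ j \<notin> D (a + 1)" by blast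
  define h where "h = k1 ** g"
  have hL: "h \<in> L a" using ab(1) K_L_left[OF k1(1)] by (simp add: h_def)
  have h1: "h $ 1 $ j \<notin> D (a + 1)" "h $ 1 $ j \<noteq> 0" using k1(2) D_zero by (auto simp: h_def)
  define c where "c l = h $ l $ j / h $ 1 $ j" for l
  have c: "c l \<in> D 0" for l
    using D_cancel[OF h1(1), of "c l" 0] h1(2) L_nth[OF hL, of l j] by (simp add: c_def)
  let ?l = "mat3 1 0 0 (- c 2) 1 0 (- c 3) 0 1" and ?l' = "mat3 1 0 0 (c 2) 1 0 (c 3) 0 1"
  have lK: "?l \<in> K" by (rule K_I[of _ ?l']) (simp_all add: L_iff3 c mat3_eq_iff mat_mult3 mat_nth)
  define k2 where "k2 = ?l ** k1"
  have k2: "k2 \<in> K" using K_mult[OF lK k1(1)] by (simp add: k2_def)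
  have "k2 ** g = ?l ** h" by (simp add: k2_def h_def matrix_mul_assoc)
  then have k2g: "(k2 ** g) $ 1 $ j \<notin> D (a + 1)" "(k2 ** g) $ 2 $ j = 0" "(k2 ** g) $ 3 $ j = 0"
    using h1 by (simp_all add: mat_mult3 c_def)
  have inv_eq: "matrix_inv (k ** g) = matrix_inv g ** matrix_inv k" if "k \<in> K" for k
    by (rule matrix_inv_mult[OF K_GL3[OF that] g])
  let ?w = "matrix_inv (k2 ** g)"
  have wL: "?w \<in> L b" using inv_eq[OF k2] K_L_right[OF K_inv[OF k2]] ab(2) by simp
  have k2gG: "k2 ** g \<in> GL3" by (rule GL3_mult[OF K_GL3[OF k2] g])
  have w1: "?w $ i $ 1 \<in> D (b + 1)"
  proof -
    have "(?w ** (k2 ** g)) $ i $ j = (if i = j then 1 else 0)" using GL3_inv(2)[OF k2gG] by (simp add: mat_nth)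
    then have "(k2 ** g) $ 1 $ j * ?w $ i $ 1 = (if i = j then 1 else 0)"
      unfolding mat_mult3[of ?w] using k2g by (simp add: mult.commute)
    \<comment> \<open>Positive height enters here: a + b \<le> -1 puts 1 into
      \<open>D (a + b + 1)\<close>.\<close>
    moreover have "(if i = j then 1 else 0) \<in> D (a + (b + 1))" using ab(3) by (simp add: one_D)
    ultimately show ?thesis using D_cancel[OF k2g(1), of "?w $ i $ 1" "b + 1"] by simp
  qed
  have "?w $ i $ 2 \<notin> D (b + 1) \<or> ?w $ i $ 3 \<notin> D (b + 1)"
  proof (rule ccontr)
    assume "\<not> (?w $ i $ 2 \<notin> D (b + 1) \<or> ?w $ i $ 3 \<notin> D (b + 1))"
    then have "(?w ** k2) $ i $ l' \<in> D (b + 1)"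
      unfolding mat_mult3[of ?w] using w1 K_D0[OF k2] by (intro D_add D_mult0(1)) auto
    moreover have "?w ** k2 = matrix_inv g" unfolding inv_eq[OF k2] by (rule GL3_inv_cancel(4)[OF K_GL3[OF k2]])
    ultimately show False using il by simp
  qed
  moreover have "\<exists>k\<in>K. (k ** g) $ 1 $ j \<notin> D (a + 1) \<and> (k ** g) $ 2 $ j = 0 \<and> (k ** g) $ 3 $ j = 0 \<and>
      matrix_inv (k ** g) $ i $ 1 \<in> D (b + 1) \<and> matrix_inv (k ** g) $ i $ 3 \<notin> D (b + 1)"
    if "?w $ i $ 2 \<notin> D (b + 1)"
  proof (intro bexI conjI)
    show kK: "srefl False 0 ** k2 \<in> K" by (rule K_mult[OF sK k2])
    have e: "srefl False 0 ** k2 ** g = srefl False 0 ** (k2 ** g)" by (simp add: matrix_mul_assoc)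
    have "srefl_inv False 0 = (srefl False 0 :: 'f ^ 3 ^ 3)" by (simp add: srefl_def srefl_inv_def)
    then have "matrix_inv (srefl False 0 :: 'f ^ 3 ^ 3) = srefl False 0"
      using matrix_inv_unique(1)[OF srefl_srefl_inv(1), of False "0 :: 'f"] by simp
    then have "matrix_inv (srefl False 0 ** (k2 ** g)) = ?w ** srefl False 0"
      using matrix_inv_mult[OF K_GL3[OF sK[of False]] k2gG] by simp
    then show "matrix_inv (srefl False 0 ** k2 ** g) $ i $ 1 \<in> D (b + 1)"
      "matrix_inv (srefl False 0 ** k2 ** g) $ i $ 3 \<notin> D (b + 1)"
      unfolding e using w1 that by (simp_all add: mat_mult3[of ?w] srefl_def)
    show "(srefl False 0 ** k2 ** g) $ 1 $ j \<notin> D (a + 1)" "(srefl False 0 ** k2 ** g) $ 2 $ j = 0"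
      "(srefl False 0 ** k2 ** g) $ 3 $ j = 0"
      unfolding e srefl_False_rows using k2g by simp_all
  qed
  ultimately obtain k3 where k3: "k3 \<in> K" "(k3 ** g) $ 1 $ j \<notin> D (a + 1)" "(k3 ** g) $ 2 $ j = 0" "(k3 ** g) $ 3 $ j = 0"
      "matrix_inv (k3 ** g) $ i $ 1 \<in> D (b + 1)" "matrix_inv (k3 ** g) $ i $ 3 \<notin> D (b + 1)"
    using k2 k2g w1 by blast
  let ?u = "matrix_inv (k3 ** g)"
  have uL: "?u \<in> L b" using inv_eq[OF k3(1)] K_L_right[OF K_inv[OF k3(1)]] ab(2) by simp
  have u0: "?u $ i $ 3 \<noteq> 0" using k3(6) D_zero by auto
  define d where "d = ?u $ i $ 2 / ?u $ i $ 3"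
  have d: "d \<in> D 0" using D_cancel[OF k3(6), of d 0] u0 L_nth[OF uL, of i 2] by (simp add: d_def)
  let ?e = "mat3 1 0 0 0 1 0 0 d 1" and ?e' = "mat3 1 0 0 0 1 0 0 (- d) 1"
  have ee: "?e ** ?e' = mat 1" by (simp add: mat3_eq_iff mat_mult3 mat_nth)
  have eK: "?e \<in> K" by (rule K_I[OF _ _ ee]) (simp_all add: L_iff3 d)
  have k3gG: "k3 ** g \<in> GL3" by (rule GL3_mult[OF K_GL3[OF k3(1)] g])
  have e: "?e ** k3 ** g = ?e ** (k3 ** g)" by (simp add: matrix_mul_assoc)
  have ei: "matrix_inv (?e ** (k3 ** g)) = ?u ** ?e'"
    using matrix_inv_mult[OF K_GL3[OF eK] k3gG] matrix_inv_unique(1)[OF ee] by simp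
  have du: "?u $ i $ 2 = ?u $ i $ 3 * d" using u0 by (simp add: d_def)
  have col: "(?u ** ?e') $ i $ 1 = ?u $ i $ 1" "(?u ** ?e') $ i $ 2 = 0" "(?u ** ?e') $ i $ 3 = ?u $ i $ 3"
    unfolding mat_mult3[of ?u] using du by simp_all
  have row: "(?e ** (k3 ** g)) $ 1 $ j = (k3 ** g) $ 1 $ j" "(?e ** (k3 ** g)) $ 2 $ j = 0" "(?e ** (k3 ** g)) $ 3 $ j = 0"
    unfolding mat_mult3[of ?e] using k3(3,4) by simp_all
  show ?thesis
    by (rule bexI[of _ "?e ** k3"], rule exI[of _ i], rule exI[of _ j])
      (unfold e ei col row, simp_all add: k3 K_mult[OF eK k3(1)])
qed

lemma adapted_translate:
  assumes n: "bounded_height n g" "\<not> bounded_height (n - 1) g"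
  shows "\<exists>k\<in>K. \<exists>a b i j. k ** g \<in> L a \<and> matrix_inv (k ** g) \<in> L b \<and> a + b = - n \<and>
    (k ** g) $ 1 $ j \<notin> D (a + 1) \<and> (k ** g) $ 2 $ j \<in> D (a + 1) \<and> (k ** g) $ 3 $ j \<in> D (a + 1) \<and>
    matrix_inv (k ** g) $ i $ 3 \<notin> D (b + 1) \<and> matrix_inv (k ** g) $ i $ 1 \<in> D (b + 1) \<and>
    matrix_inv (k ** g) $ i $ 2 \<in> D (b + 1)"
proof -
  obtain a where g: "g \<in> GL3" "g \<in> L a" "matrix_inv g \<in> L (- n - a)" using n(1) unfolding bounded_height_def by blast
  define b where "b = - n - a"
  have nb: "\<not> (g \<in> L a' \<and> matrix_inv g \<in> L (- (n - 1) - a'))" for a'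
    using n(2) g(1) unfolding bounded_height_def by blast
  have "- (n - 1) - (a + 1) = - n - a" by simp
  \<comment> \<open>Otherwise \<open>a + 1\<close>, with the same bound on the inverse, would
    witness height n - 1.\<close>
  then have n1: "g \<notin> L (a + 1)" using nb[of "a + 1"] g(3) by (simp only: not_False_eq_True simp_thms)
  have n2: "matrix_inv g \<notin> L (b + 1)" using nb[of a] g(2) by (simp add: b_def algebra_simps)
  show ?thesis
  proof (cases "n = 0")
    case False
    then have "a + b \<le> - 1" using bounded_height_nonneg[OF n(1)] by (simp add: b_def)
    then obtain k i j where k: "k \<in> K" "(k ** g) $ 1 $ j \<notin> D (a + 1)" "(k ** g) $ 2 $ j \<in> D (a + 1)" "(k ** g) $ 3 $ j \<in> D (a + 1)"
        "matrix_inv (k ** g) $ i $ 3 \<notin> D (b + 1)" "matrix_inv (k ** g) $ i $ 1 \<in> D (b + 1)" "matrix_inv (k ** g) $ i $ 2 \<in> D (b + 1)"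
      using adapted_translate_pos[OF g(1,2) _ _ n1 n2] g(3) unfolding b_def by blast
    have "k ** g \<in> L a" using g(2) K_L_left[OF k(1)] by simp
    moreover have "matrix_inv (k ** g) \<in> L b"
      using matrix_inv_mult[OF K_GL3[OF k(1)] g(1)] K_L_right[OF K_inv[OF k(1)]] g(3) by (simp add: b_def)
    moreover have "a + b = - n" by (simp add: b_def)
    ultimately show ?thesis using k by blast
  next
    case True
    \<comment> \<open>A matrix of height 0 lies in KZ, so some translate is scalar; its corners (1,
      1) and (3, 3) supply the pivots.\<close>
    have p: "inverse (\<pi> powi a) = \<pi> powi (- a)" by (simp add: power_int_minus)
    let ?k = "mat (\<pi> powi a) ** matrix_inv g"
    have e: "?k ** g = mat (\<pi> powi a)" by (rule GL3_inv_cancel(4)[OF g(1)])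
    have zi: "matrix_inv (mat (\<pi> powi a) :: 'f ^ 3 ^ 3) = mat (\<pi> powi (- a))"
      using matrix_inv_scalar[of "\<pi> powi a"] by (simp add: p)
    have kK: "?k \<in> K"
    proof (rule K_I)
      show "?k \<in> L 0" using L_scalar[of "\<pi> powi a" a "matrix_inv g" "- a"] g(3) True
        by (simp add: pi_powi_D mat_scalar_commute)
      show "g ** mat (\<pi> powi (- a)) \<in> L 0" using L_scalar[of "\<pi> powi (- a)" "- a" g a] g(2) by (simp add: pi_powi_D)
      have "?k ** (g ** mat (\<pi> powi (- a))) = mat (\<pi> powi a) ** mat (\<pi> powi (- a))"
        using e by (simp add: matrix_mul_assoc)
      then show "?k ** (g ** mat (\<pi> powi (- a))) = mat 1" by (simp add: mat_mat_mult power_int_minus)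
    qed
    have "\<pi> powi a \<notin> D (a + 1)" "\<pi> powi (- a) \<notin> D (- a + 1)" by (simp_all add: pi_powi_D)
    moreover have "mat (\<pi> powi a) \<in> L a" "mat (\<pi> powi (- a)) \<in> L (- a)" by (simp_all add: L_iff3 mat_nth pi_powi_D)
    moreover have "a + - a = - n" using True by simp
    ultimately show ?thesis
      by (intro bexI[OF _ kK] exI[of _ a] exI[of _ "- a"] exI[of _ 3] exI[of _ 1]) (simp add: e zi mat_nth)
  qed
qed

end

section \<open>Leading terms: non-vanishing in general, vanishing on the wall\<close>

context weight_line
begin

text \<open>The vectors whose whole orbit under the pro-p-Iwahori subgroup is killed by
  \<open>\<phi>\<close> form a stable subspace. If it were nonzero, it would contain an invariant
  vector, hence \<open>m\<close>, on which \<open>\<phi>\<close> is 1.\<close>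

lemma \<phi>_nonvanishing: "w \<noteq> 0 \<Longrightarrow> \<exists>u\<in>Iwr 1. \<phi> (\<sigma> u w) \<noteq> 0"
proof (rule ccontr)
  assume w: "w \<noteq> 0" and no: "\<not> (\<exists>u\<in>Iwr 1. \<phi> (\<sigma> u w) \<noteq> 0)"
  let ?S = "{x. \<forall>u\<in>Iwr 1. \<phi> (\<sigma> u x) = 0}"
  have sub: "V.subspace ?S"
    by (rule V.subspaceI) (simp_all add: sg_add sg_scale sg_zero \<phi>_add \<phi>_scale \<phi>_zero Iwr_K)
  have "\<sigma> g x \<in> ?S" if "g \<in> Iwr 1" "x \<in> ?S" for g x
  proof -
    have "\<phi> (\<sigma> u (\<sigma> g x)) = 0" if u: "u \<in> Iwr 1" for u
    proof -
      have "u ** g \<in> Iwr 1" using Iwr_mult[OF u \<open>g \<in> Iwr 1\<close>] by simp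
      then have "\<phi> (\<sigma> (u ** g) x) = 0" using \<open>x \<in> ?S\<close> by blast
      then show ?thesis using sg_mult[OF Iwr_K[OF u] Iwr_K[OF \<open>g \<in> Iwr 1\<close>], of x] by simp
    qed
    then show ?thesis by simp
  qed
  then obtain x where x: "x \<in> ?S" "x \<noteq> 0" "x \<in> inv1" using exists_inv1_in[OF sub, of w] w no by blast
  then obtain c where c: "x = smul c m" using inv1_line by blast
  have "\<phi> (\<sigma> (mat 1) x) = 0" using x(1) Iwr_one by blast
  then have "c = 0" by (simp add: c \<phi>_scale \<phi>_m)
  then show False using x(2) c by simp
qed

text \<open>At a support point of maximal distance, adapted coordinates leave only the term y = 1 of
  the sum at t g, which is a value of \<open>\<phi>\<close> times \<open>m\<close>. A translation by
  the pro-p-Iwahori subgroup makes this value nonzero and keeps both pivots.\<close>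

lemma Top_leading:
  assumes f: "f \<in> W" "f \<noteq> 0"
  obtains n g where "\<And>h. f h \<noteq> 0 \<Longrightarrow> bounded_height n h" "Top f g \<noteq> 0" "\<not> bounded_height (n + 1) g"
proof -
  define P where "P n \<longleftrightarrow> (\<forall>h. f h \<noteq> 0 \<longrightarrow> bounded_height (int n) h)" for n
  obtain g1 where g1: "f g1 \<noteq> 0" using f(2) by (auto simp: fun_eq_iff)
  obtain n0 where "\<forall>h. f h \<noteq> 0 \<longrightarrow> bounded_height n0 h" using f(1) unfolding W_iff by blast
  then have "P (nat n0)" using bounded_height_mono[of n0 _ "int (nat n0)"] by (auto simp: P_def)
  define n where "n = (LEAST n. P n)"
  have Pn: "P n" unfolding n_def by (rule LeastI) fact
  have "\<exists>g0. f g0 \<noteq> 0 \<and> \<not> bounded_height (int n - 1) g0"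
  proof (rule ccontr)
    assume a: "\<not> (\<exists>g0. f g0 \<noteq> 0 \<and> \<not> bounded_height (int n - 1) g0)"
    then have "bounded_height (int n - 1) g1" using g1 by blast
    then have "n \<ge> 1" using bounded_height_nonneg[of "int n - 1" g1] by simp
    then have "P (n - 1)" using a unfolding P_def by (auto simp: of_nat_diff)
    then have "n \<le> n - 1" unfolding n_def by (rule Least_le)
    then show False using \<open>n \<ge> 1\<close> by simp
  qed
  then obtain g0 where g0: "f g0 \<noteq> 0" "\<not> bounded_height (int n - 1) g0" by blast
  have b0: "bounded_height (int n) g0" using Pn g0(1) by (simp add: P_def)
  note gG = bounded_height_GL3[OF b0]
  obtain k a b i j where k: "k \<in> K" and h: "k ** g0 \<in> L a" "matrix_inv (k ** g0) \<in> L b" "a + b = - int n"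
      "(k ** g0) $ 1 $ j \<notin> D (a + 1)" "(k ** g0) $ 2 $ j \<in> D (a + 1)" "(k ** g0) $ 3 $ j \<in> D (a + 1)"
      "matrix_inv (k ** g0) $ i $ 3 \<notin> D (b + 1)" "matrix_inv (k ** g0) $ i $ 1 \<in> D (b + 1)"
      "matrix_inv (k ** g0) $ i $ 2 \<in> D (b + 1)"
    using adapted_translate[OF b0 g0(2)] by blast
  define h0 where "h0 = k ** g0"
  have hG: "h0 \<in> GL3" unfolding h0_def by (rule GL3_mult[OF K_GL3[OF k] gG])
  have "f h0 = \<sigma> k (f g0)" unfolding h0_def by (rule W_K[OF f(1) k gG])
  then have "f h0 \<noteq> 0" using sg_eq_zero[OF k] g0(1) by simp
  then obtain u where u: "u \<in> Iwr 1" "\<phi> (\<sigma> u (f h0)) \<noteq> 0" using \<phi>_nonvanishing by blast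
  note uK = Iwr_K[OF u(1)] and uI = Iwr_Iw[OF u(1)]
  define g where "g = u ** h0"
  have gG': "g \<in> GL3" unfolding g_def by (rule GL3_mult[OF K_GL3[OF uK] hG])
  have gi: "matrix_inv g = matrix_inv h0 ** matrix_inv u" unfolding g_def by (rule matrix_inv_mult[OF K_GL3[OF uK] hG])
  have gL: "g \<in> L a" "matrix_inv g \<in> L b"
    unfolding gi unfolding g_def h0_def using h K_L_left[OF uK] K_L_right[OF K_inv[OF uK]] by simp_all
  have uD: "u $ p $ q \<in> D 0" "matrix_inv u $ p $ q \<in> D 0" for p q using K_D0 uK K_inv by blast+
  \<comment> \<open>To row 1 the matrix u adds only multiples of rows 2 and 3, whose entries in
    column j are more divisible than the pivot.\<close>
  have gj: "g $ 1 $ j \<notin> D (a + 1)"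
  proof
    assume "g $ 1 $ j \<in> D (a + 1)"
    moreover have "u $ 1 $ 2 * h0 $ 2 $ j + u $ 1 $ 3 * h0 $ 3 $ j \<in> D (a + 1)"
      using h uD by (intro D_add D_mult0(2)) (auto simp: h0_def)
    ultimately have "g $ 1 $ j - (u $ 1 $ 2 * h0 $ 2 $ j + u $ 1 $ 3 * h0 $ 3 $ j) \<in> D (a + 1)" by (rule D_diff)
    then have "u $ 1 $ 1 * h0 $ 1 $ j \<in> D (a + 1)" by (simp add: g_def mat_mult3[of u])
    then show False using D_cancel_unit[OF Iw_diag_unit[OF uI]] h(4) by (simp add: h0_def)
  qed
  have gi3: "matrix_inv g $ i $ 3 \<notin> D (b + 1)"
  proof
    let ?w = "matrix_inv h0" and ?v = "matrix_inv u"
    assume "matrix_inv g $ i $ 3 \<in> D (b + 1)"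
    moreover have "?w $ i $ 1 * ?v $ 1 $ 3 + ?w $ i $ 2 * ?v $ 2 $ 3 \<in> D (b + 1)"
      using h uD by (intro D_add D_mult0(1)) (auto simp: h0_def)
    ultimately have "matrix_inv g $ i $ 3 - (?w $ i $ 1 * ?v $ 1 $ 3 + ?w $ i $ 2 * ?v $ 2 $ 3) \<in> D (b + 1)" by (rule D_diff)
    then have "?v $ 3 $ 3 * ?w $ i $ 3 \<in> D (b + 1)" by (simp add: gi mat_mult3[of ?w] mult.commute)
    then show False using D_cancel_unit[OF Iw_diag_unit[OF Iw_inv[OF uI]]] h(7) by (simp add: h0_def)
  qed
  have "Top f (t ** g) = kernel_term f (t ** g) (mat 1)"
    unfolding Top_eq[OF f(1)]
  proof (rule class_sum_single[OF kernel_class_function[OF f(1)] K_one])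
    fix y assume y: "y \<in> K" "kernel_term f (t ** g) y \<noteq> 0"
    have "f (t' ** matrix_inv y ** (t ** g)) \<noteq> 0" using y(2) \<phi>_zero by (auto simp: kernel_term_def)
    then have "bounded_height (int n) (t' ** matrix_inv y ** (t ** g))" using Pn by (simp add: P_def)
    then have "y \<in> tsub" by (rule unique_neighbour[OF gG' gL h(3) gj gi3 y(1)])
    then show "tcoset y = tcoset (mat 1)" using tcoset_eq_iff[OF K_one y(1)] by simp
  qed
  also have "\<dots> = smul (\<phi> (\<sigma> u (f h0))) m"
    using W_K[OF f(1) uK hG] by (simp add: kernel_term_def t_cancel g_def)
  finally have "Top f (t ** g) \<noteq> 0" using u(2) m_nonzero by simp
  moreover have "\<not> bounded_height (int n + 1) (t ** g)" by (rule t_height[OF gG' h(3) gj gi3])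
  moreover have "\<And>h. f h \<noteq> 0 \<Longrightarrow> bounded_height (int n) h" using Pn by (simp add: P_def)
  ultimately show thesis using that by blast
qed

text \<open>A contributing neighbour of height N - 2 must have scale exactly 0, so rows 2 and 3 of
  y^-1 times \<open>xdiag N\<close> are divisible by \<pi>. The first two columns of
  \<open>xdiag N\<close> are unit vectors, so a 2 by 2 block of y^-1 vanishes in the residue field,
  which makes y^-1 singular there.\<close>

lemma Top_xdiag_zero:
  assumes "\<And>h. f h \<noteq> 0 \<Longrightarrow> bounded_height (int N - 2) h"
  shows "Top f (xdiag N) = 0"
proof (rule ccontr)
  assume "Top f (xdiag N) \<noteq> 0"
  then obtain y where y: "y \<in> K" "f (t' ** matrix_inv y ** xdiag N) \<noteq> 0" by (rule Top_nonzero_term)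
  let ?z = "t' ** matrix_inv y ** xdiag N" and ?yi = "matrix_inv y"
  note yG = K_GL3[OF y(1)]
  have zb: "bounded_height (int N - 2) ?z" by (rule assms[OF y(2)])
  then obtain a where a: "?z \<in> L a" "matrix_inv ?z \<in> L (- (int N - 2) - a)" unfolding bounded_height_def by blast
  have xz: "y ** (t ** ?z) = xdiag N" "?yi ** xdiag N = t ** ?z"
    using GL3_inv_cancel(1)[OF yG, of "xdiag N"] by (simp_all add: t_cancel matrix_mul_assoc[symmetric])
  have "xdiag N \<in> L a" using L_mult0(1)[OF K_L0[OF y(1)] L_mult0(1)[OF t_L(1) a(1)]] unfolding xz(1) .
  from L_nth[OF this, of 1 1] have "a \<le> 0" by (simp add: xdiag_def one_D)
  moreover have "matrix_inv ?z = xdiag' N ** y ** t"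
    using matrix_inv_mult[OF GL3_mult[OF t_GL3(2) GL3_inv(3)[OF yG]] xdiag_GL3(1)]
      matrix_inv_mult[OF t_GL3(2) GL3_inv(3)[OF yG]] GL3_inv(4)[OF yG] t_GL3 xdiag_GL3 by (simp add: matrix_mul_assoc)
  then have "matrix_inv ?z ** t' ** ?yi = xdiag' N" using GL3_inv_cancel(3)[OF yG] by (simp add: t_cancel)
  then have "xdiag' N \<in> L (- (int N - 2) - a + - 2)"
    using L_mult0(2)[OF L_mult[OF a(2) t_L(2)] K_L0[OF K_inv[OF y(1)]]] by simp
  from L_nth[OF this, of 3 3] have "a \<ge> 0" by (simp add: xdiag'_def pi_power_D)
  ultimately have a0: "a = 0" by simp
  have "(t ** ?z) $ 2 $ j \<in> D 1" "(t ** ?z) $ 3 $ j \<in> D 1" for j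
    using D_mult0(1)[OF pi_D1(1), of "?z $ 2 $ j"] D_mult0(1)[OF D_mono[OF pi_D1(2), of 1], of "?z $ 3 $ j"]
      L_nth[OF a(1)[unfolded a0]] by (simp_all add: t_def mat_mult3[of "mat3 1 0 0 0 \<pi> 0 0 0 (\<pi>\<^sup>2)"])
  then have "(?yi ** xdiag N) $ 2 $ j \<in> D 1" "(?yi ** xdiag N) $ 3 $ j \<in> D 1" for j unfolding xz(2) by blast+
  from this(1)[of 1] this(1)[of 2] this(2)[of 1] this(2)[of 2]
  have c: "?yi $ 2 $ 1 \<in> D 1" "?yi $ 2 $ 2 \<in> D 1" "?yi $ 3 $ 1 \<in> D 1" "?yi $ 3 $ 2 \<in> D 1"
    by (simp_all add: mat_mult3[of ?yi] xdiag_def)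
  have yD: "y $ k $ l \<in> D 0" "?yi $ k $ l \<in> D 0" for k l using y(1) K_inv K_D0 by blast+
  have "y $ 3 $ 2 \<notin> D 1"
  proof
    assume "y $ 3 $ 2 \<in> D 1"
    then have "(?yi ** y) $ 2 $ 2 \<in> D 1" unfolding mat_mult3 using c yD by (auto intro!: D_add D1_multI)
    then show False using GL3_inv(2)[OF yG] by (simp add: mat_nth)
  qed
  moreover have "?yi $ 3 $ 1 * y $ 1 $ 2 + ?yi $ 3 $ 2 * y $ 2 $ 2 \<in> D 1"
    using c yD by (auto intro!: D_add D1_multI)
  moreover have "(?yi ** y) $ 3 $ 2 = 0" using GL3_inv(2)[OF yG] by (simp add: mat_nth)
  then have "y $ 3 $ 2 * ?yi $ 3 $ 3 = - (?yi $ 3 $ 1 * y $ 1 $ 2 + ?yi $ 3 $ 2 * y $ 2 $ 2)"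
    unfolding mat_mult3 by (simp add: eq_neg_iff_add_eq_0 algebra_simps)
  ultimately have "?yi $ 3 $ 3 \<in> D 1" using D_cancel_unit D_uminus by metis
  then show False using K_unit_in_row[OF K_inv[OF y(1)], of 3] c by (metis exhaust_3)
qed

end

section \<open>Eigenfunctions supported on single double cosets\<close>

context uniformized_field
begin

lemma KZ_mult: "g \<in> KZ \<Longrightarrow> h \<in> KZ \<Longrightarrow> g ** h \<in> KZ"
proof -
  assume "g \<in> KZ" "h \<in> KZ"
  then obtain a c b d where "a \<in> K" "c \<noteq> 0" "g = a ** mat c" "b \<in> K" "d \<noteq> 0" "h = b ** mat d"
    by (auto simp: times_center_def)
  then have "g ** h = (a ** b) ** mat (c * d)" "a ** b \<in> K" "c * d \<noteq> 0"
    by (simp_all add: scalar_mult_swap K_mult)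
  then show ?thesis unfolding times_center_def by blast
qed

lemma inv_scalar_mult:
  assumes "h \<in> GL3"
  shows "matrix_inv (h ** mat (\<pi> powi r)) = matrix_inv h ** mat (\<pi> powi (- r))"
proof -
  have "(mat (\<pi> powi r) :: 'f ^ 3 ^ 3) \<in> GL3" by (rule GL3_scalar) simp
  then have "matrix_inv (h ** mat (\<pi> powi r)) = mat (inverse (\<pi> powi r)) ** matrix_inv h"
    using matrix_inv_mult[OF assms] matrix_inv_scalar[of "\<pi> powi r"] by simp
  then show ?thesis by (simp add: power_int_minus mat_scalar_commute)
qed

lemma KZ_inv: "g \<in> KZ \<Longrightarrow> matrix_inv g \<in> KZ"
proof -
  assume "g \<in> KZ"
  then obtain h n where "h \<in> K" "g = h ** mat (\<pi> powi n)" by (rule KZ_cases)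
  then show ?thesis using inv_scalar_mult[OF K_GL3] times_centerI[OF K_inv] by simp
qed

lemma xdiag_conj_le:
  assumes "h \<in> K" "l \<in> Iw" "h ** mat (\<pi> powi r) ** xdiag N = xdiag N ** (l ** mat (\<pi> powi s))"
  shows "r \<le> s"
proof -
  have "(h ** mat (\<pi> powi r) ** xdiag N) $ 1 $ 1 = \<pi> powi r * h $ 1 $ 1"
    by (simp add: mat_mult3[of "h ** mat (\<pi> powi r)"] mat_mult_scalar xdiag_def)
  moreover have "(xdiag N ** (l ** mat (\<pi> powi s))) $ 1 $ 1 = \<pi> powi s * l $ 1 $ 1"
    by (simp add: mat_mult3[of _ "l ** mat (\<pi> powi s)"] mat_mult_scalar xdiag_def)
  ultimately have "\<pi> powi s * l $ 1 $ 1 = \<pi> powi r * h $ 1 $ 1" using assms(3) by simp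
  moreover have "\<pi> powi r * h $ 1 $ 1 \<in> D r" unfolding pi_powi_mult_D using K_D0[OF assms(1)] by simp
  ultimately have "l $ 1 $ 1 \<in> D (r - s)" unfolding pi_powi_mult_D[symmetric] by simp
  then show ?thesis using Iw_diag_unit[OF assms(2), of 1] D_mono[of "l $ 1 $ 1" "r - s" 1] by linarith
qed

text \<open>Comparing corner entries, also for the inverses, shows that the central factors agree.
  Then h is the conjugate of l by \<open>xdiag N\<close>, which fixes the diagonal and keeps the
  entries below it in the maximal ideal. So h and l act alike on \<open>m\<close>, as the
  eigenfunctions below require.\<close>

lemma xdiag_conj:
  assumes h: "h \<in> K" and l: "l \<in> Iw" and eq: "h ** mat (\<pi> powi r) ** xdiag N = xdiag N ** (l ** mat (\<pi> powi s))"
  shows "h \<in> Iw" "h - l \<in> J 1"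
proof -
  let ?x = "xdiag N" and ?H = "h ** mat (\<pi> powi r)" and ?M = "l ** mat (\<pi> powi s)"
  note hG = K_GL3[OF h] and lG = K_GL3[OF Iw_K[OF l]]
  have HG: "?H \<in> GL3" and MG: "?M \<in> GL3" using hG lG by (simp_all add: GL3_mult GL3_scalar)
  have "matrix_inv ?H ** ?x = ?x ** matrix_inv ?M"
  proof -
    have "matrix_inv ?H ** (?H ** ?x) ** matrix_inv ?M = matrix_inv ?H ** (?x ** ?M) ** matrix_inv ?M"
      using eq by simp
    then have "?x ** matrix_inv ?M = matrix_inv ?H ** (?x ** ?M ** matrix_inv ?M)"
      unfolding GL3_inv_cancel(2)[OF HG] by (simp add: matrix_mul_assoc)
    then show ?thesis unfolding GL3_inv_cancel(3)[OF MG] by simp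
  qed
  then have "- r \<le> - s"
    unfolding inv_scalar_mult[OF hG] inv_scalar_mult[OF lG]
    by (rule xdiag_conj_le[OF K_inv[OF h] Iw_inv[OF l]])
  moreover have "r \<le> s" by (rule xdiag_conj_le[OF h l eq])
  ultimately have rs: "r = s" by simp
  have "(?H ** ?x) $ i $ j = \<pi> powi s * (h ** ?x) $ i $ j" for i j
    unfolding rs mat_mult3[of "h ** mat (\<pi> powi s)"] mat_mult3[of h] mat_mult_scalar by (simp add: algebra_simps)
  moreover have "(?x ** ?M) $ i $ j = \<pi> powi s * (?x ** l) $ i $ j" for i j
    unfolding mat_mult3[of ?x] mat_mult_scalar by (simp add: algebra_simps)
  ultimately have e: "(h ** ?x) $ i $ j = (?x ** l) $ i $ j" for i j using eq by simp
  have hx: "h $ i $ 1 = (?x ** l) $ i $ 1" "h $ i $ 2 = (?x ** l) $ i $ 2" "\<pi> ^ N * h $ i $ 3 = (?x ** l) $ i $ 3" for i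
    unfolding e[symmetric] by (simp_all add: mat_mult3 xdiag_def mult.commute)
  have xl: "(?x ** l) $ 1 $ j = l $ 1 $ j" "(?x ** l) $ 2 $ j = l $ 2 $ j" "(?x ** l) $ 3 $ j = \<pi> ^ N * l $ 3 $ j" for j
    by (simp_all add: mat_mult3 xdiag_def)
  have d: "h $ 1 $ 1 = l $ 1 $ 1" "h $ 2 $ 2 = l $ 2 $ 2" "h $ 3 $ 3 = l $ 3 $ 3"
    using hx(1)[of 1] hx(2)[of 2] hx(3)[of 3] by (simp_all add: xl)
  have lJ: "l $ 2 $ 1 \<in> D 1" "l $ 3 $ 1 \<in> D 1" "l $ 3 $ 2 \<in> D 1" using l by (simp_all add: Iw_iff J0_iff)
  have pN: "\<pi> ^ N \<in> D 0" by (simp add: pi_power_D)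
  have "h $ 2 $ 1 \<in> D 1" "h $ 3 $ 1 \<in> D 1" "h $ 3 $ 2 \<in> D 1"
    unfolding hx xl using lJ D_mult0(2)[OF pN] by simp_all
  then show hI: "h \<in> Iw" using h K_L0 by (simp add: Iw_iff J0_iff)
  show "h - l \<in> J 1" using hI l by (auto simp: J1_iff Iw_iff d intro: J_diff)
qed

end

context weight_line
begin

definition cell :: "nat \<Rightarrow> 'f ^ 3 ^ 3 \<Rightarrow> ('f ^ 3 ^ 3) \<times> ('f ^ 3 ^ 3) \<Rightarrow> bool" where
  "cell N g p \<longleftrightarrow> fst p \<in> KZ \<and> snd p \<in> IZ \<and> g = fst p ** xdiag N ** snd p"

text \<open>The function on the double coset of \<open>xdiag N\<close> with value \<open>m\<close>
  at \<open>xdiag N\<close>, equivariant under KZ on the left and under the character of IZ on the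
  right. The choice of decomposition is harmless by \<open>cell_unique\<close>.\<close>

definition cell_fun :: "nat \<Rightarrow> 'f ^ 3 ^ 3 \<Rightarrow> 'v" where
  "cell_fun N g = (if \<exists>p. cell N g p then smul (chi (snd (SOME p. cell N g p))) (ext (fst (SOME p. cell N g p)) m) else 0)"

lemma cell_unique:
  assumes "cell N g p" "cell N g q"
  shows "smul (chi (snd p)) (ext (fst p) m) = smul (chi (snd q)) (ext (fst q) m)"
proof -
  obtain k i where p: "p = (k, i)" by (cases p)
  obtain k' i' where q: "q = (k', i')" by (cases q)
  have k: "k \<in> KZ" "k' \<in> KZ" and i: "i \<in> IZ" "i' \<in> IZ" and eq: "k ** xdiag N ** i = k' ** xdiag N ** i'"
    using assms by (auto simp: cell_def p q)
  note kG = k[THEN KZ_GL3] and iG = i[THEN IZ_GL3]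
  define h where "h = matrix_inv k' ** k"
  define l where "l = i' ** matrix_inv i"
  have h: "h \<in> KZ" and l: "l \<in> IZ" using k i by (simp_all add: h_def l_def KZ_mult KZ_inv IZ_mult IZ_inv)
  have hk: "k = k' ** h" "l ** i = i'"
    using GL3_inv_cancel(1)[OF kG(2)] GL3_inv_cancel(4)[OF iG(1)] by (simp_all add: h_def l_def)
  have "matrix_inv k' ** (k ** xdiag N ** i) ** matrix_inv i = matrix_inv k' ** (k' ** xdiag N ** i') ** matrix_inv i"
    using eq by simp
  moreover have "matrix_inv k' ** (k ** xdiag N ** i) ** matrix_inv i = h ** xdiag N"
    using GL3_inv_cancel(3)[OF iG(1)] by (simp add: h_def matrix_mul_assoc)
  moreover have "matrix_inv k' ** (k' ** (xdiag N ** i')) ** matrix_inv i = xdiag N ** l"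
    unfolding GL3_inv_cancel(2)[OF kG(2)] by (simp add: l_def matrix_mul_assoc)
  ultimately have hl: "h ** xdiag N = xdiag N ** l" by (simp add: matrix_mul_assoc)
  obtain h0 r where h0: "h0 \<in> K" "h = h0 ** mat (\<pi> powi r)" using KZ_cases[OF h] .
  obtain l0 s where l0: "l0 \<in> Iw" "l = l0 ** mat (\<pi> powi s)" using IZ_cases[OF l] .
  note c = xdiag_conj[OF h0(1) l0(1) hl[unfolded h0(2) l0(2)]]
  have "ext h m = \<sigma> h0 m" using ext_eq[OF h0(1)] h0(2) by simp
  also have "\<dots> = \<sigma> l0 m" by (rule sg_inv1_congruent[OF c(1) l0(1) c(2) m_inv1])
  also have "\<dots> = ext l m" using ext_eq[OF Iw_K[OF l0(1)]] l0(2) by simp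
  also have "\<dots> = smul (chi l) m" by (rule ext_m[OF l])
  finally have "ext k m = smul (chi l) (ext k' m)"
    unfolding hk(1) ext_mult[OF k(2) h] by (simp add: ext_scale[OF k(2)])
  moreover have "chi i' = chi l * chi i" using chi_mult[OF l i(1)] hk(2) by simp
  ultimately show ?thesis by (simp add: p q mult.commute)
qed

lemma cell_fun_eq:
  assumes "k \<in> KZ" "i \<in> IZ"
  shows "cell_fun N (k ** xdiag N ** i) = smul (chi i) (ext k m)"
proof -
  have c: "cell N (k ** xdiag N ** i) (k, i)" using assms by (simp add: cell_def)
  then have "cell N (k ** xdiag N ** i) (SOME p. cell N (k ** xdiag N ** i) p)" by (rule someI)
  from cell_unique[OF this c] show ?thesis unfolding cell_fun_def using c by auto
qed

lemma cell_fun_cases: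
  obtains k i where "k \<in> KZ" "i \<in> IZ" "g = k ** xdiag N ** i" "cell_fun N g = smul (chi i) (ext k m)"
  | "cell_fun N g = 0" "\<not> (\<exists>k\<in>KZ. \<exists>i\<in>IZ. g = k ** xdiag N ** i)"
proof (cases "\<exists>k\<in>KZ. \<exists>i\<in>IZ. g = k ** xdiag N ** i")
  case True
  then show ?thesis using that(1) cell_fun_eq by blast
next
  case False
  then have "cell_fun N g = 0" by (auto simp: cell_fun_def cell_def)
  then show ?thesis using that(2) False by blast
qed

lemma cell_fun_left: "h \<in> KZ \<Longrightarrow> cell_fun N (h ** g) = ext h (cell_fun N g)"
proof (cases rule: cell_fun_cases[where g = g and N = N])
  fix k i assume h: "h \<in> KZ" and k: "k \<in> KZ" "i \<in> IZ" "g = k ** xdiag N ** i" "cell_fun N g = smul (chi i) (ext k m)"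
  have "cell_fun N ((h ** k) ** xdiag N ** i) = smul (chi i) (ext (h ** k) m)"
    by (rule cell_fun_eq[OF KZ_mult[OF h k(1)] k(2)])
  then show ?thesis unfolding k(4) using k(3) by (simp add: matrix_mul_assoc ext_mult[OF h k(1)] ext_scale[OF h])
next
  assume h: "h \<in> KZ" and g: "cell_fun N g = 0" "\<not> (\<exists>k\<in>KZ. \<exists>i\<in>IZ. g = k ** xdiag N ** i)"
  have "cell_fun N (h ** g) = 0"
  proof (cases rule: cell_fun_cases[where g = "h ** g" and N = N])
    case (1 k i)
    have "g = (matrix_inv h ** k) ** xdiag N ** i"
      using GL3_inv_cancel(2)[OF KZ_GL3[OF h], of g] 1(3) by (simp add: matrix_mul_assoc)
    then show ?thesis using g(2) KZ_mult[OF KZ_inv[OF h] 1(1)] 1(2) by blast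
  qed
  then show ?thesis using g(1) ext_zero[OF h] by simp
qed

lemma cell_fun_right: "h \<in> IZ \<Longrightarrow> cell_fun N (g ** h) = smul (chi h) (cell_fun N g)"
proof (cases rule: cell_fun_cases[where g = g and N = N])
  fix k i assume h: "h \<in> IZ" and k: "k \<in> KZ" "i \<in> IZ" "g = k ** xdiag N ** i" "cell_fun N g = smul (chi i) (ext k m)"
  have "cell_fun N (k ** xdiag N ** (i ** h)) = smul (chi (i ** h)) (ext k m)"
    by (rule cell_fun_eq[OF k(1) IZ_mult[OF k(2) h]])
  then show ?thesis unfolding k(4) using k(3) by (simp add: matrix_mul_assoc chi_mult[OF k(2) h] mult.commute)
next
  assume h: "h \<in> IZ" and g: "cell_fun N g = 0" "\<not> (\<exists>k\<in>KZ. \<exists>i\<in>IZ. g = k ** xdiag N ** i)"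
  have "cell_fun N (g ** h) = 0"
  proof (cases rule: cell_fun_cases[where g = "g ** h" and N = N])
    case (1 k i)
    have "g = k ** xdiag N ** (i ** matrix_inv h)"
      using GL3_inv_cancel(3)[OF IZ_GL3[OF h], of g] 1(3) by (simp add: matrix_mul_assoc)
    then show ?thesis using g(2) IZ_mult[OF 1(2) IZ_inv[OF h]] 1(1) by blast
  qed
  then show ?thesis using g(1) by simp
qed

lemma cell_fun_bounded: "cell_fun N g \<noteq> 0 \<Longrightarrow> bounded_height (int N) g"
proof (cases rule: cell_fun_cases[where g = g and N = N])
  case (1 k i)
  show ?thesis unfolding 1(3)
    using bounded_height_mult[OF bounded_height_mult[OF KZ_bounded[OF 1(1)] xdiag_bounded] KZ_bounded[OF IZ_KZ[OF 1(2)]]]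
    by simp
qed simp

lemma cell_fun_E: "cell_fun N \<in> E"
  unfolding E_iff W_iff
proof (intro conjI allI impI ballI)
  show "cell_fun N g = 0" if "g \<notin> GL3" for g
    using that cell_fun_bounded bounded_height_GL3 by blast
  show "locally_constant (cell_fun N)"
  proof (rule locally_constantI)
    fix g k :: "'f ^ 3 ^ 3" assume "k \<in> K" "k - mat 1 \<in> L 1"
    then have k: "k \<in> Iwr 1" using L_subset_J[of 1] by (auto simp: Iwr_def)
    then show "cell_fun N (g ** k) = cell_fun N g"
      using cell_fun_right[OF Iw_IZ[OF Iwr_Iw[OF k]], of N g] chi_near_one[OF k] by simp
  qed
  show "\<exists>n. \<forall>g. cell_fun N g \<noteq> 0 \<longrightarrow> bounded_height n g" using cell_fun_bounded by blast
  show "cell_fun N (h ** g) = ext h (cell_fun N g)" if "h \<in> KZ" for h g using cell_fun_left[OF that] .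
  show "right_translation h (cell_fun N) = fun_scale smul (chi h) (cell_fun N)" if "h \<in> IZ" for h
    using cell_fun_right[OF that] by (simp add: right_translation_def fun_scale_def)
qed

lemma cell_fun_xdiag: "cell_fun N (xdiag N) = m"
  using cell_fun_eq[of "mat 1" "mat 1" N] K_KZ[OF K_one] Iw_IZ[OF Iw_one] chi_one ext_K[OF K_one] by simp

section \<open>The submodule\<close>

lemma Top_injective: "f \<in> W \<Longrightarrow> Top f = 0 \<Longrightarrow> f = 0"
  by (rule ccontr) (rule Top_leading[of f], auto)

lemma cell_fun_independent:
  assumes "(\<Sum>N\<le>n. fun_scale smul (c N) (cell_fun N)) \<in> Top ` E" "N \<le> n"
  shows "c N = 0"
proof (rule ccontr)
  assume "c N \<noteq> 0"
  define S where "S = {N. N \<le> n \<and> c N \<noteq> 0}"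
  have S: "finite S" "S \<noteq> {}" using assms(2) \<open>c N \<noteq> 0\<close> by (auto simp: S_def)
  \<comment> \<open>At \<open>xdiag M\<close> the functions with smaller index vanish for reasons of
    height, so this is the only coefficient seen there.\<close>
  define M where "M = Max S"
  have M: "M \<in> S" and le_M: "\<And>N. N \<in> S \<Longrightarrow> N \<le> M" using Max_in[OF S] Max_ge[OF S(1)] by (auto simp: M_def)
  define u where "u = (\<Sum>N\<le>n. fun_scale smul (c N) (cell_fun N))"
  have u_at: "u g = (\<Sum>N\<in>S. smul (c N) (cell_fun N g))" for g
  proof -
    have "u g = (\<Sum>N\<le>n. smul (c N) (cell_fun N g))"
      unfolding u_def by (induction n) (simp_all add: fun_scale_def)
    also have "\<dots> = (\<Sum>N\<in>S. smul (c N) (cell_fun N g))"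
      by (rule sum.mono_neutral_right) (auto simp: S_def)
    finally show ?thesis .
  qed
  have "cell_fun N (xdiag M) = 0" if "N \<in> S - {M}" for N
  proof (rule ccontr)
    assume "cell_fun N (xdiag M) \<noteq> 0"
    then have "int M \<le> int N" by (intro xdiag_not_bounded cell_fun_bounded)
    then show False using le_M[of N] that by auto
  qed
  then have "u (xdiag M) = smul (c M) m"
    unfolding u_at by (subst sum.remove[OF S(1) M]) (simp add: cell_fun_xdiag)
  then have u_M: "u (xdiag M) \<noteq> 0" using M m_nonzero by (simp add: S_def)
  have u_bounded: "bounded_height (int M) g" if "u g \<noteq> 0" for g
  proof -
    have "\<exists>N\<in>S. smul (c N) (cell_fun N g) \<noteq> 0"
    proof (rule ccontr)
      assume "\<not> (\<exists>N\<in>S. smul (c N) (cell_fun N g) \<noteq> 0)"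
      then have "u g = 0" unfolding u_at by (intro sum.neutral) blast
      then show False using that by simp
    qed
    then obtain N where "N \<in> S" "smul (c N) (cell_fun N g) \<noteq> 0" by blast
    then show ?thesis using cell_fun_bounded[of N g] le_M[of N] bounded_height_mono[of "int N" g "int M"] by auto
  qed
  obtain f where f: "f \<in> E" "u = Top f" using assms(1) by (auto simp: u_def)
  have "f \<noteq> 0" using u_M Top_zero f(2) by auto
  moreover have "f \<in> W" using f(1) by (simp add: E_iff)
  ultimately obtain k g where k: "\<And>h. f h \<noteq> 0 \<Longrightarrow> bounded_height k h" "Top f g \<noteq> 0" "\<not> bounded_height (k + 1) g"
    using Top_leading by blast
  have "bounded_height (int M) g" using u_bounded k(2) f(2) by simp
  \<comment> \<open>The image contains a point of height greater than k + 1 and none above M; hence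
    the preimage has height at most M - 2, the range of \<open>Top_xdiag_zero\<close>.\<close>
  then have "k \<le> int M - 2" using k(3) bounded_height_mono[of "int M" g "k + 1"] by linarith
  then have "Top f (xdiag M) = 0" using k(1) bounded_height_mono by (intro Top_xdiag_zero) blast
  then show False using u_M f(2) by simp
qed

lemma E_subspace: "WV.subspace E"
proof (rule WV.subspaceI)
  show "0 \<in> E" unfolding E_iff using WV.subspace_0[OF W_subspace]
    by (simp add: right_translation_def fun_scale_def fun_eq_iff)
  show "x + y \<in> E" if "x \<in> E" "y \<in> E" for x y
    using that WV.subspace_add[OF W_subspace, of x y]
    by (simp add: E_iff right_translation_def fun_scale_def fun_eq_iff V.scale_right_distrib)
  show "fun_scale smul c x \<in> E" if "x \<in> E" for c x
    using that WV.subspace_scale[OF W_subspace, of x c]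
    by (simp add: E_iff right_translation_def fun_scale_def fun_eq_iff V.scale_left_commute)
qed

lemma Top_image_subspace: "WV.subspace (Top ` E)"
proof (rule WV.subspaceI)
  show "0 \<in> Top ` E" using Top_zero WV.subspace_0[OF E_subspace] by (metis imageI)
  fix x y c assume "x \<in> Top ` E"
  then obtain f where f: "f \<in> E" "x = Top f" by blast
  show "fun_scale smul c x \<in> Top ` E"
    using Top_scale[of c f] WV.subspace_scale[OF E_subspace f(1), of c] f(2) by (metis imageI)
  assume "y \<in> Top ` E"
  then obtain f' where f': "f' \<in> E" "y = Top f'" by blast
  show "x + y \<in> Top ` E"
    using Top_add[of f f'] WV.subspace_add[OF E_subspace f(1) f'(1)] f(2) f'(2) by (metis imageI)
qed

text \<open>A Hecke operator sends \<open>Top w'\<close> to \<open>Phi smul (Top w') (T ev)\<close>,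
  which is \<open>Top\<close> of what the same operator makes of \<open>w'\<close>.\<close>

lemma Top_image_submodule:
  "hecke_submodule v chi (fun_scale smul) right_translation W (Top ` E)"
  unfolding hecke_submodule_def E_def[symmetric]
proof (intro conjI ballI)
  show "WV.subspace (Top ` E)" by (rule Top_image_subspace)
  show "Top ` E \<subseteq> E" using Top_E by blast
  fix w T assume "w \<in> Top ` E" and T: "T \<in> hecke_algebra v chi"
  then obtain w' where w': "w' \<in> E" "w = Top w'" by blast
  note h = hecke_action_eq[OF Top_E[OF w'(1)] T]
  have "Phi smul w' (T ev) \<in> E" by (rule Phi_E[OF w'(1) h(2,3)])
  then show "hecke_action v chi (fun_scale smul) right_translation W w T \<in> Top ` E"
    unfolding w'(2) h(1) Phi_Top[OF w'(1) h(2)] by blast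
qed

lemma Top_image_nonzero: "Top ` E \<noteq> {0}"
proof
  assume "Top ` E = {0}"
  then have "Top (cell_fun 0) = 0" using cell_fun_E by blast
  then have "cell_fun 0 = 0" using Top_injective cell_fun_E by (simp add: E_iff)
  then show False using cell_fun_xdiag[of 0] m_nonzero by simp
qed

text \<open>Modulo the image all \<open>cell_fun N\<close> would lie in the span of a finite set,
  and a linear relation between sufficiently many of them contradicts
  \<open>cell_fun_independent\<close>.\<close>

lemma Top_image_infinite_codimension: "infinite_codimension (fun_scale smul) E (Top ` E)"
  unfolding infinite_codimension_def
proof
  assume "\<exists>B. finite B \<and> B \<subseteq> E \<and> E \<subseteq> WV.span (Top ` E \<union> B)"
  then obtain B where B: "finite B" "E \<subseteq> WV.span (Top ` E \<union> B)" by blast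
  have "\<exists>a s. a \<in> Top ` E \<and> s \<in> WV.span B \<and> cell_fun N = a + s" for N
  proof -
    have "cell_fun N \<in> WV.span (Top ` E \<union> B)" using B(2) cell_fun_E by blast
    then have "cell_fun N \<in> {a + s |a s. a \<in> WV.span (Top ` E) \<and> s \<in> WV.span B}" unfolding WV.span_Un .
    moreover have "WV.span (Top ` E) = Top ` E" using Top_image_subspace WV.span_eq_iff by blast
    ultimately show ?thesis by auto
  qed
  then obtain a s where as: "\<And>N. a N \<in> Top ` E" "\<And>N. s N \<in> WV.span B" "\<And>N. cell_fun N = a N + s N" by metis
  \<comment> \<open>The set \<open>{..n}\<close> has one index more than \<open>B\<close> has
    elements.\<close>
  define n where "n = card B"
  have "\<exists>c. (\<Sum>N\<le>n. fun_scale smul (c N) (s N)) = 0 \<and> (\<exists>N\<le>n. c N \<noteq> 0)"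
  proof (cases "inj_on s {..n}")
    case True
    have "card (s ` {..n}) = Suc n" using card_image[OF True] by simp
    moreover have "s ` {..n} \<subseteq> WV.span B" using as(2) by blast
    ultimately have "WV.dependent (s ` {..n})"
      using WV.independent_span_bound[OF B(1), of "s ` {..n}"] by (auto simp: n_def)
    then obtain c where c: "\<exists>x\<in>s ` {..n}. c x \<noteq> 0" "(\<Sum>x\<in>s ` {..n}. fun_scale smul (c x) x) = 0"
      unfolding WV.dependent_finite[OF finite_imageI[OF finite_atMost]] by blast
    have "(\<Sum>N\<le>n. fun_scale smul (c (s N)) (s N)) = 0"
      using c(2) sum.reindex[OF True, of "\<lambda>x. fun_scale smul (c x) x"] by (simp add: o_def)
    then show ?thesis using c(1) by (intro exI[of _ "\<lambda>N. c (s N)"]) auto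
  next
    case False
    \<comment> \<open>Linear dependence is a notion about sets of vectors, so a repeated vector is
      treated apart, by the relation with coefficients 1 and -1.\<close>
    then obtain i j where ij: "i \<le> n" "j \<le> n" "i \<noteq> j" "s i = s j" by (auto simp: inj_on_def)
    let ?c = "\<lambda>N. if N = i then 1 else if N = j then - 1 else 0"
    have "(\<Sum>N\<le>n. fun_scale smul (?c N) (s N)) = (\<Sum>N\<in>{i, j}. fun_scale smul (?c N) (s N))"
      using ij(1,2) by (intro sum.mono_neutral_right) auto
    also have "\<dots> = 0" using ij(3,4) by (simp add: fun_eq_iff fun_scale_def)
    finally show ?thesis using ij(1) by (intro exI[of _ ?c]) auto
  qed
  then obtain c N where c: "(\<Sum>N\<le>n. fun_scale smul (c N) (s N)) = 0" "N \<le> n" "c N \<noteq> 0" by blast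
  have "(\<Sum>N\<le>n. fun_scale smul (c N) (cell_fun N))
      = (\<Sum>N\<le>n. fun_scale smul (c N) (a N)) + (\<Sum>N\<le>n. fun_scale smul (c N) (s N))"
    unfolding as(3) WV.scale_right_distrib by (rule sum.distrib)
  also have "\<dots> = (\<Sum>N\<le>n. fun_scale smul (c N) (a N))" unfolding c(1) by (rule add_0_right)
  also have "\<dots> \<in> Top ` E"
    using as(1) WV.subspace_scale[OF Top_image_subspace] by (intro WV.subspace_sum[OF Top_image_subspace]) blast
  finally have "c N = 0" using c(2) by (rule cell_fun_independent)
  then show False using c(3) by simp
qed

end

section \<open>The concrete coefficient field and the conclusion\<close>

lemma CHAR_mod_ring_alg_closure: "CHAR('p::prime_card mod_ring alg_closure) = CARD('p)"
  by simp

lemma prime_CHAR_alg_closure: "Factorial_Ring.prime CHAR('p::prime_card mod_ring alg_closure)"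
  unfolding CHAR_mod_ring_alg_closure by (rule prime_card)

theorem theorem1p1:
  fixes v :: "'f::field \<Rightarrow> int"
    and \<pi> :: 'f
    and smul :: "'p::prime_card mod_ring alg_closure \<Rightarrow> 'v::ab_group_add \<Rightarrow> 'v"
    and \<sigma> :: "'f ^ 3 ^ 3 \<Rightarrow> 'v \<Rightarrow> 'v"
  assumes "nonarch_local_field v"
    and "uniformizer v \<pi>"
    and "residue_char v = CARD('p)"
    and "vector_space smul"
    and "is_representation smul (GL3_int v) \<sigma>"
    and "smooth_representation v (GL3_int v) \<sigma>"
    and "irreducible_representation smul (GL3_int v) \<sigma>"
  shows "let chi = extend_trivially \<pi> (iwahori v) (invariant_character v smul \<sigma>);
             W = ind_KZ v \<pi> \<sigma>
         in \<exists>M. hecke_submodule v chi (fun_scale smul) right_translation W M \<and> M \<noteq> {0} \<and>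
               infinite_codimension (fun_scale smul)
                 (eigenspace_IZ v chi (fun_scale smul) right_translation W) M"
proof -
  interpret nonarch_local_field v by fact
  interpret vector_space smul by fact
  interpret weight v \<pi> smul \<sigma>
    by unfold_locales (use assms prime_CHAR_alg_closure CHAR_mod_ring_alg_closure in simp_all)
  obtain m \<phi> where "heig m" "inv1 = range (\<lambda>c. smul c m)" "lowfun \<phi>" "\<phi> m = 1"
    using exists_invariant_line by blast
  then interpret weight_line v \<pi> smul \<sigma> m \<phi> by unfold_locales
  show ?thesis
    unfolding Let_def chi_def[symmetric] W_def[symmetric] E_def[symmetric]
    using Top_image_submodule Top_image_nonzero Top_image_infinite_codimension by blast
qed

end
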